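(* Let $n\ge5$ and let $(M,g_0)$ be any compact $n$-dimensional Riemannian manifold. Then $$\inf_{g\in[g_0]}\frac{\int_M\sigma_2(g)\,dvol(g)}{\mathrm{vol}(g)^{\frac{n-4}{n}}}=-\infty,$$ where the infimum is over the entire conformal class $[g_0]$.
   Context: Manifolds are compact without boundary, and metrics are smooth. $[g_0]$ denotes the conformal class of $g_0$. For a metric $g$, $Ric_g$ and $R_g$ are its Ricci and scalar curvature, $dvol(g)$ its volume element, $\mathrm{vol}(g)$ its total volume, $A_g=\frac1{n-2}\left(Ric_g-\frac{R_g}{2(n-1)}g\right)$ its Schouten tensor, and $\sigma_2(g)$ is the second elementary symmetric function of the eigenvalues of $g^{-1}A_g$. *)

theory Defs
  imports
    "HOL-Analysis.Analysis"
    "HOL-Computational_Algebra.Polynomial"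
begin

section \<open>Smooth functions and partial derivatives on open sets\<close>

text \<open>Used for open \<open>S\<close> only.\<close>

primrec ck_on :: "nat \<Rightarrow> (real^'n) set \<Rightarrow> (real^'n \<Rightarrow> 'b::real_normed_vector) \<Rightarrow> bool" where
  "ck_on 0 S f \<longleftrightarrow> continuous_on S f"
| "ck_on (Suc k) S f \<longleftrightarrow>
     (\<forall>x\<in>S. f differentiable (at x)) \<and>
     (\<forall>v. ck_on k S (\<lambda>x. frechet_derivative f (at x) v))"

definition smooth_on :: "(real^'n) set \<Rightarrow> (real^'n \<Rightarrow> 'b::real_normed_vector) \<Rightarrow> bool" where
  "smooth_on S f \<longleftrightarrow> (\<forall>k. ck_on k S f)"

definition pderivative :: "'n \<Rightarrow> (real^'n \<Rightarrow> real) \<Rightarrow> real^'n \<Rightarrow> real" where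
  "pderivative i f x = frechet_derivative f (at x) (axis i 1)"

section \<open>Compact manifolds without boundary\<close>

text \<open>A chart is a pair of its domain and its coordinate map; the values of the coordinate map
  outside the domain are irrelevant. The dimension is \<open>CARD('n)\<close>.\<close>

type_synonym ('a, 'n) chart = "'a set \<times> ('a \<Rightarrow> real^'n)"

definition chart_on :: "'a topology \<Rightarrow> ('a, 'n::finite) chart \<Rightarrow> bool" where
  "chart_on M c \<longleftrightarrow>
     openin M (fst c) \<and> open (snd c ` fst c) \<and>
     homeomorphic_map (subtopology M (fst c)) (top_of_set (snd c ` fst c)) (snd c)"

definition chart_inv :: "('a, 'n::finite) chart \<Rightarrow> real^'n \<Rightarrow> 'a" where
  "chart_inv c = inv_into (fst c) (snd c)"

definition transition :: "('a, 'n::finite) chart \<Rightarrow> ('a, 'n) chart \<Rightarrow> real^'n \<Rightarrow> real^'n" where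
  "transition c d = snd d \<circ> chart_inv c"

definition smooth_atlas :: "'a topology \<Rightarrow> ('a, 'n::finite) chart set \<Rightarrow> bool" where
  "smooth_atlas M \<A> \<longleftrightarrow>
     (\<forall>c\<in>\<A>. chart_on M c) \<and>
     (\<Union>c\<in>\<A>. fst c) = topspace M \<and>
     (\<forall>c\<in>\<A>. \<forall>d\<in>\<A>. smooth_on (snd c ` (fst c \<inter> fst d)) (transition c d))"

definition compact_manifold :: "'a topology \<Rightarrow> ('a, 'n::finite) chart set \<Rightarrow> bool" where
  "compact_manifold M \<A> \<longleftrightarrow>
     topspace M \<noteq> {} \<and> compact_space M \<and> Hausdorff_space M \<and> second_countable M \<and>
     smooth_atlas M \<A>"

definition smooth_function :: "('a, 'n::finite) chart set \<Rightarrow> ('a \<Rightarrow> real) \<Rightarrow> bool" where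
  "smooth_function \<A> f \<longleftrightarrow> (\<forall>c\<in>\<A>. smooth_on (snd c ` fst c) (f \<circ> chart_inv c))"

section \<open>Riemannian metrics and conformal classes\<close>

text \<open>A metric is given by its coordinate matrices: \<open>g c x\<close> is the matrix of the metric in the
  chart \<open>c\<close> at the point with coordinates \<open>x\<close>, and these matrices obey the transformation law of
  covariant 2-tensors. Values for \<open>x\<close> outside the image of \<open>c\<close> are irrelevant.\<close>

type_synonym ('a, 'n) metric_field = "('a, 'n) chart \<Rightarrow> real^'n \<Rightarrow> real^'n^'n"

definition riemannian_metric ::
    "('a, 'n::finite) chart set \<Rightarrow> ('a, 'n) metric_field \<Rightarrow> bool" where
  "riemannian_metric \<A> g \<longleftrightarrow>
     (\<forall>c\<in>\<A>. smooth_on (snd c ` fst c) (g c)) \<and>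
     (\<forall>c\<in>\<A>. \<forall>x\<in>snd c ` fst c.
        transpose (g c x) = g c x \<and> (\<forall>v. v \<noteq> 0 \<longrightarrow> v \<bullet> (g c x *v v) > 0)) \<and>
     (\<forall>c\<in>\<A>. \<forall>d\<in>\<A>. \<forall>x\<in>snd c ` (fst c \<inter> fst d).
        let J = matrix (frechet_derivative (transition c d) (at x))
        in g c x = transpose J ** g d (transition c d x) ** J)"

definition conformal_class ::
    "('a, 'n::finite) chart set \<Rightarrow> ('a, 'n) metric_field \<Rightarrow> ('a, 'n) metric_field set" where
  "conformal_class \<A> g0 =
     {g. riemannian_metric \<A> g \<and>
         (\<exists>f. smooth_function \<A> f \<and>
              (\<forall>c\<in>\<A>. \<forall>p\<in>fst c. f p > 0 \<and> g c (snd c p) = f p *\<^sub>R g0 c (snd c p)))}"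

section \<open>Curvature in coordinates\<close>

text \<open>Here \<open>G\<close> is the coordinate matrix of a metric on an open subset of Euclidean space.
  \<open>riemann G l k i j\<close> is the \<open>l\<close>-th component of
  \<open>R(e\<^sub>i, e\<^sub>j) e\<^sub>k = \<nabla>\<^sub>i \<nabla>\<^sub>j e\<^sub>k - \<nabla>\<^sub>j \<nabla>\<^sub>i e\<^sub>k\<close>;
  with this convention the round sphere has positive Ricci curvature.\<close>

definition christoffel ::
    "(real^'n \<Rightarrow> real^'n^'n) \<Rightarrow> 'n::finite \<Rightarrow> 'n \<Rightarrow> 'n \<Rightarrow> real^'n \<Rightarrow> real" where
  "christoffel G k i j x =
     (\<Sum>l\<in>UNIV. matrix_inv (G x) $ k $ l *
        (pderivative i (\<lambda>y. G y $ j $ l) x + pderivative j (\<lambda>y. G y $ i $ l) x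
         - pderivative l (\<lambda>y. G y $ i $ j) x)) / 2"

definition riemann ::
    "(real^'n \<Rightarrow> real^'n^'n) \<Rightarrow> 'n::finite \<Rightarrow> 'n \<Rightarrow> 'n \<Rightarrow> 'n \<Rightarrow> real^'n \<Rightarrow> real" where
  "riemann G l k i j x =
     pderivative i (christoffel G l j k) x - pderivative j (christoffel G l i k) x
     + (\<Sum>m\<in>UNIV. christoffel G l i m x * christoffel G m j k x
                  - christoffel G l j m x * christoffel G m i k x)"

definition ricci :: "(real^'n \<Rightarrow> real^'n^'n) \<Rightarrow> real^'n \<Rightarrow> real^'n^'n::finite" where
  "ricci G x = (\<chi> j k. \<Sum>i\<in>UNIV. riemann G i k i j x)"

definition scalar_curvature :: "(real^'n \<Rightarrow> real^'n^'n) \<Rightarrow> real^'n::finite \<Rightarrow> real" where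
  "scalar_curvature G x = (\<Sum>i\<in>UNIV. \<Sum>j\<in>UNIV. matrix_inv (G x) $ i $ j * ricci G x $ i $ j)"

definition schouten :: "(real^'n \<Rightarrow> real^'n^'n) \<Rightarrow> real^'n \<Rightarrow> real^'n^'n::finite" where
  "schouten G x =
     (1 / (real CARD('n) - 2)) *\<^sub>R
       (ricci G x - (scalar_curvature G x / (2 * (real CARD('n) - 1))) *\<^sub>R G x)"

section \<open>Elementary symmetric functions of eigenvalues\<close>

definition charpoly :: "real^'n^'n \<Rightarrow> real poly" where
  "charpoly B = det (\<chi> i j. (if i = j then [:0, 1:] else 0) - [:B $ i $ j:])"

text \<open>The real eigenvalues, listed with algebraic multiplicity. For a matrix that is self-adjoint
  with respect to an inner product, such as \<open>g\<inverse>A\<^sub>g\<close>, these are all the eigenvalues.\<close>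

definition eigenvalues :: "real^'n^'n \<Rightarrow> real list" where
  "eigenvalues B = sorted_list_of_multiset (proots (charpoly B))"

definition elem_sym :: "nat \<Rightarrow> real list \<Rightarrow> real" where
  "elem_sym k xs = (\<Sum>S | S \<subseteq> {..<length xs} \<and> card S = k. \<Prod>i\<in>S. xs ! i)"

definition local_sigma2 :: "(real^'n \<Rightarrow> real^'n^'n) \<Rightarrow> real^'n::finite \<Rightarrow> real" where
  "local_sigma2 G x = elem_sym 2 (eigenvalues (matrix_inv (G x) ** schouten G x))"

section \<open>Global quantities\<close>

text \<open>The eigenvalues of \<open>g\<inverse>A\<^sub>g\<close> at a point do not depend on the chart in which they are computed.
  We evaluate them in the first chart around the point in a fixed finite list of charts covering
  the (compact) manifold.\<close>

definition chart_cover :: "'a topology \<Rightarrow> ('a, 'n::finite) chart set \<Rightarrow> ('a, 'n) chart list" where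
  "chart_cover M \<A> = (SOME cs. set cs \<subseteq> \<A> \<and> (\<Union>c\<in>set cs. fst c) = topspace M)"

definition chart_at :: "'a topology \<Rightarrow> ('a, 'n::finite) chart set \<Rightarrow> 'a \<Rightarrow> ('a, 'n) chart" where
  "chart_at M \<A> p = the (find (\<lambda>c. p \<in> fst c) (chart_cover M \<A>))"

definition sigma2 ::
    "'a topology \<Rightarrow> ('a, 'n::finite) chart set \<Rightarrow> ('a, 'n) metric_field \<Rightarrow> 'a \<Rightarrow> real" where
  "sigma2 M \<A> g p = (let c = chart_at M \<A> p in local_sigma2 (g c) (snd c p))"

text \<open>The Riemannian volume is the unique Borel measure on \<open>M\<close> that in every chart has the
  density \<open>sqrt (det g)\<close> with respect to Lebesgue measure.\<close>

definition riemannian_volume ::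
    "'a topology \<Rightarrow> ('a, 'n::finite) chart set \<Rightarrow> ('a, 'n) metric_field \<Rightarrow> 'a measure" where
  "riemannian_volume M \<A> g =
     (THE \<mu>. space \<mu> = topspace M \<and>
            sets \<mu> = sigma_sets (topspace M) {U. openin M U} \<and>
            (\<forall>c\<in>\<A>. \<forall>B\<in>sets \<mu>. B \<subseteq> fst c \<longrightarrow>
               emeasure \<mu> B = (\<integral>\<^sup>+x\<in>snd c ` B. ennreal (sqrt (det (g c x))) \<partial>lborel)))"

definition total_volume ::
    "'a topology \<Rightarrow> ('a, 'n::finite) chart set \<Rightarrow> ('a, 'n) metric_field \<Rightarrow> real" where
  "total_volume M \<A> g = measure (riemannian_volume M \<A> g) (topspace M)"

definition total_sigma2 ::
    "'a topology \<Rightarrow> ('a, 'n::finite) chart set \<Rightarrow> ('a, 'n) metric_field \<Rightarrow> real" where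
  "total_sigma2 M \<A> g = (LINT p|riemannian_volume M \<A> g. sigma2 M \<A> g p)"

end

theory Submission
  imports Defs
begin

text \<open>
  Under \<open>g = e\<^bsup>2w\<^esup> g\<^sub>0\<close> the integral of \<open>\<sigma>\<^sub>2\<close> turns into the integral of \<open>e\<^bsup>(n-4)w\<^esup>\<close> times a quartic
  expression in the first and second derivatives of \<open>w\<close>, plus terms of lower order. Let \<open>w\<close> oscillate
  fast in one coordinate direction of one chart, \<open>w = \<eta> sin (k x\<^sub>e)\<close> with a fixed bump function \<open>\<eta>\<close>
  supported in the chart. Then \<open>w\<close> and the volume stay bounded as \<open>k\<close> grows, while the quartic
  expression has size \<open>k\<^sup>4\<close>. With \<open>p\<close> and \<open>q\<close> the leading parts of \<open>\<partial>\<^sub>e w\<close> and \<open>\<partial>\<^sub>e \<partial>\<^sub>e w\<close>, the Schouten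
  tensor of \<open>g\<close> is \<open>(p\<^sup>2 - q) dx\<^sub>e \<otimes> dx\<^sub>e - (p\<^sup>2/2) |dx\<^sub>e|\<^sup>2 g\<^sub>0\<close> up to \<open>O(k)\<close>, a multiple of \<open>g\<^sub>0\<close> plus
  a rank one term, and so
  \<open>e\<^bsup>4w\<^esup> \<sigma>\<^sub>2(g) = |dx\<^sub>e|\<^sup>4 ((n-1)/2 p\<^sup>2 q + (n-1)(n-4)/8 p\<^sup>4) + O(k\<^sup>3)\<close> (lemma \<open>sigma2_expansion\<close>).
  The first term is indefinite, but integrating the derivative of
  \<open>e\<^bsup>(n-4)w\<^esup> \<rho> p\<^sup>3\<close> over the support shows that in the mean \<open>p\<^sup>2 q\<close> counts as \<open>- (n-4)/3 p\<^sup>4\<close>.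
  The total coefficient of \<open>p\<^sup>4\<close> becomes \<open>(n-1)(n-4)(1/8 - 1/6)\<close>, which is negative exactly
  because \<open>n > 4\<close>; hence the total \<open>\<sigma>\<^sub>2\<close> tends to minus infinity like \<open>- k\<^sup>4\<close>
  (lemma \<open>intL_Phi_unbounded\<close>), and dividing by a power of the bounded volume changes nothing.

  Only the leading order in \<open>k\<close> matters, so the conformal change of curvature is computed modulo
  lower order (\<open>of_order\<close>) instead of exactly; derivatives of the background metric then go
  into the error terms.

  To conclude on the manifold, three facts about the global quantities are needed. The value of
  \<open>\<sigma>\<^sub>2\<close> is independent of the chart (\<open>local_sigma2_transform\<close>); this makes it a continuous and
  hence integrable function, which a function evaluated in varying charts need not be.
  The Riemannian volume exists and is unique (\<open>ex_volume\<close>, \<open>volume_unique\<close>), by the change of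
  variables formula. Finally \<open>\<sigma>\<^sub>2\<close> is given by traces, since the eigenvalues of a self-adjoint
  matrix are all real (\<open>sigma2_self_adjoint\<close>); this makes it a smooth function of the metric and
  its derivatives, and computable to leading order.
\<close>

section \<open>Smooth functions on open sets\<close>

lemma ck_on_subset: "ck_on k S f \<Longrightarrow> T \<subseteq> S \<Longrightarrow> ck_on k T f"
  by (induction k arbitrary: f) (auto intro: continuous_on_subset)

lemma ck_on_Suc_imp: "ck_on (Suc k) S f \<Longrightarrow> ck_on k S f"
proof (induction k arbitrary: f)
  case 0
  then show ?case
    by (auto intro!: continuous_at_imp_continuous_on differentiable_imp_continuous_within)
next
  case (Suc k)
  show ?case
    unfolding ck_on.simps(2)[of k]
  proof (intro conjI allI)
    show "\<forall>x\<in>S. f differentiable at x"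
      using Suc.prems by simp
    fix v
    have "ck_on (Suc k) S (\<lambda>x. frechet_derivative f (at x) v)"
      using Suc.prems ck_on.simps(2)[of "Suc k"] by blast
    then show "ck_on k S (\<lambda>x. frechet_derivative f (at x) v)"
      by (rule Suc.IH)
  qed
qed

lemma ck_on_cong:
  assumes "open S" "\<And>x. x \<in> S \<Longrightarrow> f x = g x" "ck_on k S f"
  shows "ck_on k S g"
  using assms(2,3)
proof (induction k arbitrary: f g)
  case 0
  then show ?case
    using continuous_on_cong[of S S f g] by simp
next
  case (Suc k)
  have d: "f differentiable at x" if "x \<in> S" for x
    using Suc.prems that by simp
  have e: "frechet_derivative f (at x) = frechet_derivative g (at x)" if "x \<in> S" for x
    by (rule frechet_derivative_transform_within_open[OF d[OF that] assms(1) that Suc.prems(1)])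
  have "g differentiable at x" if x: "x \<in> S" for x
  proof -
    obtain D where "(f has_derivative D) (at x)"
      using d[OF x] unfolding differentiable_def ..
    then have "(g has_derivative D) (at x)"
      by (rule has_derivative_transform_within_open[OF _ assms(1) x]) (rule Suc.prems(1))
    then show ?thesis unfolding differentiable_def by (rule exI[where x = D])
  qed
  moreover have "ck_on k S (\<lambda>x. frechet_derivative g (at x) v)" for v
    by (rule Suc.IH[of "\<lambda>x. frechet_derivative f (at x) v"]) (use Suc.prems(2) in \<open>auto simp: e\<close>)
  ultimately show ?case by simp
qed

lemma ck_on_SucI:
  assumes "open S" "\<And>x. x \<in> S \<Longrightarrow> (f has_derivative D x) (at x)"
    and "\<And>v. ck_on k S (\<lambda>x. D x v)"
  shows "ck_on (Suc k) S f"
proof -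
  have "frechet_derivative f (at x) = D x" if "x \<in> S" for x
    using frechet_derivative_at[OF assms(2)[OF that]] by simp
  then have "ck_on k S (\<lambda>x. frechet_derivative f (at x) v)" for v
    using ck_on_cong[OF assms(1) _ assms(3)[of v], of "\<lambda>x. frechet_derivative f (at x) v"] by simp
  moreover have "f differentiable at x" if "x \<in> S" for x
    using assms(2)[OF that] unfolding differentiable_def by blast
  ultimately show ?thesis by simp
qed

lemma ck_on_SucD:
  assumes "ck_on (Suc k) S f" "x \<in> S"
  shows "(f has_derivative frechet_derivative f (at x)) (at x)"
  using assms by (auto simp: frechet_derivative_works)

text \<open>Used to glue a function defined by different formulas on overlapping open sets.\<close>

lemma ck_on_locally:
  assumes "open S" "\<And>x. x \<in> S \<Longrightarrow> \<exists>T. open T \<and> x \<in> T \<and> ck_on k T f"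
  shows "ck_on k S f"
  using assms(2)
proof (induction k arbitrary: f)
  case 0
  then have "isCont f x" if "x \<in> S" for x
    using that by (metis ck_on.simps(1) continuous_on_eq_continuous_at)
  then show ?case by (simp add: continuous_at_imp_continuous_on)
next
  case (Suc k)
  have "f differentiable at x" if "x \<in> S" for x
    using Suc.prems[OF that] by auto
  moreover have "ck_on k S (\<lambda>x. frechet_derivative f (at x) v)" for v
    by (rule Suc.IH) (use Suc.prems in fastforce)
  ultimately show ?case by simp
qed

lemma ck_on_const: "open S \<Longrightarrow> ck_on k S (\<lambda>x. c)"
proof (induction k arbitrary: c)
  case (Suc k)
  show ?case by (rule ck_on_SucI[OF Suc.prems has_derivative_const]) (rule Suc.IH[OF Suc.prems])
qed simp

lemma ck_on_linear:
  assumes "open S" "bounded_linear L"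
  shows "ck_on k S L"
proof (cases k)
  case 0
  then show ?thesis
    using assms(2) by (simp add: linear_continuous_on)
next
  case (Suc m)
  show ?thesis unfolding Suc
    by (rule ck_on_SucI[OF assms(1) bounded_linear.has_derivative[OF assms(2) has_derivative_ident]])
       (simp add: ck_on_const assms)
qed

lemma ck_on_add:
  "open S \<Longrightarrow> ck_on k S f \<Longrightarrow> ck_on k S g \<Longrightarrow> ck_on k S (\<lambda>x. f x + g x)"
proof (induction k arbitrary: f g)
  case 0
  then show ?case by (simp add: continuous_on_add)
next
  case (Suc k)
  show ?case
    by (rule ck_on_SucI[OF Suc.prems(1) has_derivative_add[OF ck_on_SucD[OF Suc.prems(2)]
              ck_on_SucD[OF Suc.prems(3)]]])
       (use Suc in auto)
qed

lemma ck_on_bilinear: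
  assumes "bounded_bilinear b" "open S"
  shows "ck_on k S f \<Longrightarrow> ck_on k S g \<Longrightarrow> ck_on k S (\<lambda>x. b (f x) (g x))"
proof (induction k arbitrary: f g)
  case 0
  then show ?case using bounded_bilinear.continuous_on[OF assms(1)] by simp
next
  case (Suc k)
  show ?case
    by (rule ck_on_SucI[OF assms(2) bounded_bilinear.FDERIV[OF assms(1) ck_on_SucD[OF Suc.prems(1)]
              ck_on_SucD[OF Suc.prems(2)]]])
       (use Suc ck_on_Suc_imp[OF Suc.prems(1)] ck_on_Suc_imp[OF Suc.prems(2)]
         in \<open>auto intro!: ck_on_add assms(2)\<close>)
qed

lemma ck_on_bounded_linear:
  assumes "bounded_linear L" "open S"
  shows "ck_on k S f \<Longrightarrow> ck_on k S (\<lambda>x. L (f x))"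
proof (induction k arbitrary: f)
  case 0
  then show ?case
    using bounded_linear.continuous_on[OF assms(1)] by simp
next
  case (Suc k)
  show ?case
    by (rule ck_on_SucI[OF assms(2) bounded_linear.has_derivative[OF assms(1) ck_on_SucD[OF Suc.prems(1)]]])
       (use Suc in auto)
qed

lemma ck_on_sum:
  assumes "open S" "\<And>i. i \<in> I \<Longrightarrow> ck_on k S (f i)"
  shows "ck_on k S (\<lambda>x. \<Sum>i\<in>I. f i x)"
  using assms(2) by (induction I rule: infinite_finite_induct) (auto intro: ck_on_const ck_on_add assms(1))

text \<open>Closure under composition with elementary functions is proved for a whole family at once:
  a family of real functions that contains a derivative of each member consists of smooth
  functions.\<close>

lemma ck_on_compose_real:
  assumes "open S"
    and F: "\<And>h. h \<in> F \<Longrightarrow> \<exists>h'\<in>F. \<forall>y\<in>T. (h has_real_derivative h' y) (at y)"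
    and T: "u ` S \<subseteq> T"
  shows "ck_on k S u \<Longrightarrow> h \<in> F \<Longrightarrow> ck_on k S (\<lambda>x. h (u x))"
proof (induction k arbitrary: h)
  case 0
  obtain h' where "\<forall>y\<in>T. (h has_real_derivative h' y) (at y)" using F[OF 0(2)] by blast
  then have "continuous_on T h" by (meson DERIV_isCont continuous_at_imp_continuous_on)
  then show ?case using 0 T by (auto intro: continuous_on_compose2)
next
  case (Suc k)
  obtain h' where h': "h' \<in> F" "\<forall>y\<in>T. (h has_real_derivative h' y) (at y)"
    using F[OF Suc.prems(2)] by blast
  have 1: "((\<lambda>x. h (u x)) has_derivative (\<lambda>v. h' (u x) * frechet_derivative u (at x) v)) (at x)"
    if "x \<in> S" for x
  proof -
    have "(h has_derivative (*) (h' (u x))) (at (u x))"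
      using h' T that by (auto simp: has_field_derivative_def)
    from has_derivative_compose[OF ck_on_SucD[OF Suc.prems(1) that] this] show ?thesis .
  qed
  have "ck_on k S (\<lambda>x. h' (u x))"
    using ck_on_Suc_imp[OF Suc.prems(1)] h'(1) by (rule Suc.IH)
  then have "ck_on k S (\<lambda>x. h' (u x) * frechet_derivative u (at x) v)" for v
    using Suc.prems(1) by (intro ck_on_bilinear[OF bounded_bilinear_mult assms(1)]) auto
  from ck_on_SucI[OF assms(1) 1 this] show ?case .
qed

lemma ck_on_compose:
  fixes T :: "real^'m \<Rightarrow> real^'n" and f :: "real^'n \<Rightarrow> 'b::real_normed_vector"
  assumes "open S" and TS: "T ` S \<subseteq> U"
  shows "ck_on k S T \<Longrightarrow> ck_on k U f \<Longrightarrow> ck_on k S (\<lambda>x. f (T x))"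
proof (induction k arbitrary: f)
  case 0
  then show ?case using TS by (auto intro: continuous_on_compose2)
next
  case (Suc k)
  define D where "D = (\<lambda>x v. \<Sum>i\<in>UNIV. (frechet_derivative T (at x) v $ i) *\<^sub>R
      frechet_derivative f (at (T x)) (axis i 1))"
  have 1: "((\<lambda>x. f (T x)) has_derivative D x) (at x)" if x: "x \<in> S" for x
  proof -
    have Tx: "T x \<in> U" using x TS by auto
    have f: "(f has_derivative frechet_derivative f (at (T x))) (at (T x))"
      by (rule ck_on_SucD[OF Suc.prems(2) Tx])
    then have l: "linear (frechet_derivative f (at (T x)))"
      by (rule has_derivative_linear)
    have E: "frechet_derivative f (at (T x)) w =
      (\<Sum>i\<in>UNIV. (w $ i) *\<^sub>R frechet_derivative f (at (T x)) (axis i 1))" for w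
    proof -
      have "frechet_derivative f (at (T x)) w =
         frechet_derivative f (at (T x)) (\<Sum>i\<in>UNIV. (w $ i) *\<^sub>R axis i 1)"
        by (simp only: basis_expansion[of w, unfolded scalar_mult_eq_scaleR])
      also have "\<dots> = (\<Sum>i\<in>UNIV. frechet_derivative f (at (T x)) ((w $ i) *\<^sub>R axis i 1))"
        by (rule linear_sum[OF l])
      also have "\<dots> = (\<Sum>i\<in>UNIV. (w $ i) *\<^sub>R frechet_derivative f (at (T x)) (axis i 1))"
        by (simp only: linear_cmul[OF l])
      finally show ?thesis .
    qed
    have "D x = (\<lambda>v. frechet_derivative f (at (T x)) (frechet_derivative T (at x) v))"
      unfolding D_def by (rule ext) (rule E[symmetric])
    then show ?thesis
      using has_derivative_compose[OF ck_on_SucD[OF Suc.prems(1) x] f] by simp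
  qed
  have "ck_on k S (\<lambda>x. frechet_derivative f (at (T x)) (axis i 1))" for i
    using Suc.prems ck_on_Suc_imp[OF Suc.prems(1)] by (intro Suc.IH) auto
  moreover have "ck_on k S (\<lambda>x. frechet_derivative T (at x) v $ i)" for i v
    using Suc.prems(1) by (intro ck_on_bounded_linear[OF bounded_linear_vec_nth assms(1)]) auto
  ultimately have "ck_on k S (\<lambda>x. D x v)" for v
    unfolding D_def by (intro ck_on_sum ck_on_bilinear[OF bounded_bilinear_scaleR] assms(1)) auto
  from ck_on_SucI[OF assms(1) 1 this] show ?case .
qed

subsection \<open>Rules for smooth functions\<close>

lemma smooth_on_subset: "smooth_on S f \<Longrightarrow> T \<subseteq> S \<Longrightarrow> smooth_on T f"
  unfolding smooth_on_def using ck_on_subset by blast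

lemma smooth_on_cong:
  "open S \<Longrightarrow> (\<And>x. x \<in> S \<Longrightarrow> f x = g x) \<Longrightarrow> smooth_on S f \<Longrightarrow> smooth_on S g"
  unfolding smooth_on_def using ck_on_cong by blast

lemma smooth_on_locally:
  "open S \<Longrightarrow> (\<And>x. x \<in> S \<Longrightarrow> \<exists>T. open T \<and> x \<in> T \<and> smooth_on T f) \<Longrightarrow> smooth_on S f"
  unfolding smooth_on_def by (meson ck_on_locally)

lemma smooth_on_const [intro]: "open S \<Longrightarrow> smooth_on S (\<lambda>x. c)"
  by (simp add: smooth_on_def ck_on_const)

lemma smooth_on_linear: "open S \<Longrightarrow> bounded_linear L \<Longrightarrow> smooth_on S L"
  by (simp add: smooth_on_def ck_on_linear)

lemma smooth_on_component: "open S \<Longrightarrow> smooth_on S (\<lambda>x. x $ i)"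
  by (rule smooth_on_linear[OF _ bounded_linear_vec_nth])

lemma smooth_on_add [intro]:
  "open S \<Longrightarrow> smooth_on S f \<Longrightarrow> smooth_on S g \<Longrightarrow> smooth_on S (\<lambda>x. f x + g x)"
  by (simp add: smooth_on_def ck_on_add)

lemma smooth_on_bounded_linear:
  "bounded_linear L \<Longrightarrow> open S \<Longrightarrow> smooth_on S f \<Longrightarrow> smooth_on S (\<lambda>x. L (f x))"
  by (simp add: smooth_on_def ck_on_bounded_linear)

lemma smooth_on_vec_nth [intro]:
  "open S \<Longrightarrow> smooth_on S f \<Longrightarrow> smooth_on S (\<lambda>x. f x $ i)"
  by (rule smooth_on_bounded_linear[OF bounded_linear_vec_nth])

lemma smooth_on_minus [intro]:
  "open S \<Longrightarrow> smooth_on S f \<Longrightarrow> smooth_on S (\<lambda>x. - f x)"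
  by (rule smooth_on_bounded_linear[OF bounded_linear_minus[OF bounded_linear_ident]])

lemma smooth_on_diff [intro]:
  "open S \<Longrightarrow> smooth_on S f \<Longrightarrow> smooth_on S g \<Longrightarrow> smooth_on S (\<lambda>x. f x - g x)"
  using smooth_on_add[of S f "\<lambda>x. - g x"] by (auto intro: smooth_on_minus)

lemma smooth_on_scaleR [intro]:
  "open S \<Longrightarrow> smooth_on S f \<Longrightarrow> smooth_on S g \<Longrightarrow> smooth_on S (\<lambda>x. f x *\<^sub>R g x)"
  by (simp add: smooth_on_def ck_on_bilinear[OF bounded_bilinear_scaleR])

lemma smooth_on_mult [intro]:
  fixes f g :: "real^'n \<Rightarrow> real"
  shows "open S \<Longrightarrow> smooth_on S f \<Longrightarrow> smooth_on S g \<Longrightarrow> smooth_on S (\<lambda>x. f x * g x)"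
  by (simp add: smooth_on_def ck_on_bilinear[OF bounded_bilinear_mult])

lemma smooth_on_sum [intro]:
  "open S \<Longrightarrow> (\<And>i. i \<in> I \<Longrightarrow> smooth_on S (f i)) \<Longrightarrow> smooth_on S (\<lambda>x. \<Sum>i\<in>I. f i x)"
  by (simp add: smooth_on_def ck_on_sum)

lemma smooth_on_prod [intro]:
  fixes f :: "'i \<Rightarrow> real^'n \<Rightarrow> real"
  shows "open S \<Longrightarrow> (\<And>i. i \<in> I \<Longrightarrow> smooth_on S (f i)) \<Longrightarrow> smooth_on S (\<lambda>x. \<Prod>i\<in>I. f i x)"
  by (induction I rule: infinite_finite_induct) auto

lemma smooth_on_power [intro]:
  fixes f :: "real^'n \<Rightarrow> real"
  shows "open S \<Longrightarrow> smooth_on S f \<Longrightarrow> smooth_on S (\<lambda>x. f x ^ m)"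
  by (induction m) auto

lemma smooth_on_divide_const [intro]:
  fixes f :: "real^'n \<Rightarrow> real"
  shows "open S \<Longrightarrow> smooth_on S f \<Longrightarrow> smooth_on S (\<lambda>x. f x / c)"
  using smooth_on_mult[of S f "\<lambda>_. inverse c"] by (auto simp: divide_inverse)

lemma smooth_on_compose_real:
  assumes "open S" "\<And>h. h \<in> F \<Longrightarrow> \<exists>h'\<in>F. \<forall>y\<in>T. (h has_real_derivative h' y) (at y)"
    and "u ` S \<subseteq> T" "smooth_on S u" "h \<in> F"
  shows "smooth_on S (\<lambda>x. h (u x))"
  using assms ck_on_compose_real[OF assms(1,2,3)] by (simp add: smooth_on_def)

lemma smooth_on_compose:
  fixes T :: "real^'m \<Rightarrow> real^'n" and f :: "real^'n \<Rightarrow> 'b::real_normed_vector"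
  shows "open S \<Longrightarrow> T ` S \<subseteq> U \<Longrightarrow> smooth_on S T \<Longrightarrow> smooth_on U f \<Longrightarrow> smooth_on S (\<lambda>x. f (T x))"
  by (simp add: smooth_on_def ck_on_compose)

lemma smooth_on_exp [intro]: "open S \<Longrightarrow> smooth_on S u \<Longrightarrow> smooth_on S (\<lambda>x. exp (u x :: real))"
  by (rule smooth_on_compose_real[where F = "{exp}" and T = UNIV]) (auto intro: DERIV_exp)

lemma smooth_on_powr_const:
  assumes "open S" "smooth_on S u" "\<And>x. x \<in> S \<Longrightarrow> u x > (0::real)"
  shows "smooth_on S (\<lambda>x. u x powr a)"
proof (rule smooth_on_compose_real[where F = "{\<lambda>y. c * y powr a |c a. True}" and T = "{0<..}" and h = "\<lambda>y. y powr a"])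
  fix h :: "real \<Rightarrow> real" assume "h \<in> {\<lambda>y. c * y powr a |c a. True}"
  then obtain c b where h: "h = (\<lambda>y. c * y powr b)" by auto
  have "\<forall>y\<in>{0<..}. (h has_real_derivative (c * b) * y powr (b - 1)) (at y)"
    unfolding h by (auto intro!: derivative_eq_intros)
  moreover have "(\<lambda>y. (c * b) * y powr (b - 1)) \<in> {\<lambda>y. c * y powr a |c a. True}"
    by (rule CollectI, intro exI conjI, rule refl, rule TrueI)
  ultimately show "\<exists>h'\<in>{\<lambda>y. c * y powr a |c a. True}. \<forall>y\<in>{0<..}. (h has_real_derivative h' y) (at y)"
    by (rule bexI)
next
  have "(\<lambda>y::real. y powr a) = (\<lambda>y. 1 * y powr a)" by simp
  then show "(\<lambda>y. y powr a) \<in> {\<lambda>y. c * y powr a |c a. True}" by blast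
qed (use assms in auto)

lemma smooth_on_inverse:
  assumes "open S" "smooth_on S u" "\<And>x. x \<in> S \<Longrightarrow> u x \<noteq> (0::real)"
  shows "smooth_on S (\<lambda>x. inverse (u x))"
proof (rule smooth_on_compose_real[where F = "{\<lambda>y. c * inverse y ^ m |c m. True}" and T = "-{0}" and h = inverse])
  fix h :: "real \<Rightarrow> real" assume "h \<in> {\<lambda>y. c * inverse y ^ m |c m. True}"
  then obtain c m where h: "h = (\<lambda>y. c * inverse y ^ m)" by auto
  have "(h has_real_derivative (- c * real m) * inverse y ^ (m + 1)) (at y)" if "y \<noteq> 0" for y
  proof (cases m)
    case (Suc j)
    show ?thesis unfolding h Suc
      by (rule derivative_eq_intros refl that)+ (use that in \<open>simp add: field_simps power2_eq_square\<close>)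
  qed (simp add: h)
  then have "\<forall>y\<in>-{0}. (h has_real_derivative (- c * real m) * inverse y ^ (m + 1)) (at y)" by blast
  moreover have "(\<lambda>y. (- c * real m) * inverse y ^ (m + 1)) \<in> {\<lambda>y. c * inverse y ^ m |c m. True}"
    by (rule CollectI, intro exI conjI, rule refl, rule TrueI)
  ultimately show "\<exists>h'\<in>{\<lambda>y. c * inverse y ^ m |c m. True}. \<forall>y\<in>-{0}. (h has_real_derivative h' y) (at y)"
    by (rule bexI)
next
  have "inverse = (\<lambda>y::real. 1 * inverse y ^ 1)" by auto
  then show "(inverse :: real \<Rightarrow> real) \<in> {\<lambda>y. c * inverse y ^ m |c m. True}" by blast
qed (use assms in auto)

lemma smooth_on_divide:
  fixes f u :: "real^'n \<Rightarrow> real"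
  assumes "open S" "smooth_on S f" "smooth_on S u" "\<And>x. x \<in> S \<Longrightarrow> u x \<noteq> 0"
  shows "smooth_on S (\<lambda>x. f x / u x)"
  unfolding divide_inverse using assms by (intro smooth_on_mult smooth_on_inverse) auto

lemma smooth_on_sin_cos:
  assumes "open S" "smooth_on S u"
  shows "smooth_on S (\<lambda>x. sin (u x :: real))" "smooth_on S (\<lambda>x. cos (u x :: real))"
proof -
  let ?F = "{\<lambda>y. a * sin y + b * cos y |a b. True} :: (real \<Rightarrow> real) set"
  have F: "\<exists>h'\<in>?F. \<forall>y\<in>UNIV. (h has_real_derivative h' y) (at y)" if "h \<in> ?F" for h
  proof -
    from that obtain a b where h: "h = (\<lambda>y. a * sin y + b * cos y)" by auto
    have "(h has_real_derivative (- b) * sin y + a * cos y) (at y)" for y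
      unfolding h by (auto intro!: derivative_eq_intros)
    then have "\<forall>y\<in>UNIV. (h has_real_derivative (- b) * sin y + a * cos y) (at y)" by blast
    moreover have "(\<lambda>y. (- b) * sin y + a * cos y) \<in> ?F"
      by (rule CollectI, intro exI conjI, rule refl, rule TrueI)
    ultimately show ?thesis by (rule bexI)
  qed
  have "sin = (\<lambda>y::real. 1 * sin y + 0 * cos y)" "cos = (\<lambda>y::real. 0 * sin y + 1 * cos y)" by auto
  then have "sin \<in> ?F" "cos \<in> ?F" by blast+
  then show "smooth_on S (\<lambda>x. sin (u x :: real))" "smooth_on S (\<lambda>x. cos (u x :: real))"
    using smooth_on_compose_real[OF assms(1) F, of u] assms by auto
qed

lemma smooth_on_frechet_derivative:
  "smooth_on S f \<Longrightarrow> smooth_on S (\<lambda>x. frechet_derivative f (at x) v)"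
  unfolding smooth_on_def by (metis ck_on.simps(2))

lemma smooth_on_pderivative [intro]:
  "smooth_on S f \<Longrightarrow> smooth_on S (pderivative i f)"
  using smooth_on_frechet_derivative[of S f "axis i 1"] unfolding pderivative_def[abs_def] .

lemma smooth_on_imp_continuous_on: "smooth_on S f \<Longrightarrow> continuous_on S f"
  unfolding smooth_on_def by (metis ck_on.simps(1))

lemma smooth_on_imp_differentiable: "smooth_on S f \<Longrightarrow> x \<in> S \<Longrightarrow> f differentiable at x"
  unfolding smooth_on_def by (metis ck_on.simps(2))

lemma smooth_on_det:
  fixes G :: "real^'m \<Rightarrow> real^'n^'n"
  assumes "open S" "\<And>i j. smooth_on S (\<lambda>x. G x $ i $ j)"
  shows "smooth_on S (\<lambda>x. det (G x))"
  unfolding det_def using assms by (intro smooth_on_sum smooth_on_mult smooth_on_prod smooth_on_const) auto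

lemma matrix_inv_mult:
  fixes A :: "real^'n^'n"
  assumes "det A \<noteq> 0"
  shows "A ** matrix_inv A = mat 1" "matrix_inv A ** A = mat 1"
proof -
  have "\<exists>B. A ** B = mat 1 \<and> B ** A = mat 1"
    using assms invertible_det_nz[of A] unfolding invertible_def by blast
  from someI_ex[OF this] show "A ** matrix_inv A = mat 1" "matrix_inv A ** A = mat 1"
    unfolding matrix_inv_def by blast+
qed

text \<open>By Cramer's rule the entries of the inverse are quotients of polynomials in the entries of the
  matrix. This is what makes the inverse of a smooth matrix field smooth.\<close>

lemma matrix_inv_entry_cramer:
  fixes A :: "real^'n^'n"
  assumes "det A \<noteq> 0"
  shows "matrix_inv A $ k $ l = det (\<chi> i j. if j = k then axis l 1 $ i else A $ i $ j) / det A"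
proof -
  have inv: "A ** matrix_inv A = mat 1"
    using assms by (rule matrix_inv_mult)
  have "A *v (matrix_inv A *v axis l 1) = axis l 1"
    by (simp add: matrix_vector_mul_assoc inv)
  then have "matrix_inv A *v axis l 1 =
      (\<chi> k. det (\<chi> i j. if j = k then axis l 1 $ i else A $ i $ j) / det A)"
    using cramer[OF assms] by blast
  moreover have "(matrix_inv A *v axis l 1) $ k = matrix_inv A $ k $ l"
    by (simp add: matrix_vector_mult_basis column_def)
  ultimately show ?thesis by simp
qed

lemma smooth_on_matrix_inv:
  fixes G :: "real^'m \<Rightarrow> real^'n^'n"
  assumes "open S" "\<And>i j. smooth_on S (\<lambda>x. G x $ i $ j)" "\<And>x. x \<in> S \<Longrightarrow> det (G x) \<noteq> 0"
  shows "smooth_on S (\<lambda>x. matrix_inv (G x) $ k $ l)"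
proof (rule smooth_on_cong[OF assms(1)])
  let ?h = "\<lambda>x. det (\<chi> i j. if j = k then axis l 1 $ i else G x $ i $ j) / det (G x)"
  show "smooth_on S ?h"
  proof (intro smooth_on_divide smooth_on_det assms)
    fix i j
    show "smooth_on S (\<lambda>x. (\<chi> i j. if j = k then axis l 1 $ i else G x $ i $ j) $ i $ j)"
      using assms(1,2) by (cases "j = k") (auto simp: axis_def)
  qed
  show "?h x = matrix_inv (G x) $ k $ l" if "x \<in> S" for x
    using matrix_inv_entry_cramer[OF assms(3)[OF that]] by simp
qed

subsection \<open>Rules for partial derivatives\<close>

lemma pderivative_eqI: "(f has_derivative D) (at x) \<Longrightarrow> pderivative i f x = D (axis i 1)"
  unfolding pderivative_def using frechet_derivative_at by metis

lemma pderivative_cong: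
  assumes "open S" "x \<in> S" "\<And>y. y \<in> S \<Longrightarrow> f y = g y" "f differentiable at x"
  shows "pderivative i f x = pderivative i g x"
  unfolding pderivative_def
  using frechet_derivative_transform_within_open[OF assms(4,1,2,3)] by simp

lemma pderivative_const [simp]: "pderivative i (\<lambda>x. c) x = 0"
  by (rule pderivative_eqI[OF has_derivative_const, simplified])

lemma pderivative_add:
  assumes "f differentiable at x" "g differentiable at x"
  shows "pderivative i (\<lambda>x. f x + g x) x = pderivative i f x + pderivative i g x"
  using assms pderivative_eqI[OF has_derivative_add]
  unfolding frechet_derivative_works pderivative_def by blast

lemma pderivative_diff:
  assumes "f differentiable at x" "g differentiable at x"
  shows "pderivative i (\<lambda>x. f x - g x) x = pderivative i f x - pderivative i g x"
  using assms pderivative_eqI[OF has_derivative_diff]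
  unfolding frechet_derivative_works pderivative_def by blast

lemma pderivative_mult:
  assumes "f differentiable at x" "g differentiable at x"
  shows "pderivative i (\<lambda>x. f x * g x) x = f x * pderivative i g x + pderivative i f x * g x"
  using assms pderivative_eqI[OF has_derivative_mult]
  unfolding frechet_derivative_works pderivative_def by blast

lemma pderivative_sum:
  assumes "\<And>j. j \<in> I \<Longrightarrow> f j differentiable at x"
  shows "pderivative i (\<lambda>x. \<Sum>j\<in>I. f j x) x = (\<Sum>j\<in>I. pderivative i (f j) x)"
  using pderivative_eqI[OF has_derivative_sum, of I f "\<lambda>j. frechet_derivative (f j) (at x)" x i] assms
  unfolding frechet_derivative_works pderivative_def by blast

lemma pderivative_compose_real:
  assumes "u differentiable at x" "(h has_real_derivative h') (at (u x))"
  shows "pderivative i (\<lambda>x. h (u x)) x = h' * pderivative i u x"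
proof -
  have "((\<lambda>x. h (u x)) has_derivative (\<lambda>v. h' * frechet_derivative u (at x) v)) (at x)"
    using has_derivative_compose[of u _ x UNIV h "(*) h'"] assms
    unfolding frechet_derivative_works has_field_derivative_def by blast
  from pderivative_eqI[OF this] show ?thesis by (simp add: pderivative_def)
qed

lemma differentiable_compose_real:
  assumes "u differentiable at x" "(h has_real_derivative h') (at (u x))"
  shows "(\<lambda>x. h (u x)) differentiable at x"
  using has_derivative_compose[of u _ x UNIV h "(*) h'"] assms
  unfolding differentiable_def has_field_derivative_def by blast

lemma pderivative_component: "pderivative i (\<lambda>x. x $ j) x = (if i = j then 1 else 0)"
  by (subst pderivative_eqI[OF bounded_linear.has_derivative[OF bounded_linear_vec_nth has_derivative_ident]])
     (auto simp: axis_def)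

lemma pderivative_mvt:
  assumes "t > 0" "\<And>r. 0 \<le> r \<Longrightarrow> r \<le> t \<Longrightarrow> f differentiable at (y + r *\<^sub>R axis i 1)"
  shows "\<exists>r. 0 < r \<and> r < t \<and> f (y + t *\<^sub>R axis i 1) - f y = t * pderivative i f (y + r *\<^sub>R axis i 1)"
proof -
  have d: "((\<lambda>r. f (y + r *\<^sub>R axis i 1)) has_real_derivative pderivative i f (y + r *\<^sub>R axis i 1)) (at r)"
    if "0 \<le> r" "r \<le> t" for r
  proof -
    have f: "(f has_derivative frechet_derivative f (at (y + r *\<^sub>R axis i 1))) (at (y + r *\<^sub>R axis i 1))"
      using assms(2)[OF that] frechet_derivative_works by blast
    have "((\<lambda>r. y + r *\<^sub>R axis i (1::real)) has_derivative (\<lambda>h. h *\<^sub>R axis i 1)) (at r)"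
      by (auto intro!: derivative_eq_intros)
    from has_derivative_compose[OF this f]
    have "((\<lambda>r. f (y + r *\<^sub>R axis i 1)) has_derivative
       (\<lambda>h. frechet_derivative f (at (y + r *\<^sub>R axis i 1)) (h *\<^sub>R axis i 1))) (at r)" .
    then show ?thesis
      using linear_cmul[OF has_derivative_linear[OF f]]
      by (simp add: has_field_derivative_def pderivative_def mult_commute_abs)
  qed
  show ?thesis using MVT2[OF assms(1) d] by simp
qed

text \<open>Both mixed second derivatives equal the limit of the second difference quotient over
  a small square with sides in the two directions.\<close>

lemma pderivative_commute:
  fixes f :: "real^'n \<Rightarrow> real"
  assumes "open S" "smooth_on S f" "x \<in> S"
  shows "pderivative i (pderivative j f) x = pderivative j (pderivative i f) x"
proof (rule ccontr)
  define e where "e = (\<lambda>i::'n. axis i (1::real))"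
  have e: "axis i (1::real) = e i" for i :: 'n by (simp add: e_def)
  have ne: "norm (e i) = 1" for i by (simp add: e_def)
  have mixed: "\<exists>p. dist p x < 2 * t \<and>
      f (x + t *\<^sub>R e i + t *\<^sub>R e j) - f (x + t *\<^sub>R e i) - f (x + t *\<^sub>R e j) + f x
        = t * t * pderivative j (pderivative i f) p"
    if t: "t > 0" and b: "ball x (3 * t) \<subseteq> S" for t i j
  proof -
    have inS: "x + a *\<^sub>R e i + c *\<^sub>R e j \<in> S" if "0 \<le> a" "0 \<le> c" "a \<le> t" "c \<le> t" for a c
    proof -
      have "norm (a *\<^sub>R e i + c *\<^sub>R e j) \<le> a + c"
        using norm_triangle_ineq[of "a *\<^sub>R e i" "c *\<^sub>R e j"] that by (simp add: ne)
      then have "norm ((x + a *\<^sub>R e i + c *\<^sub>R e j) - x) < 3 * t"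
        using that t by simp
      then have "x + a *\<^sub>R e i + c *\<^sub>R e j \<in> ball x (3 * t)"
        by (simp only: mem_ball dist_norm norm_minus_commute)
      then show ?thesis using b by blast
    qed
    have dS: "f differentiable at y" "pderivative i f differentiable at y" if "y \<in> S" for y
      using that smooth_on_imp_differentiable assms(2) smooth_on_pderivative by blast+
    define F where "F = (\<lambda>y. f (y + t *\<^sub>R e j) - f y)"
    have sh: "((\<lambda>y. f (y + t *\<^sub>R e j)) has_derivative frechet_derivative f (at (y + t *\<^sub>R e j))) (at y)"
      if "y + t *\<^sub>R e j \<in> S" for y
    proof -
      have "((\<lambda>y. y + t *\<^sub>R e j) has_derivative (\<lambda>h. h)) (at y)"
        by (auto intro!: derivative_eq_intros)
      from has_derivative_compose[OF this dS(1)[OF that, unfolded frechet_derivative_works]]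
      show ?thesis .
    qed
    have dF: "F differentiable at y" "pderivative i F y = pderivative i f (y + t *\<^sub>R e j) - pderivative i f y"
      if "y \<in> S" "y + t *\<^sub>R e j \<in> S" for y
    proof -
      have "(F has_derivative (\<lambda>v. frechet_derivative f (at (y + t *\<^sub>R e j)) v - frechet_derivative f (at y) v)) (at y)"
        unfolding F_def
        by (rule has_derivative_diff[OF sh[OF that(2)] dS(1)[OF that(1), unfolded frechet_derivative_works]])
      then show "F differentiable at y" "pderivative i F y = pderivative i f (y + t *\<^sub>R e j) - pderivative i f y"
        using pderivative_eqI unfolding differentiable_def pderivative_def by blast+
    qed
    obtain r where r: "0 < r" "r < t" "F (x + t *\<^sub>R e i) - F x = t * pderivative i F (x + r *\<^sub>R e i)"
    proof -
      have "F differentiable at (x + r *\<^sub>R e i)" if "0 \<le> r" "r \<le> t" for r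
        using dF(1)[of "x + r *\<^sub>R e i"] inS[of r 0] inS[of r t] that t by simp
      from pderivative_mvt[OF t, of F x i, unfolded e, OF this] show ?thesis using that by blast
    qed
    have 1: "pderivative i F (x + r *\<^sub>R e i) =
        pderivative i f (x + r *\<^sub>R e i + t *\<^sub>R e j) - pderivative i f (x + r *\<^sub>R e i)"
      using dF(2)[of "x + r *\<^sub>R e i"] inS[of r 0] inS[of r t] r t by simp
    obtain s where s: "0 < s" "s < t"
       "pderivative i f (x + r *\<^sub>R e i + t *\<^sub>R e j) - pderivative i f (x + r *\<^sub>R e i)
          = t * pderivative j (pderivative i f) (x + r *\<^sub>R e i + s *\<^sub>R e j)"
    proof -
      have "pderivative i f differentiable at (x + r *\<^sub>R e i + s *\<^sub>R e j)" if "0 \<le> s" "s \<le> t" for s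
        using dS(2)[of "x + r *\<^sub>R e i + s *\<^sub>R e j"] inS[of r s] that t r by simp
      from pderivative_mvt[OF t, of "pderivative i f" "x + r *\<^sub>R e i" j, unfolded e, OF this]
      show ?thesis using that by blast
    qed
    have "norm (r *\<^sub>R e i + s *\<^sub>R e j) \<le> r + s"
      using norm_triangle_ineq[of "r *\<^sub>R e i" "s *\<^sub>R e j"] r s by (simp add: ne)
    then have "dist (x + r *\<^sub>R e i + s *\<^sub>R e j) x < 2 * t"
      using r s by (simp add: dist_norm algebra_simps)
    moreover have "f (x + t *\<^sub>R e i + t *\<^sub>R e j) - f (x + t *\<^sub>R e i) - f (x + t *\<^sub>R e j) + f x
        = F (x + t *\<^sub>R e i) - F x" by (simp add: F_def)
    ultimately show ?thesis using r(3) 1 s(3) by (intro exI[of _ "x + r *\<^sub>R e i + s *\<^sub>R e j"]) simp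
  qed
  define a where "a = pderivative i (pderivative j f)"
  define b where "b = pderivative j (pderivative i f)"
  assume "a x \<noteq> b x" 
  then have eps: "\<bar>a x - b x\<bar> / 2 > 0" by simp
  have "continuous_on S a" "continuous_on S b"
    unfolding a_def b_def using assms(2) by (intro smooth_on_imp_continuous_on smooth_on_pderivative; assumption)+
  then have "isCont a x" "isCont b x" using assms(1,3) by (simp_all add: continuous_on_eq_continuous_at)
  from \<open>isCont a x\<close>[unfolded continuous_at_eps_delta, rule_format, OF eps]
  obtain d1 where d1: "d1 > 0" "\<forall>p. dist p x < d1 \<longrightarrow> dist (a p) (a x) < \<bar>a x - b x\<bar> / 2"
    by (elim exE conjE)
  from \<open>isCont b x\<close>[unfolded continuous_at_eps_delta, rule_format, OF eps]
  obtain d2 where d2: "d2 > 0" "\<forall>p. dist p x < d2 \<longrightarrow> dist (b p) (b x) < \<bar>a x - b x\<bar> / 2"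
    by (elim exE conjE)
  note d = d1 d2
  obtain d3 where d3: "d3 > 0" "ball x d3 \<subseteq> S" using openE[OF assms(1,3)] by metis
  define t where "t = Min {d1, d2, d3} / 3"
  have t: "t > 0" "2 * t \<le> d1" "2 * t \<le> d2" "3 * t \<le> d3" using d d3 by (auto simp: t_def)
  then have bt: "ball x (3 * t) \<subseteq> S" using d3 by (meson order_trans subset_ball)
  obtain p where p: "dist p x < 2 * t" "f (x + t *\<^sub>R e i + t *\<^sub>R e j) - f (x + t *\<^sub>R e i) - f (x + t *\<^sub>R e j) + f x
        = t * t * b p" using mixed[OF t(1) bt] unfolding b_def by blast
  obtain q where q: "dist q x < 2 * t" "f (x + t *\<^sub>R e j + t *\<^sub>R e i) - f (x + t *\<^sub>R e j) - f (x + t *\<^sub>R e i) + f x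
        = t * t * a q" using mixed[OF t(1) bt] unfolding a_def by blast
  have sw: "x + t *\<^sub>R e i + t *\<^sub>R e j = x + t *\<^sub>R e j + t *\<^sub>R e i" by (simp add: algebra_simps)
  from p(2)[unfolded sw] q(2) have "t * t * b p = t * t * a q" by linarith
  then have "b p = a q" using t(1) by simp
  moreover have "dist (a q) (a x) < \<bar>a x - b x\<bar> / 2" "dist (b p) (b x) < \<bar>a x - b x\<bar> / 2"
    using d p q t by auto
  ultimately show False by (auto simp: dist_real_def abs_if split: if_splits)
qed

section \<open>The second elementary symmetric function of a self-adjoint pencil\<close>

lemma matrix_mult_entry: "(A ** B) $ i $ j = (\<Sum>k\<in>UNIV. A $ i $ k * B $ k $ j)"
  by (simp add: matrix_matrix_mult_def)

lemma matrix_add_rdistrib: "((A + B) ** C) = (A ** C) + (B ** C)"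
  for A B :: "'a::comm_ring_1^'n^'m"
  by (simp add: vec_eq_iff matrix_mult_entry algebra_simps sum.distrib)

lemma matrix_diff_ldistrib: "A ** (B - C) = (A ** B) - (A ** C)"
  for A :: "'a::comm_ring_1^'n^'m"
  by (simp add: vec_eq_iff matrix_mult_entry algebra_simps sum_subtractf)

lemma matrix_diff_rdistrib: "((A - B) ** C) = (A ** C) - (B ** C)"
  for A B :: "'a::comm_ring_1^'n^'m"
  by (simp add: vec_eq_iff matrix_mult_entry algebra_simps sum_subtractf)

lemma transpose_entry [simp]: "transpose A $ i $ j = A $ j $ i"
  by (simp add: transpose_def)

lemma mat_entry: "(mat c :: 'a::zero^'n^'n) $ i $ j = (if i = j then c else 0)"
  by (simp add: mat_def)

lemma symmetric_matrix_entry: "transpose A = A \<Longrightarrow> A $ i $ j = A $ j $ i"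
  by (metis transpose_entry)

lemma symmetric_form_commute:
  fixes A :: "real^'n^'n"
  assumes "transpose A = A"
  shows "u \<bullet> (A *v v) = v \<bullet> (A *v u)"
  by (metis assms dot_lmul_matrix inner_commute transpose_matrix_vector)

lemma positive_definite_det_nonzero:
  fixes A :: "real^'n^'n"
  assumes "\<And>v. v \<noteq> 0 \<Longrightarrow> v \<bullet> (A *v v) > 0"
  shows "det A \<noteq> 0"
proof -
  have "inj ((*v) A)"
  proof (rule injI)
    fix x y assume "A *v x = A *v y"
    then have "(x - y) \<bullet> (A *v (x - y)) = 0" by (simp add: matrix_vector_mult_diff_distrib)
    then show "x = y" using assms[of "x - y"] by force
  qed
  then show ?thesis
    using invertible_det_nz invertible_left_inverse matrix_left_invertible_injective by blast
qed

text \<open>The first order condition at a minimum of a quadratic function.\<close>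

lemma nonneg_quadratic_linear_term_zero:
  fixes c d :: real
  assumes "\<And>t. 2 * t * c + t\<^sup>2 * d \<ge> 0"
  shows "c = 0"
proof (rule ccontr)
  assume c: "c \<noteq> 0"
  define s where "s = \<bar>d\<bar> + 1"
  have s: "s > 0" "d < s" by (auto simp: s_def)
  have "2 * (- c / s) * c + (- c / s)\<^sup>2 * d = (c\<^sup>2 / s\<^sup>2) * (d - 2 * s)"
    using s by (simp add: field_simps power2_eq_square)
  also have "\<dots> < 0"
    using c s by (intro mult_pos_neg) auto
  finally show False using assms[of "- c / s"] by simp
qed

text \<open>A vector \<open>v\<close> of \<open>S\<close> that maximises the quotient of the two quadratic forms
  is an eigenvector of the pencil: every vector of \<open>S\<close> orthogonal to \<open>v\<close> for the first form is
  also orthogonal for the second one. Splitting off \<open>v\<close> reduces the dimension.\<close>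

lemma simultaneous_orthogonal_basis:
  fixes G A :: "real^'n^'n"
  assumes symG: "transpose G = G" and symA: "transpose A = A"
    and pos: "\<And>v. v \<noteq> 0 \<Longrightarrow> v \<bullet> (G *v v) > 0"
  shows "subspace S \<Longrightarrow> dim S = m \<Longrightarrow> \<exists>B. finite B \<and> B \<subseteq> S \<and> card B = m \<and>
    (\<forall>u\<in>B. u \<bullet> (G *v u) = 1) \<and>
    (\<forall>u\<in>B. \<forall>v\<in>B. u \<noteq> v \<longrightarrow> u \<bullet> (G *v v) = 0 \<and> u \<bullet> (A *v v) = 0)"
proof (induction m arbitrary: S)
  case 0
  show ?case by (rule exI[of _ "{}"]) auto
next
  case (Suc m)
  define g where "g = (\<lambda>u v. u \<bullet> (G *v v))"
  define a where "a = (\<lambda>u v. u \<bullet> (A *v v))"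
  have lin: "g u (v + w) = g u v + g u w" "a u (v + w) = a u v + a u w"
      "g u (r *\<^sub>R v) = r * g u v" "a u (r *\<^sub>R v) = r * a u v"
      "g (v + w) u = g v u + g w u" "a (v + w) u = a v u + a w u"
      "g (r *\<^sub>R v) u = r * g v u" "a (r *\<^sub>R v) u = r * a v u" for u v w r
    by (simp_all add: g_def a_def matrix_vector_right_distrib inner_right_distrib inner_left_distrib
        matrix_vector_mult_scaleR)
  have sym: "g u v = g v u" "a u v = a v u" for u v
    unfolding g_def a_def using symG symA symmetric_form_commute by blast+
  have gpos: "v \<noteq> 0 \<Longrightarrow> g v v > 0" for v using pos by (simp add: g_def)
  define K where "K = S \<inter> sphere 0 1"
  have K: "compact K"
    unfolding K_def using closed_subspace[OF Suc.prems(1)] by (simp add: closed_Int_compact)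
  have "\<exists>x\<in>S. x \<noteq> 0" using Suc.prems(2) dim_eq_0[of S] by auto
  then obtain x where x: "x \<in> S" "x \<noteq> 0" by blast
  then have "x /\<^sub>R norm x \<in> K"
    unfolding K_def using subspace_scale[OF Suc.prems(1)] by auto
  then have Kne: "K \<noteq> {}" by blast
  have "continuous_on K (\<lambda>x. a x x / g x x)"
  proof (intro continuous_on_divide)
    show "continuous_on K (\<lambda>x. a x x)" "continuous_on K (\<lambda>x. g x x)"
      unfolding a_def g_def
      by (intro continuous_intros linear_continuous_on_compose matrix_vector_mul_linear; simp)+
    show "\<forall>x\<in>K. g x x \<noteq> 0"
    proof
      fix x assume "x \<in> K"
      then have "x \<noteq> 0" by (auto simp: K_def)
      from gpos[OF this] show "g x x \<noteq> 0" by simp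
    qed
  qed
  then obtain v0 where v0: "v0 \<in> K" "\<And>y. y \<in> K \<Longrightarrow> a y y / g y y \<le> a v0 v0 / g v0 v0"
    using continuous_attains_sup[OF K Kne] by blast
  (* The maximal value of the quotient; l * g - a is nonnegative on S and vanishes at v0. *)
  define l where "l = a v0 v0 / g v0 v0"
  have v0': "v0 \<noteq> 0" "v0 \<in> S" using v0(1) by (auto simp: K_def)
  note v0' = this gpos[OF this(1)]
  have qK: "a y y \<le> l * g y y" if "y \<in> K" for y
  proof -
    have "y \<noteq> 0" using that by (auto simp: K_def)
    from gpos[OF this] have "g y y > 0" .
    then show ?thesis using v0(2)[OF that] by (simp add: l_def pos_divide_le_eq)
  qed
  have q: "a y y \<le> l * g y y" if "y \<in> S" for y
  proof (cases "y = 0")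
    case True
    have "a 0 0 = 0" "g 0 0 = 0" by (simp_all add: a_def g_def)
    then show ?thesis using True by simp
  next
    case False
    then have "y /\<^sub>R norm y \<in> K"
      unfolding K_def using subspace_scale[OF Suc.prems(1)] that by auto
    from qK[OF this] have "a y y / (norm y)\<^sup>2 \<le> l * g y y / (norm y)\<^sup>2"
      by (simp add: lin power2_eq_square divide_inverse algebra_simps)
    then show ?thesis using False by (simp add: divide_le_cancel)
  qed
  define v where "v = v0 /\<^sub>R sqrt (g v0 v0)"
  have vS: "v \<in> S" unfolding v_def using subspace_scale[OF Suc.prems(1)] v0' by blast
  have gvv: "g v v = 1" unfolding v_def using v0' by (simp add: lin field_simps)
  have avv: "a v v = l" unfolding v_def l_def using v0' by (simp add: lin field_simps)
  have orth: "a v y = l * g v y" if y: "y \<in> S" for y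
  proof -
    have "2 * t * (l * g v y - a v y) + t\<^sup>2 * (l * g y y - a y y) \<ge> 0" for t
    proof -
      have "v + t *\<^sub>R y \<in> S" using vS y Suc.prems(1) by (simp add: subspace_add subspace_scale)
      from q[OF this] show ?thesis
        using gvv avv sym[of y v] by (simp add: lin power2_eq_square algebra_simps)
    qed
    from nonneg_quadratic_linear_term_zero[OF this] show ?thesis by simp
  qed
  define S' where "S' = {y\<in>S. g v y = 0}"
  have subS': "subspace S'"
    unfolding S'_def subspace_def using Suc.prems(1)
    by (auto simp: lin subspace_add subspace_scale subspace_0) (simp add: g_def)
  have vS': "v \<notin> S'" using gvv by (simp add: S'_def)
  have "S \<subseteq> span (insert v S')"
  proof
    fix y assume y: "y \<in> S"
    define z where "z = y + (- g v y) *\<^sub>R v"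
    have "z \<in> S" unfolding z_def using y vS Suc.prems(1) by (intro subspace_add subspace_scale)
    moreover have "g v z = 0" unfolding z_def lin gvv by simp
    ultimately have "z \<in> S'" by (simp add: S'_def)
    then have "z + g v y *\<^sub>R v \<in> span (insert v S')"
      by (intro span_add span_scale) (auto intro: span_base)
    then show "y \<in> span (insert v S')" by (simp add: z_def)
  qed
  moreover have "insert v S' \<subseteq> S" using vS by (auto simp: S'_def)
  ultimately have "dim (insert v S') = dim S"
    by (metis dim_span dim_subset le_antisym)
  moreover have "v \<notin> span S'" using vS' span_minimal[OF subset_refl subS'] by blast
  ultimately have "dim S' = m" using Suc.prems(2) dim_insert[of v S'] by simp
  from Suc.IH[OF subS' this] obtain B where B: "finite B" "B \<subseteq> S'" "card B = m"
     "\<forall>u\<in>B. g u u = 1" "\<forall>u\<in>B. \<forall>v\<in>B. u \<noteq> v \<longrightarrow> g u v = 0 \<and> a u v = 0"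
    unfolding g_def a_def by blast
  have vB: "g v u = 0 \<and> a v u = 0 \<and> g u v = 0 \<and> a u v = 0" if "u \<in> B" for u
    using B(2) that orth[of u] sym[of u v] by (auto simp: S'_def)
  have "v \<notin> B" using B(2) vS' by blast
  moreover have "x \<bullet> (G *v y) = g x y" "x \<bullet> (A *v y) = a x y" for x y
    by (simp_all add: g_def a_def)
  ultimately show ?case
    using B vS gvv vB by (intro exI[of _ "insert v B"]) (auto simp: S'_def)
qed

lemma simultaneous_diagonalization:
  fixes G A :: "real^'n^'n"
  assumes "transpose G = G" "transpose A = A" "\<And>v. v \<noteq> 0 \<Longrightarrow> v \<bullet> (G *v v) > 0"
  shows "\<exists>(P :: real^'n^'n) d. transpose P ** G ** P = mat 1 \<and>
     transpose P ** A ** P = (\<chi> i j. if i = j then d i else 0)"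
proof -
  obtain B where B: "finite B" "card B = CARD('n)" "\<forall>u\<in>B. u \<bullet> (G *v u) = 1"
    "\<forall>u\<in>B. \<forall>v\<in>B. u \<noteq> v \<longrightarrow> u \<bullet> (G *v v) = 0 \<and> u \<bullet> (A *v v) = 0"
    using simultaneous_orthogonal_basis[OF assms subspace_UNIV, of "CARD('n)"] by (auto simp: dim_UNIV)
  then obtain f where f: "bij_betw f (UNIV :: 'n set) B"
    using finite_same_card_bij[of "UNIV :: 'n set" B] by auto
  define P :: "real^'n^'n" where "P = (\<chi> i j. f j $ i)"
  have ent: "(transpose P ** M ** P) $ i $ j = f i \<bullet> (M *v f j)" for M :: "real^'n^'n" and i j
  proof -
    have "(transpose P ** M ** P) $ i $ j = (transpose P ** (M ** P)) $ i $ j"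
      by (simp add: matrix_mul_assoc)
    also have "\<dots> = f i \<bullet> (M *v f j)"
      by (simp add: matrix_mult_entry inner_vec_def P_def matrix_vector_mult_def)
    finally show ?thesis .
  qed
  have fB: "f i \<in> B" for i using f by (auto simp: bij_betw_def)
  have fn: "f i \<noteq> f j" if "i \<noteq> j" for i j using f that by (auto simp: bij_betw_def inj_on_def)
  have "transpose P ** G ** P = mat 1"
    unfolding vec_eq_iff using B(3,4) fB fn by (auto simp: ent mat_entry)
  moreover have "transpose P ** A ** P = (\<chi> i j. if i = j then f i \<bullet> (A *v f i) else 0)"
    unfolding vec_eq_iff using B(4) fB fn by (auto simp: ent)
  ultimately show ?thesis
    by (intro exI[of _ P] exI[of _ "\<lambda>i. f i \<bullet> (A *v f i)"] conjI)
qed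

lemma const_poly_sum: "[:sum f I:] = (\<Sum>i\<in>I. [:f i:])"
proof (induction I rule: infinite_finite_induct)
  case (insert a I)
  have "[:sum f (insert a I):] = [:f a:] + [:sum f I:]" using insert(1,2) by simp
  then show ?case using insert by simp
qed auto

text \<open>Similarity is stated as an intertwining relation, the form in which it arises for mixed tensors
  in two coordinate systems.\<close>

lemma charpoly_similar:
  fixes B D P Q :: "real^'n^'n"
  assumes "P ** Q = mat 1" "B ** P = P ** D"
  shows "charpoly B = charpoly D"
proof -
  define pm where "pm = (\<lambda>M::real^'n^'n. \<chi> i j. [:M $ i $ j:])"
  define cm where "cm = (\<lambda>M::real^'n^'n. \<chi> i j. (if i = j then [:0, 1:] else 0) - [:M $ i $ j:])"
  have pm_mult: "pm (M ** N) = pm M ** pm N" for M N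
    by (simp add: vec_eq_iff pm_def matrix_mult_entry const_poly_sum mult.commute)
  have cm: "cm M ** pm P = (\<chi> i j. [:0, 1:] * [:P $ i $ j:]) - pm (M ** P)"
     "pm P ** cm M = (\<chi> i j. [:0, 1:] * [:P $ i $ j:]) - pm (P ** M)" for M
  proof -
    have c: "cm M = mat [:0, 1:] - pm M" by (simp add: vec_eq_iff cm_def pm_def mat_entry)
    have "mat [:0, 1:] ** pm P = (\<chi> i j. [:0, 1:] * [:P $ i $ j:])"
       "pm P ** mat [:0, 1:] = (\<chi> i j. [:0, 1:] * [:P $ i $ j:])"
      by (simp_all add: vec_eq_iff matrix_mult_entry mat_entry pm_def if_distrib[of "\<lambda>x. x * _"]
          if_distrib[of "\<lambda>x. _ * x"] if_distrib[of "smult _"] sum.delta sum.delta' cong: if_cong)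
    then show "cm M ** pm P = (\<chi> i j. [:0, 1:] * [:P $ i $ j:]) - pm (M ** P)"
     "pm P ** cm M = (\<chi> i j. [:0, 1:] * [:P $ i $ j:]) - pm (P ** M)"
      by (simp_all add: c matrix_diff_ldistrib matrix_diff_rdistrib pm_mult)
  qed
  have "cm B ** pm P = pm P ** cm D" using cm assms(2) by simp
  then have "det (cm B) * det (pm P) = det (cm D) * det (pm P)"
    by (metis det_mul mult.commute)
  moreover have "pm P ** pm Q = mat 1"
    unfolding pm_mult[symmetric] assms(1) by (simp add: vec_eq_iff pm_def mat_entry)
  then have "det (pm P) * det (pm Q) = 1" by (metis det_mul det_I)
  then have "det (pm P) \<noteq> 0" by auto
  ultimately show ?thesis by (simp add: charpoly_def cm_def)
qed

lemma sum_pairs_prod: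
  fixes f :: "'i \<Rightarrow> real"
  shows "finite I \<Longrightarrow> (\<Sum>S | S \<subseteq> I \<and> card S = 2. \<Prod>i\<in>S. f i) = ((\<Sum>i\<in>I. f i)\<^sup>2 - (\<Sum>i\<in>I. (f i)\<^sup>2)) / 2"
proof (induction I rule: finite_induct)
  case empty
  have "{S :: 'i set. S \<subseteq> {} \<and> card S = 2} = {}" by auto
  then show ?case by simp
next
  case (insert a I)
  have fin: "finite S" if "S \<subseteq> I" for S using that insert(1) finite_subset by blast
  have split: "{S. S \<subseteq> insert a I \<and> card S = 2} = {S. S \<subseteq> I \<and> card S = 2} \<union> (\<lambda>b. {a, b}) ` I"
  proof (intro equalityI subsetI)
    fix S assume "S \<in> {S. S \<subseteq> insert a I \<and> card S = 2}"
    then have S: "S \<subseteq> insert a I" "card S = 2" by auto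
    from S(2) obtain x y where "S = {x, y}" "x \<noteq> y" by (auto simp: card_2_iff)
    then show "S \<in> {S. S \<subseteq> I \<and> card S = 2} \<union> (\<lambda>b. {a, b}) ` I"
      using S by (cases "x = a"; cases "y = a") auto
  next
    fix S assume "S \<in> {S. S \<subseteq> I \<and> card S = 2} \<union> (\<lambda>b. {a, b}) ` I"
    then show "S \<in> {S. S \<subseteq> insert a I \<and> card S = 2}" using insert(2) by (auto simp: card_2_iff)
  qed
  have inj: "inj_on (\<lambda>b. {a, b}) I" by (auto simp: inj_on_def doubleton_eq_iff)
  have "(\<Sum>S | S \<subseteq> insert a I \<and> card S = 2. \<Prod>i\<in>S. f i)
      = (\<Sum>S | S \<subseteq> I \<and> card S = 2. \<Prod>i\<in>S. f i) + (\<Sum>S\<in>(\<lambda>b. {a, b}) ` I. \<Prod>i\<in>S. f i)"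
    unfolding split using insert(1,2) by (intro sum.union_disjoint) auto
  also have "(\<Sum>S\<in>(\<lambda>b. {a, b}) ` I. \<Prod>i\<in>S. f i) = (\<Sum>b\<in>I. \<Prod>i\<in>{a, b}. f i)"
    using inj by (simp add: sum.reindex)
  also have "\<dots> = (\<Sum>b\<in>I. f a * f b)"
  proof (intro sum.cong refl)
    fix b assume "b \<in> I"
    then have "a \<noteq> b" using insert(2) by blast
    then show "(\<Prod>i\<in>{a, b}. f i) = f a * f b" by simp
  qed
  also have "\<dots> = f a * sum f I" by (simp add: sum_distrib_left)
  finally show ?case
    unfolding insert(3) using insert(1,2)
    by (simp add: power2_eq_square field_simps)
qed

lemma elem_sym_2:
  "elem_sym 2 xs = ((sum_list xs)\<^sup>2 - sum_list (map (\<lambda>x. x\<^sup>2) xs)) / 2"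
  unfolding elem_sym_def
  by (subst sum_pairs_prod) (auto simp: sum_list_sum_nth atLeast0LessThan)

lemma sum_list_of_mset:
  fixes d :: "'n::finite \<Rightarrow> real" and h :: "real \<Rightarrow> real"
  assumes "mset xs = image_mset d (mset_set UNIV)"
  shows "sum_list (map h xs) = (\<Sum>i\<in>UNIV. h (d i))"
proof -
  have "sum_list (map h xs) = sum_mset (image_mset h (mset xs))"
    by (simp flip: sum_mset_sum_list)
  also have "\<dots> = (\<Sum>i\<in>UNIV. h (d i))"
    unfolding assms by (simp add: sum_unfold_sum_mset image_mset.compositionality o_def)
  finally show ?thesis .
qed

lemma eigenvalues_diagonal:
  fixes d :: "'n::finite \<Rightarrow> real"
  shows "mset (eigenvalues (\<chi> i j. if i = j then d i else 0)) = image_mset d (mset_set UNIV)"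
proof -
  have "charpoly (\<chi> i j. if i = j then d i else 0) = (\<Prod>i\<in>UNIV. [:- d i, 1:])"
    unfolding charpoly_def by (subst det_diagonal) auto
  then have "proots (charpoly (\<chi> i j. if i = j then d i else 0)) = (\<Sum>i\<in>UNIV. {#d i#})"
    by (simp add: proots_prod)
  also have "\<dots> = image_mset d (mset_set UNIV)"
    by (simp add: sum_unfold_sum_mset)
  finally show ?thesis by (simp add: eigenvalues_def)
qed

text \<open>For a self-adjoint matrix the characteristic polynomial splits over the reals, so the
  list of real eigenvalues is complete and \<open>\<sigma>\<^sub>2\<close> can be read off from traces.\<close>

lemma sigma2_self_adjoint:
  fixes G A :: "real^'n^'n"
  assumes sym: "transpose G = G" "transpose A = A" and pos: "\<And>v. v \<noteq> 0 \<Longrightarrow> v \<bullet> (G *v v) > 0"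
  defines "B \<equiv> matrix_inv G ** A"
  shows "elem_sym 2 (eigenvalues B) = ((trace B)\<^sup>2 - trace (B ** B)) / 2"
proof -
  obtain P :: "real^'n^'n" and d where P: "transpose P ** G ** P = mat 1"
     and D: "transpose P ** A ** P = (\<chi> i j. if i = j then d i else 0)"
    using simultaneous_diagonalization[OF sym pos] by blast
  define Dm where "Dm = (\<chi> i j. if i = j then d i else 0)"
  define Q where "Q = transpose P ** G"
  have QP: "Q ** P = mat 1" using P by (simp add: Q_def)
  then have PQ: "P ** Q = mat 1" using matrix_left_right_inverse by blast
  have "det G \<noteq> 0" using pos by (rule positive_definite_det_nonzero)
  then have GG: "G ** matrix_inv G = mat 1" by (rule matrix_inv_mult)
  have "P ** transpose P = (P ** transpose P) ** (G ** matrix_inv G)" by (simp add: GG)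
  also have "\<dots> = (P ** Q) ** matrix_inv G" by (simp add: Q_def matrix_mul_assoc)
  finally have inv: "matrix_inv G = P ** transpose P" by (simp add: PQ)
  have BP: "B ** P = P ** Dm"
    unfolding B_def inv Dm_def D[symmetric] by (simp add: matrix_mul_assoc)
  have B: "B = P ** (Dm ** Q)"
    by (metis BP PQ matrix_mul_assoc matrix_mul_rid)
  have BB: "B ** B = P ** (Dm ** Dm ** Q)"
    by (metis B BP matrix_mul_assoc)
  have t1: "trace B = (\<Sum>i\<in>UNIV. d i)"
  proof -
    have "trace B = trace ((Dm ** Q) ** P)" unfolding B by (rule trace_mul_sym)
    also have "(Dm ** Q) ** P = Dm" by (simp add: QP flip: matrix_mul_assoc)
    finally show ?thesis by (simp add: trace_def Dm_def)
  qed
  have t2: "trace (B ** B) = (\<Sum>i\<in>UNIV. (d i)\<^sup>2)"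
  proof -
    have "trace (B ** B) = trace ((Dm ** Dm ** Q) ** P)" unfolding BB by (rule trace_mul_sym)
    also have "(Dm ** Dm ** Q) ** P = Dm ** Dm" by (simp add: QP flip: matrix_mul_assoc)
    also have "trace \<dots> = (\<Sum>i\<in>UNIV. (d i)\<^sup>2)"
      by (simp add: trace_def matrix_mult_entry Dm_def if_distrib[of "\<lambda>x. x * _"] power2_eq_square cong: if_cong)
    finally show ?thesis .
  qed
  have "mset (eigenvalues B) = image_mset d (mset_set UNIV)"
    using charpoly_similar[OF PQ BP] eigenvalues_diagonal[of d] by (simp add: eigenvalues_def Dm_def)
  from sum_list_of_mset[OF this, of "\<lambda>x. x"] sum_list_of_mset[OF this, of "\<lambda>x. x\<^sup>2"]
  show ?thesis by (simp add: elem_sym_2 t1 t2)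
qed

section \<open>Curvature in coordinates\<close>

lemma pderivative_eq_on:
  assumes "open S" "x \<in> S" "\<And>y. y \<in> S \<Longrightarrow> f y = g y" "smooth_on S f"
  shows "pderivative i f x = pderivative i g x"
  using assms pderivative_cong smooth_on_imp_differentiable by blast

locale coordinate_metric =
  fixes S :: "(real^'n::finite) set" and G :: "real^'n \<Rightarrow> real^'n^'n"
  assumes open_S: "open S" and smooth_G: "smooth_on S G"
    and sym_G: "x \<in> S \<Longrightarrow> transpose (G x) = G x"
    and pos_G: "x \<in> S \<Longrightarrow> v \<noteq> 0 \<Longrightarrow> v \<bullet> (G x *v v) > 0"
begin

lemma det_G: "x \<in> S \<Longrightarrow> det (G x) \<noteq> 0"
  using pos_G positive_definite_det_nonzero by blast

lemma det_G_pos: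
  assumes x: "x \<in> S"
  shows "det (G x) > 0"
proof -
  obtain P :: "real^'n^'n" where "transpose P ** G x ** P = mat 1"
    using simultaneous_diagonalization[OF sym_G sym_G pos_G, OF x x x] by blast
  then have "det P * det (G x) * det P = 1" by (metis det_I det_mul det_transpose)
  then have "0 < det (G x) * (det P)\<^sup>2" by (simp add: power2_eq_square mult_ac)
  then show ?thesis by (auto simp: zero_less_mult_iff)
qed

lemma smooth_G_entry: "smooth_on S (\<lambda>x. G x $ i $ j)"
  using open_S smooth_G by (intro smooth_on_vec_nth)

lemma smooth_inv: "smooth_on S (\<lambda>x. matrix_inv (G x) $ i $ j)"
  using open_S smooth_G_entry det_G by (intro smooth_on_matrix_inv)

lemma smooth_christoffel: "smooth_on S (christoffel G k i j)"
  unfolding christoffel_def[abs_def]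
  by (intro smooth_on_divide_const smooth_on_sum smooth_on_mult smooth_on_diff smooth_on_add open_S
      smooth_inv smooth_on_pderivative[of S "\<lambda>y. G y $ _ $ _"] smooth_G_entry)

lemma smooth_riemann: "smooth_on S (riemann G l k i j)"
  unfolding riemann_def[abs_def]
  by (intro smooth_on_sum smooth_on_mult smooth_on_diff smooth_on_add open_S
      smooth_on_pderivative[of S "christoffel G _ _ _"] smooth_christoffel)

lemma smooth_ricci: "smooth_on S (\<lambda>x. ricci G x $ i $ j)"
  unfolding ricci_def by (simp, intro smooth_on_sum open_S smooth_riemann)

lemma smooth_scalar_curvature: "smooth_on S (scalar_curvature G)"
  unfolding scalar_curvature_def[abs_def]
  by (intro smooth_on_sum smooth_on_mult open_S smooth_inv smooth_ricci)

lemma smooth_schouten: "smooth_on S (\<lambda>x. schouten G x $ i $ j)"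
  unfolding schouten_def
  by (simp, intro smooth_on_divide_const smooth_on_diff smooth_on_mult open_S smooth_ricci
      smooth_scalar_curvature smooth_G_entry)

lemma inv_G:
  assumes "x \<in> S"
  shows "G x ** matrix_inv (G x) = mat 1" "matrix_inv (G x) ** G x = mat 1"
  using matrix_inv_mult[OF det_G[OF assms]] by auto

lemma sym_G_entry: "x \<in> S \<Longrightarrow> G x $ i $ j = G x $ j $ i"
  using sym_G symmetric_matrix_entry by blast

lemma sym_inv:
  assumes "x \<in> S"
  shows "transpose (matrix_inv (G x)) = matrix_inv (G x)"
proof -
  have "transpose (matrix_inv (G x)) ** G x = mat 1"
    by (metis assms inv_G(1) matrix_transpose_mul sym_G transpose_mat)
  then show ?thesis
    by (metis assms inv_G(1) matrix_mul_assoc matrix_mul_lid matrix_mul_rid)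
qed

lemma sym_inv_entry: "x \<in> S \<Longrightarrow> matrix_inv (G x) $ i $ j = matrix_inv (G x) $ j $ i"
  using sym_inv symmetric_matrix_entry by blast

lemma pderivative_G_sym: "x \<in> S \<Longrightarrow> pderivative l (\<lambda>y. G y $ i $ j) x = pderivative l (\<lambda>y. G y $ j $ i) x"
  by (rule pderivative_eq_on[OF open_S _ _ smooth_G_entry]) (auto simp: sym_G_entry)

lemma christoffel_sym: "x \<in> S \<Longrightarrow> christoffel G k i j x = christoffel G k j i x"
  unfolding christoffel_def by (simp add: pderivative_G_sym[of x _ i j] add.commute)

lemma pderivative_christoffel_sym:
  "x \<in> S \<Longrightarrow> pderivative l (christoffel G k i j) x = pderivative l (christoffel G k j i) x"
  by (rule pderivative_eq_on[OF open_S _ _ smooth_christoffel]) (auto simp: christoffel_sym)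

lemma lower_christoffel:
  assumes "x \<in> S"
  shows "(\<Sum>k\<in>UNIV. G x $ l $ k * christoffel G k i j x) =
    (pderivative i (\<lambda>y. G y $ j $ l) x + pderivative j (\<lambda>y. G y $ i $ l) x
         - pderivative l (\<lambda>y. G y $ i $ j) x) / 2"
proof -
  define w where "w = (\<chi> l. pderivative i (\<lambda>y. G y $ j $ l) x + pderivative j (\<lambda>y. G y $ i $ l) x
         - pderivative l (\<lambda>y. G y $ i $ j) x)"
  have c: "christoffel G k i j x = (matrix_inv (G x) *v w) $ k / 2" for k
    by (simp add: christoffel_def w_def matrix_vector_mult_def)
  have "(\<Sum>k\<in>UNIV. G x $ l $ k * christoffel G k i j x) = (G x *v (matrix_inv (G x) *v w)) $ l / 2"
    unfolding c by (simp add: matrix_vector_mult_def[of "G x"] sum_divide_distrib)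
  also have "G x *v (matrix_inv (G x) *v w) = w"
    using inv_G[OF assms] by (simp add: matrix_vector_mul_assoc)
  finally show ?thesis by (simp add: w_def)
qed

text \<open>In the sum over \<open>i\<close> the derivatives of the metric in the directions \<open>i\<close> and \<open>l\<close> cancel by the
  symmetry of the inverse metric. What remains is half of the logarithmic derivative of the
  determinant.\<close>

lemma christoffel_contraction:
  assumes "x \<in> S"
  shows "(\<Sum>i\<in>UNIV. christoffel G i i k x) =
    (\<Sum>i\<in>UNIV. \<Sum>l\<in>UNIV. matrix_inv (G x) $ i $ l * pderivative k (\<lambda>y. G y $ i $ l) x) / 2"
proof -
  define I where "I = (\<lambda>i l. matrix_inv (G x) $ i $ l)"
  have "(\<Sum>i\<in>UNIV. \<Sum>l\<in>UNIV. I i l * pderivative i (\<lambda>y. G y $ k $ l) x) =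
     (\<Sum>l\<in>UNIV. \<Sum>i\<in>UNIV. I i l * pderivative i (\<lambda>y. G y $ k $ l) x)" by (rule sum.swap)
  also have "\<dots> = (\<Sum>i\<in>UNIV. \<Sum>l\<in>UNIV. I i l * pderivative l (\<lambda>y. G y $ i $ k) x)"
    by (simp add: I_def sym_inv_entry[OF assms, of _ "_::'n"] pderivative_G_sym[OF assms, of _ k])
  finally have "(\<Sum>i\<in>UNIV. \<Sum>l\<in>UNIV. I i l * pderivative i (\<lambda>y. G y $ k $ l) x) =
     (\<Sum>i\<in>UNIV. \<Sum>l\<in>UNIV. I i l * pderivative l (\<lambda>y. G y $ i $ k) x)" .
  then show ?thesis
    unfolding christoffel_def I_def
    by (simp add: algebra_simps sum.distrib sum_subtractf flip: sum_divide_distrib)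
qed

lemma pderivative_inv:
  assumes x: "x \<in> S"
  shows "(\<chi> i j. pderivative a (\<lambda>y. matrix_inv (G y) $ i $ j) x) =
    - (matrix_inv (G x) ** (\<chi> i j. pderivative a (\<lambda>y. G y $ i $ j) x) ** matrix_inv (G x))"
proof -
  define DI where "DI = (\<chi> i j. pderivative a (\<lambda>y. matrix_inv (G y) $ i $ j) x)"
  define DG where "DG = (\<chi> i j. pderivative a (\<lambda>y. G y $ i $ j) x)"
  note d [simp] = smooth_on_imp_differentiable[OF smooth_inv x] smooth_on_imp_differentiable[OF smooth_G_entry x]
  have "(matrix_inv (G x) ** DG + DI ** G x) $ i $ j = 0" for i j
  proof -
    have "(matrix_inv (G x) ** DG + DI ** G x) $ i $ j
      = pderivative a (\<lambda>y. \<Sum>k\<in>UNIV. matrix_inv (G y) $ i $ k * G y $ k $ j) x"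
      by (simp add: pderivative_sum pderivative_mult matrix_mult_entry DI_def DG_def sum.distrib)
    also have "\<dots> = pderivative a (\<lambda>y. if i = j then 1 else 0) x"
    proof (rule pderivative_eq_on[OF open_S x])
      fix y assume "y \<in> S"
      then have "(matrix_inv (G y) ** G y) $ i $ j = (if i = j then 1 else 0)"
        by (simp add: inv_G mat_entry)
      then show "(\<Sum>k\<in>UNIV. matrix_inv (G y) $ i $ k * G y $ k $ j) = (if i = j then 1 else 0)"
        by (simp add: matrix_mult_entry)
    qed (intro smooth_on_sum smooth_on_mult open_S smooth_inv smooth_G_entry)
    finally show ?thesis by simp
  qed
  then have "DI ** G x = - (matrix_inv (G x) ** DG)"
    by (metis add_eq_0_iff vec_eq_iff zero_index)
  then have "DI ** G x ** matrix_inv (G x) = - (matrix_inv (G x) ** DG) ** matrix_inv (G x)" by simp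
  moreover have "(- M) ** N = - (M ** N)" for M N :: "real^'n^'n"
    by (simp add: vec_eq_iff matrix_mult_entry sum_negf)
  moreover have "DI ** G x ** matrix_inv (G x) = DI"
    using inv_G[OF x] by (simp flip: matrix_mul_assoc)
  ultimately show ?thesis unfolding DI_def DG_def by metis
qed

lemma ricci_entry:
  assumes x: "x \<in> S"
  shows "ricci G x $ j $ k = (\<Sum>i\<in>UNIV. pderivative i (christoffel G i j k) x)
     - pderivative j (\<lambda>y. \<Sum>i\<in>UNIV. christoffel G i i k y) x
     + (\<Sum>i\<in>UNIV. \<Sum>m\<in>UNIV. christoffel G i i m x * christoffel G m j k x)
     - (\<Sum>i\<in>UNIV. \<Sum>m\<in>UNIV. christoffel G i j m x * christoffel G m i k x)"
  by (simp add: ricci_def riemann_def sum.distrib sum_subtractf pderivative_sum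
      smooth_on_imp_differentiable[OF smooth_christoffel x])

text \<open>The trace of the curvature contains \<open>\<partial>\<^sub>j \<Gamma>\<^sup>i\<^sub>i\<^sub>k\<close>. Differentiating the formula for the contraction gives
  a term with second derivatives of the metric, symmetric because partial derivatives commute,
  and a term \<open>tr (\<partial>\<^sub>j g\<^bsup>-1\<^esup> \<partial>\<^sub>k g)\<close>, symmetric because \<open>\<partial>\<^sub>j g\<^bsup>-1\<^esup> = - g\<^bsup>-1\<^esup> \<partial>\<^sub>j g g\<^bsup>-1\<^esup>\<close> and the trace is cyclic.\<close>

lemma ricci_sym:
  assumes x: "x \<in> S"
  shows "transpose (ricci G x) = ricci G x"
proof -
  define I where "I = matrix_inv (G x)"
  define DG where "DG = (\<lambda>a. \<chi> i j. pderivative a (\<lambda>y. G y $ i $ j) x)"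
  define DI where "DI = (\<lambda>a. \<chi> i j. pderivative a (\<lambda>y. matrix_inv (G y) $ i $ j) x)"
  define E where "E = (\<lambda>j k. \<Sum>i\<in>UNIV. \<Sum>l\<in>UNIV.
      matrix_inv (G x) $ i $ l * pderivative j (pderivative k (\<lambda>y. G y $ i $ l)) x)"
  note d [simp] = smooth_on_imp_differentiable[OF smooth_inv x] smooth_on_imp_differentiable[OF smooth_G_entry x]
    smooth_on_imp_differentiable[OF smooth_on_pderivative[OF smooth_G_entry] x]
  have D: "DI a = - (I ** DG a ** I)" for a
    unfolding DI_def DG_def I_def by (rule pderivative_inv[OF x])
  have dc: "pderivative j (\<lambda>y. \<Sum>i\<in>UNIV. christoffel G i i k y) x = (E j k + trace (DI j ** DG k)) / 2" for j k
  proof -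
    have "pderivative j (\<lambda>y. \<Sum>i\<in>UNIV. christoffel G i i k y) x
      = pderivative j (\<lambda>y. (1/2) * (\<Sum>i\<in>UNIV. \<Sum>l\<in>UNIV. matrix_inv (G y) $ i $ l * pderivative k (\<lambda>y. G y $ i $ l) y)) x"
      by (rule pderivative_eq_on[OF open_S x _ smooth_on_sum[OF open_S smooth_christoffel]])
         (simp add: christoffel_contraction)
    also have "\<dots> = (1/2) * (\<Sum>i\<in>UNIV. \<Sum>l\<in>UNIV. matrix_inv (G x) $ i $ l * pderivative j (pderivative k (\<lambda>y. G y $ i $ l)) x
        + pderivative j (\<lambda>y. matrix_inv (G y) $ i $ l) x * pderivative k (\<lambda>y. G y $ i $ l) x)"
      by (subst pderivative_mult, simp, simp, simp add: pderivative_sum pderivative_mult)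
    also have "\<dots> = (E j k + (\<Sum>i\<in>UNIV. \<Sum>l\<in>UNIV.
         pderivative j (\<lambda>y. matrix_inv (G y) $ i $ l) x * pderivative k (\<lambda>y. G y $ l $ i) x)) / 2"
      using pderivative_G_sym[OF x, of k] by (simp add: E_def sum.distrib)
    also have "(\<Sum>i\<in>UNIV. \<Sum>l\<in>UNIV.
         pderivative j (\<lambda>y. matrix_inv (G y) $ i $ l) x * pderivative k (\<lambda>y. G y $ l $ i) x) = trace (DI j ** DG k)"
      by (simp add: trace_def matrix_mult_entry DI_def DG_def)
    finally show ?thesis .
  qed
  have tr: "trace (DI j ** DG k) = trace (DI k ** DG j)" for j k
  proof -
    have neg: "(- M) ** N = - (M ** N)" "trace (- M) = - trace M" for M N :: "real^'n^'n"
      by (simp_all add: vec_eq_iff matrix_mult_entry sum_negf trace_def)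
    have "trace (I ** DG j ** I ** DG k) = trace ((I ** DG j) ** (I ** DG k))"
      by (simp add: matrix_mul_assoc)
    also have "\<dots> = trace ((I ** DG k) ** (I ** DG j))" by (rule trace_mul_sym)
    finally show ?thesis by (simp add: D neg matrix_mul_assoc)
  qed
  have "E j k = E k j" for j k
    unfolding E_def using pderivative_commute[OF open_S smooth_G_entry x, of j k] by simp
  then have 1: "pderivative j (\<lambda>y. \<Sum>i\<in>UNIV. christoffel G i i k y) x =
      pderivative k (\<lambda>y. \<Sum>i\<in>UNIV. christoffel G i i j y) x" for j k
    unfolding dc using tr[of j k] by simp
  have 2: "(\<Sum>i\<in>UNIV. \<Sum>m\<in>UNIV. christoffel G i j m x * christoffel G m i k x) =
     (\<Sum>i\<in>UNIV. \<Sum>m\<in>UNIV. christoffel G i k m x * christoffel G m i j x)" for j k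
    by (subst sum.swap) (simp add: christoffel_sym[OF x, of _ _ j] christoffel_sym[OF x, of _ _ k] mult.commute)
  have "ricci G x $ j $ k = ricci G x $ k $ j" for j k
    unfolding ricci_entry[OF x]
    by (simp only: 1[of j k] 2[of j k] christoffel_sym[OF x, of _ j k] pderivative_christoffel_sym[OF x, of _ _ j k])
  then show ?thesis by (simp add: vec_eq_iff)
qed

lemma schouten_sym: "x \<in> S \<Longrightarrow> transpose (schouten G x) = schouten G x"
  by (simp add: vec_eq_iff schouten_def symmetric_matrix_entry[OF ricci_sym] symmetric_matrix_entry[OF sym_G])

lemma local_sigma2_trace:
  assumes "x \<in> S"
  defines "B \<equiv> matrix_inv (G x) ** schouten G x"
  shows "local_sigma2 G x = ((trace B)\<^sup>2 - trace (B ** B)) / 2"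
  unfolding local_sigma2_def B_def
  using assms(1) by (intro sigma2_self_adjoint sym_G schouten_sym pos_G)

lemma smooth_local_sigma2: "smooth_on S (local_sigma2 G)"
proof (rule smooth_on_cong[OF open_S])
  show "smooth_on S (\<lambda>x. ((trace (matrix_inv (G x) ** schouten G x))\<^sup>2 -
      trace ((matrix_inv (G x) ** schouten G x) ** (matrix_inv (G x) ** schouten G x))) / 2)"
    unfolding trace_def matrix_mult_entry
    by (intro smooth_on_divide_const smooth_on_diff smooth_on_power smooth_on_sum smooth_on_mult
        open_S smooth_inv smooth_schouten)
qed (simp add: local_sigma2_trace)

end

section \<open>Change of coordinates\<close>

lemma sum_rot3: "(\<Sum>a\<in>A. \<Sum>b\<in>B. \<Sum>c\<in>C. f a b c) = (\<Sum>c\<in>C. \<Sum>a\<in>A. \<Sum>b\<in>B. f a b c)"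
  by (subst sum.swap[of _ C B]) (rule sum.swap)

lemma frechet_derivative_entry:
  assumes "T differentiable at x"
  shows "frechet_derivative T (at x) v $ a = frechet_derivative (\<lambda>y. T y $ a) (at x) v"
proof -
  have "((\<lambda>y. T y $ a) has_derivative (\<lambda>v. frechet_derivative T (at x) v $ a)) (at x)"
    using assms bounded_linear.has_derivative[OF bounded_linear_vec_nth] frechet_derivative_works by blast
  from frechet_derivative_at[OF this] show ?thesis by metis
qed

lemma jacobian_entry:
  assumes "T differentiable at x"
  shows "matrix (frechet_derivative T (at x)) $ a $ i = pderivative i (\<lambda>y. T y $ a) x"
  by (simp add: matrix_def pderivative_def frechet_derivative_entry[OF assms])

lemma pderivative_chain:
  fixes T :: "real^'m \<Rightarrow> real^'n" and h :: "real^'n \<Rightarrow> real"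
  assumes T: "T differentiable at x" and h: "h differentiable at (T x)"
  shows "pderivative i (\<lambda>y. h (T y)) x = (\<Sum>a\<in>UNIV. pderivative a h (T x) * pderivative i (\<lambda>y. T y $ a) x)"
proof -
  let ?D = "frechet_derivative h (at (T x))" and ?v = "frechet_derivative T (at x) (axis i 1)"
  have hd: "(h has_derivative ?D) (at (T x))" using h frechet_derivative_works by blast
  have "((\<lambda>y. h (T y)) has_derivative (\<lambda>v. ?D (frechet_derivative T (at x) v))) (at x)"
    using has_derivative_compose[OF T[unfolded frechet_derivative_works] hd] .
  from pderivative_eqI[OF this] have "pderivative i (\<lambda>y. h (T y)) x = ?D ?v" .
  also have "\<dots> = ?D (\<Sum>a\<in>UNIV. (?v $ a) *\<^sub>R axis a 1)"
    by (simp only: basis_expansion[of ?v, unfolded scalar_mult_eq_scaleR])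
  also have "\<dots> = (\<Sum>a\<in>UNIV. ?D ((?v $ a) *\<^sub>R axis a 1))"
    using linear_sum[OF has_derivative_linear[OF hd]] .
  also have "\<dots> = (\<Sum>a\<in>UNIV. (?v $ a) * ?D (axis a 1))"
    by (simp only: linear_cmul[OF has_derivative_linear[OF hd]] real_scaleR_def)
  finally show ?thesis
    by (simp add: pderivative_def frechet_derivative_entry[OF T] mult.commute)
qed

locale coordinate_change = G: coordinate_metric S G + H: coordinate_metric S' H
  for S :: "(real^'n::finite) set" and G S' H +
  fixes T :: "real^'n \<Rightarrow> real^'n" and J :: "'n \<Rightarrow> 'n \<Rightarrow> real^'n \<Rightarrow> real"
  defines J_def: "J \<equiv> \<lambda>a i. pderivative i (\<lambda>y. T y $ a)"
  assumes smooth_T: "smooth_on S T" and maps_T: "T ` S \<subseteq> S'"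
    and pullback: "x \<in> S \<Longrightarrow> G x = transpose (\<chi> a i. J a i x) ** H (T x) ** (\<chi> a i. J a i x)"
begin

lemma T_in: "x \<in> S \<Longrightarrow> T x \<in> S'"
  using maps_T by blast

lemma smooth_J: "smooth_on S (J a i)"
  unfolding J_def using G.open_S smooth_T by (intro smooth_on_pderivative smooth_on_vec_nth)

lemma J_commute: "x \<in> S \<Longrightarrow> pderivative i (J a j) x = pderivative j (J a i) x"
  unfolding J_def using G.open_S smooth_T
  by (intro pderivative_commute[of S] smooth_on_vec_nth)

lemma smooth_comp: "smooth_on S' h \<Longrightarrow> smooth_on S (\<lambda>x. h (T x))"
  using smooth_on_compose[OF G.open_S maps_T smooth_T] .

lemma pderivative_comp:
  assumes "x \<in> S" "smooth_on S' h"
  shows "pderivative i (\<lambda>y. h (T y)) x = (\<Sum>a\<in>UNIV. pderivative a h (T x) * J a i x)"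
  unfolding J_def
  using pderivative_chain[OF smooth_on_imp_differentiable[OF smooth_T assms(1)]
      smooth_on_imp_differentiable[OF assms(2) T_in[OF assms(1)]]] .

lemma pullback_entry:
  assumes "x \<in> S"
  shows "G x $ i $ j = (\<Sum>a\<in>UNIV. \<Sum>b\<in>UNIV. J a i x * H (T x) $ a $ b * J b j x)"
proof -
  have "G x $ i $ j = (\<Sum>b\<in>UNIV. \<Sum>a\<in>UNIV. J a i x * H (T x) $ a $ b * J b j x)"
    unfolding pullback[OF assms] by (simp add: matrix_mult_entry sum_distrib_right)
  also have "\<dots> = (\<Sum>a\<in>UNIV. \<Sum>b\<in>UNIV. J a i x * H (T x) $ a $ b * J b j x)" by (rule sum.swap)
  finally show ?thesis .
qed

text \<open>Both sides are compared after lowering the index with the pulled back metric. Differentiating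
  the pullback formula produces terms \<open>X\<close> with a derivative of the Jacobian and terms \<open>Y\<close> with a
  derivative of the metric \<open>H\<close>. In the combination of derivatives that defines the Christoffel symbols
  the symmetry of \<open>X\<close> in its first two indices leaves \<open>2 X\<close>, the inhomogeneous term.\<close>

lemma christoffel_transform:
  assumes x: "x \<in> S"
  shows "(\<Sum>k\<in>UNIV. J c k x * christoffel G k i j x) =
    (\<Sum>b\<in>UNIV. (\<Sum>a\<in>UNIV. J a i x * christoffel H c a b (T x)) * J b j x) + pderivative i (J c j) x"
proof -
  note Tx = T_in[OF x]
  define h where "h = (\<lambda>a b. H (T x) $ a $ b)"
  define dh where "dh = (\<lambda>c a b. pderivative c (\<lambda>y. H y $ a $ b) (T x))"
  define X where "X = (\<lambda>i j l. \<Sum>b\<in>UNIV. \<Sum>d\<in>UNIV. pderivative i (J b j) x * h b d * J d l x)"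
  define Y where "Y = (\<lambda>i j l. \<Sum>b\<in>UNIV. \<Sum>d\<in>UNIV. \<Sum>a\<in>UNIV. dh a b d * J a i x * J b j x * J d l x)"
  have h_sym: "h a b = h b a" for a b unfolding h_def by (rule H.sym_G_entry[OF Tx])
  have dh_sym: "dh c a b = dh c b a" for a b c unfolding dh_def by (rule H.pderivative_G_sym[OF Tx])
  note [simp] = smooth_on_imp_differentiable[OF smooth_J x]
    smooth_on_imp_differentiable[OF smooth_comp[OF H.smooth_G_entry] x]
  have X_sym: "X i j l = X j i l" for i j l
    unfolding X_def using J_commute[OF x, of i _ j] by simp
  have dG: "pderivative i (\<lambda>y. G y $ j $ l) x = X i j l + X i l j + Y i j l" for i j l
  proof -
    have "pderivative i (\<lambda>y. G y $ j $ l) x =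
       pderivative i (\<lambda>y. \<Sum>b\<in>UNIV. \<Sum>d\<in>UNIV. J b j y * H (T y) $ b $ d * J d l y) x"
      by (rule pderivative_eq_on[OF G.open_S x _ G.smooth_G_entry]) (rule pullback_entry)
    also have "\<dots> = (\<Sum>b\<in>UNIV. \<Sum>d\<in>UNIV. J b j x * h b d * pderivative i (J d l) x
       + (J b j x * (\<Sum>a\<in>UNIV. dh a b d * J a i x) + pderivative i (J b j) x * h b d) * J d l x)"
      by (simp add: pderivative_sum pderivative_mult differentiable_sum differentiable_mult
          pderivative_comp[OF x H.smooth_G_entry] h_def dh_def)
    also have "\<dots> = (\<Sum>b\<in>UNIV. \<Sum>d\<in>UNIV. J b j x * h b d * pderivative i (J d l) x) + Y i j l + X i j l"
      unfolding X_def Y_def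
      by (simp add: sum.distrib distrib_right distrib_left sum_distrib_left sum_distrib_right mult_ac add_ac)
    also have "(\<Sum>b\<in>UNIV. \<Sum>d\<in>UNIV. J b j x * h b d * pderivative i (J d l) x) = X i l j"
      unfolding X_def by (subst sum.swap) (simp add: h_sym mult_ac)
    finally show ?thesis by simp
  qed
  define L where "L = (\<chi> c. (\<Sum>b\<in>UNIV. (\<Sum>a\<in>UNIV. J a i x * christoffel H c a b (T x)) * J b j x) + pderivative i (J c j) x)"
  define V where "V = (\<chi> c. \<Sum>k\<in>UNIV. J c k x * christoffel G k i j x)"
  define Jm where "Jm = (\<chi> a i. J a i x)"
  define M where "M = transpose Jm ** H (T x)"
  have M_entry: "M $ l $ c = (\<Sum>d\<in>UNIV. J d l x * h d c)" for l c
    by (simp add: M_def matrix_mult_entry Jm_def h_def)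
  have MJ: "M ** Jm = G x" using pullback[OF x] by (simp add: M_def Jm_def)
  have "(M *v V) $ l = X i j l + (Y i j l + Y j i l - Y l i j) / 2" for l
  proof -
    have "V = Jm *v (\<chi> k. christoffel G k i j x)"
      by (simp add: vec_eq_iff V_def Jm_def matrix_vector_mult_def)
    then have "M *v V = G x *v (\<chi> k. christoffel G k i j x)"
      by (simp add: matrix_vector_mul_assoc MJ)
    then have "(M *v V) $ l = (\<Sum>k\<in>UNIV. G x $ l $ k * christoffel G k i j x)"
      by (simp add: matrix_vector_mult_def)
    also have "\<dots> = X i j l + (Y i j l + Y j i l - Y l i j) / 2"
      unfolding G.lower_christoffel[OF x] dG
      using X_sym[of i j l] X_sym[of i l j] X_sym[of j l i] by (simp add: field_simps)
    finally show ?thesis .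
  qed
  moreover have "(M *v L) $ l = X i j l + (Y i j l + Y j i l - Y l i j) / 2" for l
  proof -
    have 1: "(\<Sum>c\<in>UNIV. M $ l $ c * pderivative i (J c j) x) = X i j l"
      unfolding M_entry X_def by (simp add: sum_distrib_right sum_distrib_left h_sym mult_ac)
    have "(\<Sum>c\<in>UNIV. M $ l $ c * (\<Sum>b\<in>UNIV. (\<Sum>a\<in>UNIV. J a i x * christoffel H c a b (T x)) * J b j x))
       = (\<Sum>c\<in>UNIV. \<Sum>d\<in>UNIV. \<Sum>b\<in>UNIV. \<Sum>a\<in>UNIV. J d l x * J a i x * J b j x * (h d c * christoffel H c a b (T x)))"
      unfolding M_entry sum_product by (simp add: sum_distrib_left sum_distrib_right mult_ac)
    also have "\<dots> = (\<Sum>d\<in>UNIV. \<Sum>c\<in>UNIV. \<Sum>b\<in>UNIV. \<Sum>a\<in>UNIV. J d l x * J a i x * J b j x * (h d c * christoffel H c a b (T x)))"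
      by (rule sum.swap)
    also have "\<dots> = (\<Sum>d\<in>UNIV. \<Sum>b\<in>UNIV. \<Sum>a\<in>UNIV. \<Sum>c\<in>UNIV. J d l x * J a i x * J b j x * (h d c * christoffel H c a b (T x)))"
      by (rule sum.cong[OF refl]) (rule sum_rot3[symmetric])
    also have "\<dots> = (\<Sum>d\<in>UNIV. \<Sum>b\<in>UNIV. \<Sum>a\<in>UNIV. J d l x * J a i x * J b j x * ((dh a b d + dh b a d - dh d a b) / 2))"
      by (simp only: h_def dh_def sum_distrib_left[symmetric] H.lower_christoffel[OF Tx])
    also have "\<dots> = ((\<Sum>d\<in>UNIV. \<Sum>b\<in>UNIV. \<Sum>a\<in>UNIV. dh a b d * J a i x * J b j x * J d l x)
       + (\<Sum>d\<in>UNIV. \<Sum>b\<in>UNIV. \<Sum>a\<in>UNIV. dh b a d * J b j x * J a i x * J d l x)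
       - (\<Sum>d\<in>UNIV. \<Sum>b\<in>UNIV. \<Sum>a\<in>UNIV. dh d a b * J d l x * J a i x * J b j x)) / 2"
      by (simp add: sum.distrib sum_subtractf algebra_simps add_divide_distrib diff_divide_distrib flip: sum_divide_distrib)
    also have "(\<Sum>d\<in>UNIV. \<Sum>b\<in>UNIV. \<Sum>a\<in>UNIV. dh a b d * J a i x * J b j x * J d l x) = Y i j l"
      unfolding Y_def by (rule sum.swap)
    also have "(\<Sum>d\<in>UNIV. \<Sum>b\<in>UNIV. \<Sum>a\<in>UNIV. dh b a d * J b j x * J a i x * J d l x) = Y j i l"
      unfolding Y_def by (rule sum_rot3)
    also have "(\<Sum>d\<in>UNIV. \<Sum>b\<in>UNIV. \<Sum>a\<in>UNIV. dh d a b * J d l x * J a i x * J b j x) = Y l i j"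
      unfolding Y_def by (subst sum_rot3) (rule sum.cong[OF refl], rule sum.swap)
    finally show ?thesis
      using 1 by (simp add: matrix_vector_mult_def L_def distrib_left sum.distrib)
  qed
  ultimately have "M *v V = M *v L" by (simp add: vec_eq_iff)
  moreover have "det M \<noteq> 0" using MJ G.det_G[OF x] by (metis det_mul mult_zero_left)
  ultimately have "V = L"
    by (metis matrix_inv_mult(2) matrix_vector_mul_assoc matrix_vector_mul_lid)
  then have "V $ c = L $ c" by simp
  then show ?thesis by (simp add: V_def L_def)
qed

text \<open>With \<open>\<omega>\<^sub>i\<close> the matrix of Christoffel symbols in direction \<open>i\<close> and \<open>J\<close> the Jacobian, the
  transformation law of the connection is \<open>J \<omega>\<^sub>i = \<Omega>\<^sub>i J + \<partial>\<^sub>i J\<close>. Differentiating it and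
  antisymmetrising cancels all derivatives of \<open>J\<close>, so that the curvature matrices
  \<open>\<partial>\<^sub>i \<omega>\<^sub>j - \<partial>\<^sub>j \<omega>\<^sub>i + [\<omega>\<^sub>i, \<omega>\<^sub>j]\<close> are intertwined by \<open>J\<close>.\<close>

lemma riemann_transform:
  assumes x: "x \<in> S"
  shows "(\<Sum>l\<in>UNIV. J c l x * riemann G l k i j x) =
    (\<Sum>b\<in>UNIV. (\<Sum>a\<in>UNIV. \<Sum>d\<in>UNIV. J a i x * J d j x * riemann H c b a d (T x)) * J b k x)"
proof -
  note Tx = T_in[OF x]
  define Jm where "Jm = (\<chi> c k. J c k x)"
  define dJ where "dJ = (\<lambda>i. \<chi> c k. pderivative i (J c k) x)"
  define ddJ where "ddJ = (\<lambda>i j. \<chi> c k. pderivative i (pderivative j (J c k)) x)"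
  define om where "om = (\<lambda>i. \<chi> l k. christoffel G l i k x)"
  define dom where "dom = (\<lambda>i j. \<chi> l k. pderivative i (christoffel G l j k) x)"
  define Om where "Om = (\<lambda>i. \<chi> c b. \<Sum>a\<in>UNIV. J a i x * christoffel H c a b (T x))"
  define dOm where "dOm = (\<lambda>i j. \<chi> c b. pderivative i (\<lambda>y. \<Sum>a\<in>UNIV. J a j y * christoffel H c a b (T y)) x)"
  define R where "R = (\<lambda>i j. dom i j - dom j i + om i ** om j - om j ** om i)"
  define R' where "R' = (\<lambda>i j. dOm i j - dOm j i + Om i ** Om j - Om j ** Om i)"
  note sm = smooth_J G.smooth_christoffel smooth_comp[OF H.smooth_christoffel]
  note [simp] = sm[THEN smooth_on_imp_differentiable, OF x]
    smooth_on_imp_differentiable[OF smooth_on_pderivative[OF smooth_J] x]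
  have 1: "Jm ** om i = Om i ** Jm + dJ i" for i
    using christoffel_transform[OF x]
    by (simp add: vec_eq_iff matrix_mult_entry Jm_def om_def Om_def dJ_def)
  have 2: "dJ i ** om j + Jm ** dom i j = dOm i j ** Jm + Om j ** dJ i + ddJ i j" for i j
  proof -
    have "(dJ i ** om j + Jm ** dom i j) $ c $ l = (dOm i j ** Jm + Om j ** dJ i + ddJ i j) $ c $ l" for c l
    proof -
      have "(dJ i ** om j + Jm ** dom i j) $ c $ l =
          pderivative i (\<lambda>y. \<Sum>k\<in>UNIV. J c k y * christoffel G k j l y) x"
        by (simp add: pderivative_sum pderivative_mult sum.distrib matrix_mult_entry
            dJ_def om_def Jm_def dom_def)
      also have "\<dots> = pderivative i (\<lambda>y. (\<Sum>b\<in>UNIV. (\<Sum>a\<in>UNIV. J a j y * christoffel H c a b (T y)) * J b l y)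
           + pderivative j (J c l) y) x"
        by (rule pderivative_eq_on[OF G.open_S x])
           (auto simp: christoffel_transform intro!: smooth_on_sum smooth_on_mult G.open_S sm)
      also have "\<dots> = (dOm i j ** Jm + Om j ** dJ i + ddJ i j) $ c $ l"
        by (simp add: pderivative_add pderivative_sum[of UNIV "\<lambda>b y. _ b y * J b l y"] pderivative_mult
            sum.distrib matrix_mult_entry dJ_def Om_def Jm_def dOm_def ddJ_def)
      finally show ?thesis .
    qed
    then show ?thesis by (simp only: vec_eq_iff) blast
  qed
  have ddJ: "ddJ i j = ddJ j i" for i j
    by (simp add: vec_eq_iff ddJ_def pderivative_commute[OF G.open_S smooth_J x, of i j])
  have 3: "Jm ** om i ** om j = Om i ** Om j ** Jm + Om i ** dJ j + dJ i ** om j" for i j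
  proof -
    have "Jm ** om i ** om j = Om i ** (Jm ** om j) + dJ i ** om j"
      by (simp add: 1[of i] matrix_add_rdistrib matrix_mul_assoc)
    then show ?thesis by (simp add: 1[of j] matrix_add_ldistrib matrix_mul_assoc)
  qed
  have 4: "Jm ** dom i j = dOm i j ** Jm + Om j ** dJ i + ddJ i j - dJ i ** om j" for i j
    using 2[of i j] by (simp add: algebra_simps)
  have JR: "Jm ** R i j = R' i j ** Jm"
    unfolding R_def R'_def
    by (simp add: matrix_add_ldistrib matrix_diff_ldistrib matrix_add_rdistrib matrix_diff_rdistrib
        matrix_mul_assoc 3 4 ddJ[of i j])
  have R: "R i j $ l $ k = riemann G l k i j x" for l k
    by (simp add: R_def riemann_def matrix_mult_entry dom_def om_def sum_subtractf)
  have R': "R' i j $ c $ b = (\<Sum>a\<in>UNIV. \<Sum>d\<in>UNIV. J a i x * J d j x * riemann H c b a d (T x))" for c b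
  proof -
    have dO: "dOm i j $ c $ b = (\<Sum>a\<in>UNIV. pderivative i (J a j) x * christoffel H c a b (T x))
       + (\<Sum>a\<in>UNIV. \<Sum>d\<in>UNIV. J a j x * J d i x * pderivative d (christoffel H c a b) (T x))" for i j
      by (simp add: dOm_def pderivative_sum pderivative_mult pderivative_comp[OF x H.smooth_christoffel]
          sum.distrib sum_distrib_left mult_ac)
    have OO: "(Om i ** Om j) $ c $ b = (\<Sum>a\<in>UNIV. \<Sum>d\<in>UNIV. J a i x * J d j x *
        (\<Sum>m\<in>UNIV. christoffel H c a m (T x) * christoffel H m d b (T x)))" for i j
    proof -
      have "(Om i ** Om j) $ c $ b = (\<Sum>m\<in>UNIV. \<Sum>a\<in>UNIV. \<Sum>d\<in>UNIV. J a i x * J d j x *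
          (christoffel H c a m (T x) * christoffel H m d b (T x)))"
        by (simp add: matrix_mult_entry Om_def sum_product mult_ac)
      also have "\<dots> = (\<Sum>a\<in>UNIV. \<Sum>d\<in>UNIV. \<Sum>m\<in>UNIV. J a i x * J d j x *
          (christoffel H c a m (T x) * christoffel H m d b (T x)))"
        by (rule sum_rot3[symmetric])
      finally show ?thesis by (simp add: sum_distrib_left)
    qed
    have s1: "(\<Sum>a\<in>UNIV. \<Sum>d\<in>UNIV. J a j x * J d i x * f a d) =
        (\<Sum>a\<in>UNIV. \<Sum>d\<in>UNIV. J a i x * J d j x * f d a)" for f :: "'n \<Rightarrow> 'n \<Rightarrow> real"
      by (subst sum.swap) (simp add: mult_ac)
    have "R' i j $ c $ b = (\<Sum>a\<in>UNIV. \<Sum>d\<in>UNIV. J a j x * J d i x * pderivative d (christoffel H c a b) (T x))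
       - (\<Sum>a\<in>UNIV. \<Sum>d\<in>UNIV. J a i x * J d j x * pderivative d (christoffel H c a b) (T x))
       + (\<Sum>a\<in>UNIV. \<Sum>d\<in>UNIV. J a i x * J d j x *
            (\<Sum>m\<in>UNIV. christoffel H c a m (T x) * christoffel H m d b (T x)))
       - (\<Sum>a\<in>UNIV. \<Sum>d\<in>UNIV. J a j x * J d i x *
            (\<Sum>m\<in>UNIV. christoffel H c a m (T x) * christoffel H m d b (T x)))"
      unfolding R'_def by (simp add: dO OO J_commute[OF x, of i _ j])
    then show ?thesis
      unfolding s1 riemann_def
      by (simp add: sum.distrib sum_subtractf algebra_simps flip: sum_distrib_left)
  qed
  have "(Jm ** R i j) $ c $ k = (R' i j ** Jm) $ c $ k" using JR by simp
  then show ?thesis by (simp add: matrix_mult_entry R R' Jm_def)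
qed

text \<open>Contracting the intertwining relation for the curvature: the Jacobian in the contracted lower
  index cancels against its inverse in the upper index.\<close>

lemma ricci_transform:
  assumes x: "x \<in> S"
  shows "ricci G x = transpose (\<chi> a i. J a i x) ** ricci H (T x) ** (\<chi> a i. J a i x)"
proof -
  define Jm where "Jm = (\<chi> c k. J c k x)"
  have "det Jm \<noteq> 0"
    using G.det_G[OF x] unfolding pullback[OF x] Jm_def det_mul by auto
  then have K: "Jm ** matrix_inv Jm = mat 1" "matrix_inv Jm ** Jm = mat 1"
    by (simp_all add: matrix_inv_mult)
  define K where "K = (\<lambda>i c. matrix_inv Jm $ i $ c)"
  have KJ: "(\<Sum>c\<in>UNIV. K i c * J c l x) = (if i = l then 1 else 0)" for i l
  proof -
    have "(matrix_inv Jm ** Jm) $ i $ l = (if i = l then 1 else 0)"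
      by (simp only: K mat_entry)
    then show ?thesis by (simp add: matrix_mult_entry K_def Jm_def)
  qed
  have JK: "(\<Sum>i\<in>UNIV. J a i x * K i c) = (if a = c then 1 else 0)" for a c
  proof -
    have "(Jm ** matrix_inv Jm) $ a $ c = (if a = c then 1 else 0)"
      by (simp only: K mat_entry)
    then show ?thesis by (simp add: matrix_mult_entry K_def Jm_def)
  qed
  have rm: "riemann G i k i j x = (\<Sum>c\<in>UNIV. K i c *
      (\<Sum>b\<in>UNIV. (\<Sum>a\<in>UNIV. \<Sum>d\<in>UNIV. J a i x * J d j x * riemann H c b a d (T x)) * J b k x))" for i j k
  proof -
    have "(\<Sum>c\<in>UNIV. K i c * (\<Sum>l\<in>UNIV. J c l x * riemann G l k i j x)) =
        (\<Sum>l\<in>UNIV. (\<Sum>c\<in>UNIV. K i c * J c l x) * riemann G l k i j x)"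
      by (simp add: sum_distrib_left sum_distrib_right mult.assoc) (rule sum.swap)
    also have "\<dots> = riemann G i k i j x"
      by (simp add: KJ if_distrib[of "\<lambda>x. x * _"] cong: if_cong)
    finally show ?thesis by (simp add: riemann_transform[OF x])
  qed
  have "ricci G x $ j $ k = (transpose Jm ** ricci H (T x) ** Jm) $ j $ k" for j k
  proof -
    define F where "F = (\<lambda>c a. \<Sum>b\<in>UNIV. \<Sum>d\<in>UNIV. J d j x * riemann H c b a d (T x) * J b k x)"
    have "riemann G i k i j x = (\<Sum>c\<in>UNIV. \<Sum>a\<in>UNIV. J a i x * K i c * F c a)" for i
    proof -
      have "(\<Sum>b\<in>UNIV. (\<Sum>a\<in>UNIV. \<Sum>d\<in>UNIV. J a i x * J d j x * riemann H c b a d (T x)) * J b k x)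
         = (\<Sum>a\<in>UNIV. J a i x * F c a)" for c
        unfolding F_def sum_distrib_left sum_distrib_right
        by (subst sum.swap) (simp add: mult_ac)
      then show ?thesis unfolding rm by (simp add: sum_distrib_left mult_ac)
    qed
    then have "ricci G x $ j $ k = (\<Sum>i\<in>UNIV. \<Sum>c\<in>UNIV. \<Sum>a\<in>UNIV. J a i x * K i c * F c a)"
      by (simp add: ricci_def)
    also have "\<dots> = (\<Sum>c\<in>UNIV. \<Sum>a\<in>UNIV. (\<Sum>i\<in>UNIV. J a i x * K i c) * F c a)"
      unfolding sum_distrib_right by (rule sum_rot3[symmetric])
    also have "\<dots> = (\<Sum>c\<in>UNIV. F c c)"
      by (simp add: JK if_distrib[of "\<lambda>x. x * _"] cong: if_cong)
    also have "\<dots> = (\<Sum>b\<in>UNIV. \<Sum>d\<in>UNIV. J d j x * (\<Sum>c\<in>UNIV. riemann H c b c d (T x)) * J b k x)"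
      unfolding F_def sum_distrib_left sum_distrib_right by (rule sum_rot3[symmetric])
    also have "\<dots> = (transpose Jm ** ricci H (T x) ** Jm) $ j $ k"
      by (simp add: matrix_mult_entry Jm_def ricci_def sum_distrib_right)
    finally show ?thesis .
  qed
  then show ?thesis by (simp add: vec_eq_iff Jm_def)
qed

text \<open>The endomorphisms obtained from the Schouten tensor by raising an index are conjugate under the
  Jacobian and therefore have the same eigenvalues.\<close>

theorem local_sigma2_transform:
  assumes x: "x \<in> S"
  shows "local_sigma2 G x = local_sigma2 H (T x)"
proof -
  note Tx = T_in[OF x]
  define Jm where "Jm = (\<chi> c k. J c k x)"
  define K where "K = matrix_inv Jm"
  have "det Jm \<noteq> 0"
    using G.det_G[OF x] unfolding pullback[OF x] Jm_def det_mul by auto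
  then have K: "Jm ** K = mat 1" "K ** Jm = mat 1"
    by (simp_all add: matrix_inv_mult K_def)
  define g where "g = matrix_inv (G x)"
  define h where "h = matrix_inv (H (T x))"
  have tK: "transpose Jm ** transpose K = mat 1" "transpose K ** transpose Jm = mat 1"
    using K by (metis matrix_transpose_mul transpose_mat)+
  have GK: "transpose K ** G x = H (T x) ** Jm"
    unfolding pullback[OF x] Jm_def[symmetric] by (simp add: matrix_mul_assoc tK)
  have "h ** transpose K = h ** (transpose K ** G x) ** g"
    using G.inv_G(1)[OF x] by (simp add: g_def flip: matrix_mul_assoc)
  also have "\<dots> = Jm ** g"
    unfolding GK using H.inv_G(2)[OF Tx] by (simp add: h_def matrix_mul_assoc)
  finally have gh: "Jm ** g = h ** transpose K" by simp
  have Jg: "Jm ** (g ** ricci G x) = (h ** ricci H (T x)) ** Jm"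
  proof -
    have "Jm ** (g ** ricci G x) = h ** (transpose K ** transpose Jm) ** ricci H (T x) ** Jm"
      unfolding ricci_transform[OF x] Jm_def[symmetric] by (simp add: matrix_mul_assoc gh)
    then show ?thesis by (simp add: tK)
  qed
  have scal: "scalar_curvature A y = trace (matrix_inv (A y) ** ricci A y)"
    if "transpose (ricci A y) = ricci A y" for A :: "real^'n \<Rightarrow> real^'n^'n" and y
    using symmetric_matrix_entry[OF that]
    by (simp add: scalar_curvature_def trace_def matrix_mult_entry)
  have "trace (h ** ricci H (T x)) = trace ((h ** ricci H (T x)) ** Jm ** K)"
    using K(1) by (simp flip: matrix_mul_assoc)
  also have "\<dots> = trace (K ** (Jm ** (g ** ricci G x)))"
    unfolding Jg[symmetric] by (rule trace_mul_sym)
  also have "\<dots> = trace (g ** ricci G x)" using K(2) by (simp add: matrix_mul_assoc)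
  finally have sc: "scalar_curvature H (T x) = scalar_curvature G x"
    using G.ricci_sym[OF x] H.ricci_sym[OF Tx] by (simp add: scal g_def h_def)
  have sch: "matrix_inv (A y) ** schouten A y = (1 / (real CARD('n) - 2)) *\<^sub>R (matrix_inv (A y) ** ricci A y
      - (scalar_curvature A y / (2 * (real CARD('n) - 1))) *\<^sub>R mat 1)"
    if "matrix_inv (A y) ** A y = mat 1" for A :: "real^'n \<Rightarrow> real^'n^'n" and y
    unfolding schouten_def
    by (simp add: matrix_diff_ldistrib matrix_scalar_ac that scaleR_diff_right flip: scalar_matrix_assoc)
  have "(h ** schouten H (T x)) ** Jm = Jm ** (g ** schouten G x)"
    unfolding g_def h_def sch[of G, OF G.inv_G(2)[OF x]] sch[of H, OF H.inv_G(2)[OF Tx]]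
    using Jg unfolding g_def h_def
    by (simp add: matrix_scalar_ac matrix_diff_ldistrib matrix_diff_rdistrib sc scaleR_diff_right flip: scalar_matrix_assoc)
  from charpoly_similar[OF K(1) this] show ?thesis
    by (simp add: local_sigma2_def eigenvalues_def g_def h_def)
qed

end

section \<open>Oscillating conformal factors\<close>

text \<open>The relation \<open>F = O(k\<^sup>m)\<close>, uniformly on \<open>L\<close>. Starting at \<open>k = 1\<close> makes it monotone in \<open>m\<close>.\<close>

definition of_order :: "'a set \<Rightarrow> nat \<Rightarrow> (nat \<Rightarrow> 'a \<Rightarrow> real) \<Rightarrow> bool" where
  "of_order L m F \<longleftrightarrow> (\<exists>C. \<forall>k\<ge>1. \<forall>x\<in>L. \<bar>F k x\<bar> \<le> C * real k ^ m)"

lemma of_order_cong: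
  "(\<And>k x. x \<in> L \<Longrightarrow> F k x = F' k x) \<Longrightarrow> of_order L m F \<longleftrightarrow> of_order L m F'"
  unfolding of_order_def by simp

lemma of_order_add: "of_order L m F \<Longrightarrow> of_order L m F' \<Longrightarrow> of_order L m (\<lambda>k x. F k x + F' k x)"
proof -
  assume "of_order L m F" "of_order L m F'"
  then obtain C C' where C: "\<And>k x. k \<ge> 1 \<Longrightarrow> x \<in> L \<Longrightarrow> \<bar>F k x\<bar> \<le> C * real k ^ m"
     "\<And>k x. k \<ge> 1 \<Longrightarrow> x \<in> L \<Longrightarrow> \<bar>F' k x\<bar> \<le> C' * real k ^ m"
    unfolding of_order_def by blast
  have "\<bar>F k x + F' k x\<bar> \<le> (C + C') * real k ^ m" if "k \<ge> 1" "x \<in> L" for k x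
    using C(1)[OF that] C(2)[OF that] abs_triangle_ineq[of "F k x" "F' k x"] by (simp add: algebra_simps)
  then show ?thesis unfolding of_order_def by blast
qed

lemma of_order_mult:
  "of_order L m F \<Longrightarrow> of_order L m' F' \<Longrightarrow> of_order L (m + m') (\<lambda>k x. F k x * F' k x)"
proof -
  assume "of_order L m F" "of_order L m' F'"
  then obtain C C' where C: "\<And>k x. k \<ge> 1 \<Longrightarrow> x \<in> L \<Longrightarrow> \<bar>F k x\<bar> \<le> C * real k ^ m"
     "\<And>k x. k \<ge> 1 \<Longrightarrow> x \<in> L \<Longrightarrow> \<bar>F' k x\<bar> \<le> C' * real k ^ m'"
    unfolding of_order_def by blast
  have "\<bar>F k x * F' k x\<bar> \<le> (C * C') * real k ^ (m + m')" if "k \<ge> 1" "x \<in> L" for k x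
  proof -
    have "\<bar>F k x\<bar> * \<bar>F' k x\<bar> \<le> (C * real k ^ m) * (C' * real k ^ m')"
      using C(1)[OF that] C(2)[OF that] abs_ge_zero order_trans by (intro mult_mono) blast+
    then show ?thesis by (simp add: abs_mult power_add mult_ac)
  qed
  then show ?thesis unfolding of_order_def by blast
qed

lemma of_order_mono:
  assumes "of_order L m F" "m \<le> m'"
  shows "of_order L m' F"
proof -
  obtain C where C: "\<And>k x. k \<ge> 1 \<Longrightarrow> x \<in> L \<Longrightarrow> \<bar>F k x\<bar> \<le> C * real k ^ m"
    using assms unfolding of_order_def by blast
  have "\<bar>F k x\<bar> \<le> \<bar>C\<bar> * real k ^ m'" if "k \<ge> 1" "x \<in> L" for k x
  proof -
    have "C * real k ^ m \<le> \<bar>C\<bar> * real k ^ m'"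
      using that assms(2) by (intro mult_mono power_increasing) auto
    then show ?thesis using C[OF that] by simp
  qed
  then show ?thesis unfolding of_order_def by blast
qed

lemma of_order_bounded: "(\<And>k x. x \<in> L \<Longrightarrow> \<bar>F k x\<bar> \<le> C) \<Longrightarrow> of_order L 0 F"
  unfolding of_order_def by auto

lemma of_order_const: "of_order L 0 (\<lambda>k x. c)"
  by (rule of_order_bounded[of _ _ "\<bar>c\<bar>"]) simp

lemma of_order_minus: "of_order L m F \<Longrightarrow> of_order L m (\<lambda>k x. - F k x)"
  unfolding of_order_def by simp

lemma of_order_diff: "of_order L m F \<Longrightarrow> of_order L m F' \<Longrightarrow> of_order L m (\<lambda>k x. F k x - F' k x)"
  using of_order_add[OF _ of_order_minus, of L m F F'] by simp

lemma of_order_mult_bounded: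
  "of_order L 0 F \<Longrightarrow> of_order L m F' \<Longrightarrow> of_order L m (\<lambda>k x. F k x * F' k x)"
  using of_order_mult[of L 0 F m F'] by simp

lemma of_order_cmult: "of_order L m F \<Longrightarrow> of_order L m (\<lambda>k x. c * F k x)"
  by (rule of_order_mult_bounded[OF of_order_const])

lemma of_order_zero: "of_order L m (\<lambda>k x. 0)"
  by (rule of_order_mono[OF of_order_const]) simp

lemma of_order_sum:
  "(\<And>i. i \<in> I \<Longrightarrow> of_order L m (F i)) \<Longrightarrow> of_order L m (\<lambda>k x. \<Sum>i\<in>I. F i k x)"
  by (induction I rule: infinite_finite_induct) (auto intro: of_order_zero of_order_add)

lemma of_order_continuous:
  fixes f :: "'a::topological_space \<Rightarrow> real"
  assumes "compact L" "continuous_on L f"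
  shows "of_order L 0 (\<lambda>k. f)"
proof -
  have "bounded (f ` L)" using assms by (intro compact_imp_bounded compact_continuous_image)
  then obtain C where "\<And>x. x \<in> L \<Longrightarrow> \<bar>f x\<bar> \<le> C" by (auto simp: bounded_iff)
  then show ?thesis by (rule of_order_bounded)
qed

text \<open>Replacing both factors of a product by their leading parts: \<open>F F' - F\<^sub>0 F'\<^sub>0 = (F - F\<^sub>0) F' + F\<^sub>0 (F' - F'\<^sub>0)\<close>.\<close>

lemma of_order_mult_diff:
  assumes "of_order L (a + b) (\<lambda>k x. F k x - F0 k x)" "of_order L c F'" "of_order L c' F0"
    "of_order L (a' + b') (\<lambda>k x. F' k x - F0' k x)"
    and "a + b + c \<le> m" "c' + (a' + b') \<le> m"
  shows "of_order L m (\<lambda>k x. F k x * F' k x - F0 k x * F0' k x)"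
proof -
  have "of_order L m (\<lambda>k x. (F k x - F0 k x) * F' k x + F0 k x * (F' k x - F0' k x))"
    by (intro of_order_add of_order_mono[OF of_order_mult[OF assms(1,2)] assms(5)]
        of_order_mono[OF of_order_mult[OF assms(3,4)] assms(6)])
  then show ?thesis by (simp add: algebra_simps)
qed

definition kd :: "'i \<Rightarrow> 'i \<Rightarrow> real" where
  "kd i j = (if i = j then 1 else 0)"

lemma kd_same [simp]: "kd i i = 1"
  by (simp add: kd_def)

lemma kd_sym: "kd i j = kd j i"
  by (auto simp: kd_def)

lemma sum_kd [simp]:
  fixes f :: "'i::finite \<Rightarrow> real"
  shows "(\<Sum>i\<in>UNIV. kd i a * f i) = f a" "(\<Sum>i\<in>UNIV. kd a i * f i) = f a"
    "(\<Sum>i\<in>UNIV. f i * kd i a) = f a" "(\<Sum>i\<in>UNIV. f i * kd a i) = f a"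
  by (simp_all add: kd_def if_distrib[of "\<lambda>x. x * _"] if_distrib[of "\<lambda>x. _ * x"] cong: if_cong)

text \<open>The conformal factor \<open>e\<^bsup>2w\<^esup>\<close> oscillates in the coordinate direction \<open>e\<close> with frequency \<open>k\<close> and
  amplitude \<open>eta\<close>. Orders of magnitude in \<open>k\<close> are measured on the compact set \<open>L\<close>, where all functions
  of the background metric are bounded.\<close>

locale oscillation = coordinate_metric S G
  for S :: "(real^'n::finite) set" and G +
  fixes L :: "(real^'n) set" and eta :: "real^'n \<Rightarrow> real" and e :: 'n
  assumes compact_L: "compact L" and L_S: "L \<subseteq> S" and smooth_eta: "smooth_on S eta"
begin

definition w :: "nat \<Rightarrow> real^'n \<Rightarrow> real" where
  "w k x = eta x * sin (real k * x $ e)"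

definition Gk :: "nat \<Rightarrow> real^'n \<Rightarrow> real^'n^'n" where
  "Gk k x = exp (2 * w k x) *\<^sub>R G x"

text \<open>The leading parts of the first and second derivative of \<open>w\<close> in the direction of
  oscillation; all other derivatives have lower order in \<open>k\<close>.\<close>

definition p :: "nat \<Rightarrow> real^'n \<Rightarrow> real" where
  "p k x = real k * (eta x * cos (real k * x $ e))"

definition q :: "nat \<Rightarrow> real^'n \<Rightarrow> real" where
  "q k x = - (real k)\<^sup>2 * (eta x * sin (real k * x $ e))"

definition I :: "'n \<Rightarrow> 'n \<Rightarrow> real^'n \<Rightarrow> real" where
  "I i j x = matrix_inv (G x) $ i $ j"

text \<open>The remainders of the first and second derivatives of \<open>w\<close> after the leading parts are removed.\<close>

definition b :: "'n \<Rightarrow> nat \<Rightarrow> real^'n \<Rightarrow> real" where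
  "b i k x = pderivative i eta x * sin (real k * x $ e)"

definition r :: "'n \<Rightarrow> 'n \<Rightarrow> nat \<Rightarrow> real^'n \<Rightarrow> real" where
  "r a i k x = real k * (cos (real k * x $ e) * (pderivative a eta x * kd i e + pderivative i eta x * kd a e))
     + sin (real k * x $ e) * pderivative a (pderivative i eta) x"

text \<open>The coefficient of \<open>p\<close> in the Christoffel symbols of the rescaled metric: the conformal change
  \<open>\<delta>\<^sup>c\<^sub>j w\<^sub>i + \<delta>\<^sup>c\<^sub>i w\<^sub>j - g\<^sub>i\<^sub>j w\<^sup>c\<close> evaluated for \<open>dw = dx\<^sub>e\<close>.\<close>

definition E :: "'n \<Rightarrow> 'n \<Rightarrow> 'n \<Rightarrow> real^'n \<Rightarrow> real" where
  "E c i j x = kd c j * kd i e + kd c i * kd j e - G x $ i $ j * I c e x"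

lemma I_G: "x \<in> S \<Longrightarrow> (\<Sum>l\<in>UNIV. I c l x * G x $ l $ j) = kd c j"
  using arg_cong[OF inv_G(2), of x "\<lambda>M. M $ c $ j"]
  by (simp add: matrix_mult_entry I_def mat_entry kd_def)

lemma G_I: "x \<in> S \<Longrightarrow> (\<Sum>l\<in>UNIV. G x $ c $ l * I l j x) = kd c j"
  using arg_cong[OF inv_G(1), of x "\<lambda>M. M $ c $ j"]
  by (simp add: matrix_mult_entry I_def mat_entry kd_def)

lemma smooth_phase: "smooth_on S (\<lambda>x. real k * x $ e)"
  by (intro smooth_on_mult smooth_on_const smooth_on_component open_S)

lemma smooth_w: "smooth_on S (w k)"
  unfolding w_def[abs_def]
  by (intro smooth_on_mult smooth_eta smooth_on_sin_cos smooth_phase open_S)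

lemma smooth_I: "smooth_on S (I i j)"
  unfolding I_def[abs_def] by (rule smooth_inv)

lemma pderivative_phase: "x \<in> S \<Longrightarrow> pderivative i (\<lambda>x. real k * x $ e) x = real k * kd i e"
  by (subst pderivative_mult)
     (auto simp: pderivative_component kd_def intro: smooth_on_imp_differentiable[OF smooth_on_component[OF open_S]])

lemma pderivative_sin_phase:
  "x \<in> S \<Longrightarrow> pderivative i (\<lambda>x. sin (real k * x $ e)) x = cos (real k * x $ e) * (real k * kd i e)"
  by (subst pderivative_compose_real[OF smooth_on_imp_differentiable[OF smooth_phase] DERIV_sin])
     (auto simp: pderivative_phase)

lemma pderivative_cos_phase:
  "x \<in> S \<Longrightarrow> pderivative i (\<lambda>x. cos (real k * x $ e)) x = - sin (real k * x $ e) * (real k * kd i e)"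
  by (subst pderivative_compose_real[OF smooth_on_imp_differentiable[OF smooth_phase] DERIV_cos])
     (auto simp: pderivative_phase)

lemma diff_simps:
  assumes "x \<in> S"
  shows "eta differentiable at x" "pderivative i eta differentiable at x"
    "(\<lambda>x. sin (real k * x $ e)) differentiable at x" "(\<lambda>x. cos (real k * x $ e)) differentiable at x"
    "w k differentiable at x" "pderivative i (w k) differentiable at x"
    "(\<lambda>y. G y $ i $ j) differentiable at x" "I i j differentiable at x"
    "christoffel G c i j differentiable at x"
  using assms open_S
  by (auto intro!: smooth_on_imp_differentiable[of S] smooth_on_pderivative smooth_eta smooth_on_sin_cos
      smooth_phase smooth_w smooth_G_entry smooth_I smooth_christoffel)

lemma pderivative_w: "x \<in> S \<Longrightarrow> pderivative i (w k) x = p k x * kd i e + b i k x"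
  unfolding w_def[abs_def]
  by (simp add: pderivative_mult diff_simps pderivative_sin_phase p_def b_def algebra_simps)

lemma pderivative2_w:
  assumes x: "x \<in> S"
  shows "pderivative a (pderivative i (w k)) x = q k x * (kd i e * kd a e) + r a i k x"
proof -
  have "pderivative a (pderivative i (w k)) x = pderivative a (\<lambda>x. eta x * cos (real k * x $ e) * (real k * kd i e)
      + pderivative i eta x * sin (real k * x $ e)) x"
    by (rule pderivative_eq_on[OF open_S x _ smooth_on_pderivative[OF smooth_w]])
       (simp add: pderivative_w p_def b_def algebra_simps)
  also have "\<dots> = q k x * (kd i e * kd a e) + r a i k x"
    using x by (simp add: pderivative_add pderivative_mult diff_simps differentiable_mult
        pderivative_sin_phase pderivative_cos_phase q_def r_def algebra_simps power2_eq_square)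
  finally show ?thesis .
qed

lemma Gk_metric: "coordinate_metric S (Gk k)"
proof
  show "open S" by (rule open_S)
  show "smooth_on S (Gk k)"
    unfolding Gk_def[abs_def]
    by (intro smooth_on_scaleR smooth_on_exp smooth_on_mult smooth_on_const smooth_w smooth_G open_S)
  show "transpose (Gk k x) = Gk k x" if "x \<in> S" for x
    using sym_G_entry[OF that] by (simp add: Gk_def vec_eq_iff)
  show "v \<bullet> (Gk k x *v v) > 0" if "x \<in> S" "v \<noteq> 0" for x v
    using pos_G[OF that] by (simp add: Gk_def scaleR_matrix_vector_assoc[symmetric])
qed

lemma inv_Gk:
  assumes "x \<in> S"
  shows "matrix_inv (Gk k x) $ i $ j = exp (- 2 * w k x) * I i j x"
proof -
  interpret K: coordinate_metric S "Gk k" by (rule Gk_metric)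
  define M where "M = exp (- 2 * w k x) *\<^sub>R matrix_inv (G x)"
  have "Gk k x ** M = (exp (2 * w k x) * exp (- 2 * w k x)) *\<^sub>R (G x ** matrix_inv (G x))"
    by (simp add: Gk_def M_def matrix_scalar_ac mult.commute flip: scalar_matrix_assoc)
  also have "\<dots> = mat 1" using inv_G(1)[OF assms] by (simp flip: exp_add)
  finally have "Gk k x ** M = mat 1" .
  then have "M = matrix_inv (Gk k x)"
    by (metis K.inv_G(2)[OF assms] matrix_mul_assoc matrix_mul_lid matrix_mul_rid)
  then show ?thesis unfolding I_def by (metis M_def real_scaleR_def vector_scaleR_component)
qed

lemma christoffel_Gk:
  assumes x: "x \<in> S"
  shows "christoffel (Gk k) c i j x = christoffel G c i j x + kd c j * pderivative i (w k) x
    + kd c i * pderivative j (w k) x - G x $ i $ j * (\<Sum>l\<in>UNIV. I c l x * pderivative l (w k) x)"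
proof -
  have d: "pderivative a (\<lambda>y. Gk k y $ i $ j) x =
      exp (2 * w k x) * (2 * pderivative a (w k) x * G x $ i $ j + pderivative a (\<lambda>y. G y $ i $ j) x)" for a i j
  proof -
    have d2: "(\<lambda>y. 2 * w k y) differentiable at x"
      using diff_simps(5)[OF x] by (intro differentiable_mult) auto
    have "pderivative a (\<lambda>y. exp (2 * w k y)) x = exp (2 * w k x) * (2 * pderivative a (w k) x)"
      using diff_simps(5)[OF x] pderivative_compose_real[OF d2 DERIV_exp] by (simp add: pderivative_mult)
    moreover have "(\<lambda>y. exp (2 * w k y)) differentiable at x"
      by (rule differentiable_compose_real[OF d2 DERIV_exp])
    ultimately show ?thesis
      using x by (simp add: Gk_def pderivative_mult diff_simps algebra_simps)
  qed
  have "christoffel (Gk k) c i j x = (\<Sum>l\<in>UNIV. I c l x *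
      ((pderivative i (\<lambda>y. G y $ j $ l) x + pderivative j (\<lambda>y. G y $ i $ l) x - pderivative l (\<lambda>y. G y $ i $ j) x)
        + 2 * (pderivative i (w k) x * G x $ j $ l + pderivative j (w k) x * G x $ i $ l - pderivative l (w k) x * G x $ i $ j))) / 2"
    unfolding christoffel_def inv_Gk[OF x] d
    by (intro arg_cong[where f = "\<lambda>t. t / 2"] sum.cong refl) (simp add: algebra_simps flip: exp_add)
  also have "\<dots> = christoffel G c i j x + (\<Sum>l\<in>UNIV. I c l x *
      (pderivative i (w k) x * G x $ j $ l + pderivative j (w k) x * G x $ i $ l - pderivative l (w k) x * G x $ i $ j))"
  proof -
    have "(\<Sum>l\<in>UNIV. f l * (A l + 2 * B l)) / 2 = (\<Sum>l\<in>UNIV. f l * A l) / 2 + (\<Sum>l\<in>UNIV. f l * B l)"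
      for f A B :: "'n \<Rightarrow> real"
    proof -
      have "f l * (A l + 2 * B l) = f l * A l + 2 * (f l * B l)" for l by (simp add: algebra_simps)
      then show ?thesis by (simp add: sum.distrib flip: sum_distrib_left)
    qed
    then show ?thesis unfolding christoffel_def I_def .
  qed
  also have "(\<Sum>l\<in>UNIV. I c l x *
      (pderivative i (w k) x * G x $ j $ l + pderivative j (w k) x * G x $ i $ l - pderivative l (w k) x * G x $ i $ j))
     = pderivative i (w k) x * (\<Sum>l\<in>UNIV. I c l x * G x $ l $ j) + pderivative j (w k) x * (\<Sum>l\<in>UNIV. I c l x * G x $ l $ i)
       - G x $ i $ j * (\<Sum>l\<in>UNIV. I c l x * pderivative l (w k) x)"
  proof -
    have "I c l x * (pderivative i (w k) x * G x $ j $ l + pderivative j (w k) x * G x $ i $ l - pderivative l (w k) x * G x $ i $ j)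
      = pderivative i (w k) x * (I c l x * G x $ l $ j) + pderivative j (w k) x * (I c l x * G x $ l $ i)
        - G x $ i $ j * (I c l x * pderivative l (w k) x)" for l
      by (simp add: sym_G_entry[OF x, of j l] sym_G_entry[OF x, of i l] algebra_simps)
    then show ?thesis by (simp only: sum.distrib sum_subtractf sum_distrib_left[symmetric])
  qed
  finally show ?thesis by (simp add: I_G[OF x] mult.commute)
qed

lemma pderivative_christoffel_Gk:
  assumes x: "x \<in> S"
  shows "pderivative a (christoffel (Gk k) c i j) x = pderivative a (christoffel G c i j) x
    + kd c j * pderivative a (pderivative i (w k)) x + kd c i * pderivative a (pderivative j (w k)) x
    - G x $ i $ j * (\<Sum>l\<in>UNIV. I c l x * pderivative a (pderivative l (w k)) x + pderivative a (I c l) x * pderivative l (w k) x)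
    - pderivative a (\<lambda>y. G y $ i $ j) x * (\<Sum>l\<in>UNIV. I c l x * pderivative l (w k) x)"
proof -
  interpret K: coordinate_metric S "Gk k" by (rule Gk_metric)
  have "pderivative a (christoffel (Gk k) c i j) x = pderivative a (\<lambda>x. christoffel G c i j x + kd c j * pderivative i (w k) x
    + kd c i * pderivative j (w k) x - G x $ i $ j * (\<Sum>l\<in>UNIV. I c l x * pderivative l (w k) x)) x"
    by (rule pderivative_eq_on[OF open_S x christoffel_Gk K.smooth_christoffel])
  also have "\<dots> = pderivative a (christoffel G c i j) x
    + kd c j * pderivative a (pderivative i (w k)) x + kd c i * pderivative a (pderivative j (w k)) x
    - G x $ i $ j * (\<Sum>l\<in>UNIV. I c l x * pderivative a (pderivative l (w k)) x + pderivative a (I c l) x * pderivative l (w k) x)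
    - pderivative a (\<lambda>y. G y $ i $ j) x * (\<Sum>l\<in>UNIV. I c l x * pderivative l (w k) x)"
    by (simp add: pderivative_add pderivative_diff pderivative_mult pderivative_sum diff_simps[OF x]
        differentiable_mult differentiable_add differentiable_sum)
  finally show ?thesis .
qed

subsection \<open>Orders of magnitude\<close>

lemma order_smooth: "smooth_on S f \<Longrightarrow> of_order L 0 (\<lambda>k. f)"
  using of_order_continuous[OF compact_L] smooth_on_imp_continuous_on continuous_on_subset L_S by blast

lemma order_trig: "of_order L 0 (\<lambda>k x. sin (real k * x $ e))" "of_order L 0 (\<lambda>k x. cos (real k * x $ e))"
  by (rule of_order_bounded[of _ _ 1], simp)+

lemma order_k: "of_order L 1 (\<lambda>k x. real k)"
  unfolding of_order_def by (intro exI[of _ 1]) auto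

lemma order_k2: "of_order L 2 (\<lambda>k x. (real k)\<^sup>2)"
  unfolding of_order_def by (intro exI[of _ 1]) auto

lemma order_p: "of_order L 1 p"
  using of_order_mult[OF order_k of_order_mult_bounded[OF order_smooth[OF smooth_eta] order_trig(2)]]
  by (simp add: p_def[abs_def])

lemma order_q: "of_order L 2 q"
  using of_order_minus[OF of_order_mult[OF order_k2 of_order_mult_bounded[OF order_smooth[OF smooth_eta] order_trig(1)]]]
  by (simp add: q_def[abs_def])

lemma order_b: "of_order L 0 (b i)"
  using of_order_mult_bounded[OF order_smooth[OF smooth_on_pderivative[OF smooth_eta]] order_trig(1)]
  by (simp add: b_def[abs_def])

lemma order_deriv_eta: "of_order L 0 (\<lambda>k. pderivative i eta)"
   "of_order L 0 (\<lambda>k. pderivative a (pderivative i eta))"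
  by (intro order_smooth smooth_on_pderivative smooth_eta)+

lemma order_r: "of_order L 1 (r a i)"
proof -
  have 1: "of_order L (1 + 0) (\<lambda>k x. real k * (cos (real k * x $ e) * (pderivative a eta x * kd i e + pderivative i eta x * kd a e)))"
    by (intro of_order_mult[OF order_k] of_order_mult_bounded order_trig of_order_add order_deriv_eta of_order_const)
  have 2: "of_order L 1 (\<lambda>k x. sin (real k * x $ e) * pderivative a (pderivative i eta) x)"
    by (rule of_order_mono[of _ 0]) (intro of_order_mult_bounded order_trig order_deriv_eta, simp)
  show ?thesis
    unfolding r_def[abs_def] by (rule of_order_add[OF of_order_mono[OF 1] 2]) simp
qed

lemma order_G: "of_order L 0 (\<lambda>k x. G x $ i $ j)"
  by (rule order_smooth[OF smooth_G_entry])

lemma order_I: "of_order L 0 (\<lambda>k. I i j)"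
  by (rule order_smooth[OF smooth_I])

lemma order_E: "of_order L 0 (\<lambda>k. E c i j)"
  unfolding E_def[abs_def]
  by (intro of_order_diff of_order_add of_order_const of_order_mult_bounded order_G order_I)

lemma order_pderivative_w: "of_order L 1 (\<lambda>k. pderivative i (w k))"
proof -
  have "of_order L 1 (\<lambda>k x. p k x * kd i e + b i k x)"
    using of_order_cmult[OF order_p, of "kd i e"] of_order_mono[OF order_b, of 1]
    by (intro of_order_add) (auto simp: mult.commute)
  then show ?thesis
    by (subst of_order_cong[of L _ "\<lambda>k x. p k x * kd i e + b i k x"]) (use L_S pderivative_w in auto)
qed

lemma order_christoffel: "of_order L 0 (\<lambda>k x. christoffel (Gk k) c i j x - p k x * E c i j x)"
proof -
  have "of_order L 0 (\<lambda>k x. christoffel G c i j x + kd c j * b i k x + kd c i * b j k x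
     - G x $ i $ j * (\<Sum>l\<in>UNIV. I c l x * b l k x))"
    by (intro of_order_add of_order_diff of_order_cmult of_order_mult_bounded of_order_sum
        order_b order_G order_I order_smooth[OF smooth_christoffel])
  moreover have "christoffel (Gk k) c i j x - p k x * E c i j x = christoffel G c i j x + kd c j * b i k x + kd c i * b j k x
     - G x $ i $ j * (\<Sum>l\<in>UNIV. I c l x * b l k x)" if "x \<in> L" for k x
  proof -
    have x: "x \<in> S" using that L_S by blast
    have "(\<Sum>l\<in>UNIV. I c l x * (p k x * kd l e + b l k x)) = p k x * (\<Sum>l\<in>UNIV. I c l x * kd l e) + (\<Sum>l\<in>UNIV. I c l x * b l k x)"
      unfolding sum_distrib_left by (simp add: distrib_left sum.distrib mult_ac)
    then show ?thesis
      unfolding christoffel_Gk[OF x] pderivative_w[OF x] E_def by (simp add: algebra_simps)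
  qed
  ultimately show ?thesis
    by (subst of_order_cong) auto
qed

lemma order_pderivative_christoffel:
  "of_order L 1 (\<lambda>k x. pderivative a (christoffel (Gk k) c i j) x - q k x * (kd a e * E c i j x))"
proof -
  have "of_order L 1 (\<lambda>k x. pderivative a (christoffel G c i j) x + kd c j * r a i k x + kd c i * r a j k x
     - G x $ i $ j * (\<Sum>l\<in>UNIV. I c l x * r a l k x + pderivative a (I c l) x * pderivative l (w k) x)
     - pderivative a (\<lambda>y. G y $ i $ j) x * (\<Sum>l\<in>UNIV. I c l x * pderivative l (w k) x))"
    by (intro of_order_add of_order_diff of_order_cmult of_order_mult_bounded of_order_sum
        order_r order_G order_I order_pderivative_w
        of_order_mono[OF order_smooth[OF smooth_on_pderivative[OF smooth_christoffel]]]
        order_smooth[OF smooth_on_pderivative[OF smooth_G_entry]]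
        order_smooth[OF smooth_on_pderivative[OF smooth_I]]) simp
  moreover have "pderivative a (christoffel (Gk k) c i j) x - q k x * (kd a e * E c i j x) =
     pderivative a (christoffel G c i j) x + kd c j * r a i k x + kd c i * r a j k x
     - G x $ i $ j * (\<Sum>l\<in>UNIV. I c l x * r a l k x + pderivative a (I c l) x * pderivative l (w k) x)
     - pderivative a (\<lambda>y. G y $ i $ j) x * (\<Sum>l\<in>UNIV. I c l x * pderivative l (w k) x)" if "x \<in> L" for k x
  proof -
    have x: "x \<in> S" using that L_S by blast
    have "(\<Sum>l\<in>UNIV. I c l x * (q k x * (kd l e * kd a e) + r a l k x) + pderivative a (I c l) x * pderivative l (w k) x)
       = q k x * kd a e * (\<Sum>l\<in>UNIV. I c l x * kd l e) + (\<Sum>l\<in>UNIV. I c l x * r a l k x + pderivative a (I c l) x * pderivative l (w k) x)"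
      unfolding sum_distrib_left by (simp add: distrib_left sum.distrib mult_ac)
    then show ?thesis
      unfolding pderivative_christoffel_Gk[OF x] pderivative2_w[OF x] E_def by (simp add: algebra_simps)
  qed
  ultimately show ?thesis
    by (subst of_order_cong) auto
qed

lemma order_christoffel_1: "of_order L 1 (\<lambda>k. christoffel (Gk k) c i j)"
proof -
  have "of_order L 1 (\<lambda>k x. (christoffel (Gk k) c i j x - p k x * E c i j x) + E c i j x * p k x)"
    by (intro of_order_add of_order_mono[OF order_christoffel] of_order_mult_bounded order_E order_p) simp
  then show ?thesis by (simp add: mult.commute)
qed

lemma order_christoffel_mult:
  "of_order L 1 (\<lambda>k x. christoffel (Gk k) c i j x * christoffel (Gk k) c' i' j' x
      - (p k x)\<^sup>2 * (E c i j x * E c' i' j' x))"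
proof -
  have "of_order L 1 (\<lambda>k x. p k x * E c i j x)"
    using of_order_mult_bounded[OF order_E order_p] by (simp add: mult.commute)
  then have "of_order L 1 (\<lambda>k x. christoffel (Gk k) c i j x * christoffel (Gk k) c' i' j' x
      - (p k x * E c i j x) * (p k x * E c' i' j' x))"
    using order_christoffel order_christoffel_1
    by (intro of_order_mult_diff[where a = 0 and b = 0 and a' = 0 and b' = 0 and c = 1 and c' = 1]) auto
  then show ?thesis by (simp add: power2_eq_square mult_ac)
qed

subsection \<open>Leading terms\<close>

lemma E_contract: "x \<in> S \<Longrightarrow> (\<Sum>i\<in>UNIV. E i i k x) = real CARD('n) * kd k e"
  by (simp add: E_def sum.distrib sum_subtractf sym_G_entry[of x _ k] G_I)

lemma G_E:
  assumes x: "x \<in> S"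
  shows "(\<Sum>m\<in>UNIV. G x $ j $ m * E m i k x) = G x $ j $ k * kd i e + G x $ j $ i * kd k e - G x $ i $ k * kd j e"
proof -
  have "(\<Sum>m\<in>UNIV. G x $ j $ m * E m i k x) = (\<Sum>m\<in>UNIV. G x $ j $ m * kd m k) * kd i e
     + (\<Sum>m\<in>UNIV. G x $ j $ m * kd m i) * kd k e - G x $ i $ k * (\<Sum>m\<in>UNIV. G x $ j $ m * I m e x)"
    unfolding sum_distrib_left sum_distrib_right E_def
    by (simp add: algebra_simps sum.distrib sum_subtractf)
  then show ?thesis by (simp add: G_I[OF x])
qed

lemma E_E:
  assumes x: "x \<in> S"
  shows "(\<Sum>i\<in>UNIV. \<Sum>m\<in>UNIV. E i j m x * E m i k x) =
    (real CARD('n) + 2) * (kd j e * kd k e) - 2 * (G x $ j $ k * I e e x)"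
proof -
  have inner: "(\<Sum>m\<in>UNIV. E i j m x * E m i k x) = kd j e * E i i k x + kd i j * E e i k x
      - I i e x * (G x $ j $ k * kd i e + G x $ j $ i * kd k e - G x $ i $ k * kd j e)" for i
  proof -
    have "(\<Sum>m\<in>UNIV. E i j m x * E m i k x) = kd j e * (\<Sum>m\<in>UNIV. kd i m * E m i k x)
       + kd i j * (\<Sum>m\<in>UNIV. kd m e * E m i k x) - I i e x * (\<Sum>m\<in>UNIV. G x $ j $ m * E m i k x)"
      unfolding sum_distrib_left E_def[of i j]
      by (simp add: algebra_simps sum.distrib sum_subtractf)
    then show ?thesis by (simp add: G_E[OF x])
  qed
  have "(\<Sum>i\<in>UNIV. I i e x * (G x $ j $ k * kd i e + G x $ j $ i * kd k e - G x $ i $ k * kd j e))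
     = G x $ j $ k * (\<Sum>i\<in>UNIV. I i e x * kd i e) + kd k e * (\<Sum>i\<in>UNIV. G x $ j $ i * I i e x)
       - kd j e * (\<Sum>i\<in>UNIV. G x $ k $ i * I i e x)"
  proof -
    have "I i e x * (G x $ j $ k * kd i e + G x $ j $ i * kd k e - G x $ i $ k * kd j e)
      = G x $ j $ k * (I i e x * kd i e) + kd k e * (G x $ j $ i * I i e x) - kd j e * (G x $ k $ i * I i e x)" for i
      by (simp add: sym_G_entry[OF x, of i k] algebra_simps)
    then show ?thesis
      by (simp only: sum.distrib sum_subtractf sum_distrib_left[symmetric])
  qed
  also have "\<dots> = G x $ j $ k * I e e x" by (simp only: G_I[OF x] sum_kd) (simp add: mult.commute)
  finally have 1: "(\<Sum>i\<in>UNIV. I i e x * (G x $ j $ k * kd i e + G x $ j $ i * kd k e - G x $ i $ k * kd j e))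
     = G x $ j $ k * I e e x" .
  have "(\<Sum>i\<in>UNIV. \<Sum>m\<in>UNIV. E i j m x * E m i k x) = kd j e * (\<Sum>i\<in>UNIV. E i i k x) + E e j k x - G x $ j $ k * I e e x"
    unfolding inner by (simp add: sum.distrib sum_subtractf 1 flip: sum_distrib_left)
  then show ?thesis
    by (simp add: E_contract[OF x]) (simp add: E_def kd_sym[of e] algebra_simps)
qed

text \<open>This is \<open>- (n - 2) (q - p\<^sup>2) dx\<^sub>e \<otimes> dx\<^sub>e - (q + (n - 2) p\<^sup>2) |dx\<^sub>e|\<^sup>2 g\<close>, the conformal change of the Ricci
  tensor for a function with differential \<open>p dx\<^sub>e\<close> and Hessian \<open>q dx\<^sub>e \<otimes> dx\<^sub>e\<close>.\<close>

definition ricci_lead :: "'n \<Rightarrow> 'n \<Rightarrow> nat \<Rightarrow> real^'n \<Rightarrow> real" where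
  "ricci_lead j l k x = - q k x * ((real CARD('n) - 2) * (kd j e * kd l e) + I e e x * G x $ j $ l)
     + (p k x)\<^sup>2 * ((real CARD('n) - 2) * (kd j e * kd l e - I e e x * G x $ j $ l))"

text \<open>In the definition of the curvature the derivatives of the Christoffel symbols contribute \<open>q E\<close> and
  the products contribute \<open>p\<^sup>2 E E\<close>, each up to order one.\<close>

lemma order_ricci: "of_order L 1 (\<lambda>k x. ricci (Gk k) x $ j $ l - ricci_lead j l k x)"
proof -
  let ?C = "\<lambda>k. christoffel (Gk k)"
  have "of_order L 1 (\<lambda>k x. \<Sum>i\<in>UNIV.
      (pderivative i (?C k i j l) x - q k x * (kd i e * E i j l x))
    - (pderivative j (?C k i i l) x - q k x * (kd j e * E i i l x))
    + (\<Sum>m\<in>UNIV. (?C k i i m x * ?C k m j l x - (p k x)\<^sup>2 * (E i i m x * E m j l x))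
        - (?C k i j m x * ?C k m i l x - (p k x)\<^sup>2 * (E i j m x * E m i l x))))"
    by (intro of_order_sum of_order_add of_order_diff order_pderivative_christoffel order_christoffel_mult)
  moreover have "ricci (Gk k) x $ j $ l - ricci_lead j l k x = (\<Sum>i\<in>UNIV.
      (pderivative i (?C k i j l) x - q k x * (kd i e * E i j l x))
    - (pderivative j (?C k i i l) x - q k x * (kd j e * E i i l x))
    + (\<Sum>m\<in>UNIV. (?C k i i m x * ?C k m j l x - (p k x)\<^sup>2 * (E i i m x * E m j l x))
        - (?C k i j m x * ?C k m i l x - (p k x)\<^sup>2 * (E i j m x * E m i l x))))" if "x \<in> L" for k x
  proof -
    have x: "x \<in> S" using that L_S by blast
    have "(\<Sum>i\<in>UNIV. \<Sum>m\<in>UNIV. E i i m x * E m j l x) = (\<Sum>m\<in>UNIV. (\<Sum>i\<in>UNIV. E i i m x) * E m j l x)"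
      unfolding sum_distrib_right by (rule sum.swap)
    also have "\<dots> = real CARD('n) * E e j l x"
      by (simp add: E_contract[OF x] mult.assoc flip: sum_distrib_left)
    finally have 1: "(\<Sum>i\<in>UNIV. \<Sum>m\<in>UNIV. E i i m x * E m j l x) = real CARD('n) * E e j l x" .
    have "ricci_lead j l k x = (\<Sum>i\<in>UNIV. q k x * (kd i e * E i j l x)) - (\<Sum>i\<in>UNIV. q k x * (kd j e * E i i l x))
      + (p k x)\<^sup>2 * (\<Sum>i\<in>UNIV. \<Sum>m\<in>UNIV. E i i m x * E m j l x)
      - (p k x)\<^sup>2 * (\<Sum>i\<in>UNIV. \<Sum>m\<in>UNIV. E i j m x * E m i l x)"
      unfolding E_E[OF x] 1 sum_distrib_left[symmetric] E_contract[OF x] sum_kd(1)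
      by (simp add: ricci_lead_def E_def kd_sym[of e] algebra_simps)
    then show ?thesis
      by (simp add: ricci_def riemann_def sum.distrib sum_subtractf sum_distrib_left algebra_simps)
  qed
  ultimately show ?thesis by (subst of_order_cong) auto
qed

text \<open>Subtracting the trace part of \<open>ricci_lead\<close> removes the term \<open>q g\<close>, so that only \<open>dx\<^sub>e \<otimes> dx\<^sub>e\<close> carries
  second derivatives of \<open>w\<close>.\<close>

definition schouten_lead :: "'n \<Rightarrow> 'n \<Rightarrow> nat \<Rightarrow> real^'n \<Rightarrow> real" where
  "schouten_lead i j k x = ((p k x)\<^sup>2 - q k x) * (kd i e * kd j e) - (p k x)\<^sup>2 / 2 * I e e x * G x $ i $ j"

lemma trace_ricci_lead:
  assumes x: "x \<in> S"
  shows "(\<Sum>i\<in>UNIV. \<Sum>j\<in>UNIV. I i j x * ricci_lead i j k x) =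
    - (2 * real CARD('n) - 2) * q k x * I e e x
    - (real CARD('n) - 2) * (real CARD('n) - 1) * (p k x)\<^sup>2 * I e e x"
proof -
  have "(\<Sum>j\<in>UNIV. I i j x * ricci_lead i j k x) =
     (real CARD('n) - 2) * ((p k x)\<^sup>2 - q k x) * (kd i e * I i e x)
     - ((real CARD('n) - 2) * (p k x)\<^sup>2 + q k x) * I e e x" for i
  proof -
    have "I i j x * ricci_lead i j k x =
      (real CARD('n) - 2) * ((p k x)\<^sup>2 - q k x) * (kd i e * (I i j x * kd j e))
      - ((real CARD('n) - 2) * (p k x)\<^sup>2 + q k x) * I e e x * (I i j x * G x $ j $ i)" for j
      by (simp add: ricci_lead_def sym_G_entry[OF x, of i j] algebra_simps)
    then have "(\<Sum>j\<in>UNIV. I i j x * ricci_lead i j k x) =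
      (real CARD('n) - 2) * ((p k x)\<^sup>2 - q k x) * (kd i e * (\<Sum>j\<in>UNIV. I i j x * kd j e))
      - ((real CARD('n) - 2) * (p k x)\<^sup>2 + q k x) * I e e x * (\<Sum>j\<in>UNIV. I i j x * G x $ j $ i)"
      by (simp only: sum_subtractf sum_distrib_left[symmetric])
    then show ?thesis by (simp only: I_G[OF x] sum_kd kd_same mult_1_right)
  qed
  then have "(\<Sum>i\<in>UNIV. \<Sum>j\<in>UNIV. I i j x * ricci_lead i j k x) =
     (real CARD('n) - 2) * ((p k x)\<^sup>2 - q k x) * I e e x
     - real CARD('n) * (((real CARD('n) - 2) * (p k x)\<^sup>2 + q k x) * I e e x)"
    by (simp add: sum_subtractf flip: sum_distrib_left)
  then show ?thesis by (simp add: algebra_simps)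
qed

lemma schouten_Gk:
  assumes x: "x \<in> S"
  shows "schouten (Gk k) x $ i $ j = (1 / (real CARD('n) - 2)) * (ricci (Gk k) x $ i $ j
     - (\<Sum>i\<in>UNIV. \<Sum>j\<in>UNIV. I i j x * ricci (Gk k) x $ i $ j) * (G x $ i $ j * (1 / (2 * (real CARD('n) - 1)))))"
proof -
  have "scalar_curvature (Gk k) x = exp (- 2 * w k x) * (\<Sum>i\<in>UNIV. \<Sum>j\<in>UNIV. I i j x * ricci (Gk k) x $ i $ j)"
    unfolding scalar_curvature_def inv_Gk[OF x] sum_distrib_left by (simp add: mult.assoc)
  then have "scalar_curvature (Gk k) x * exp (2 * w k x) = (\<Sum>i\<in>UNIV. \<Sum>j\<in>UNIV. I i j x * ricci (Gk k) x $ i $ j)"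
    by (simp add: mult_ac flip: exp_add)
  then show ?thesis
    by (simp add: schouten_def Gk_def)
qed

lemma order_schouten:
  assumes n: "CARD('n) \<ge> 3"
  shows "of_order L 1 (\<lambda>k x. schouten (Gk k) x $ i $ j - schouten_lead i j k x)"
proof -
  define c where "c = real CARD('n)"
  have c: "c \<ge> 3" using n by (simp add: c_def)
  have "of_order L 1 (\<lambda>k x. (1 / (c - 2)) * ((ricci (Gk k) x $ i $ j - ricci_lead i j k x)
     - (G x $ i $ j * (1 / (2 * (c - 1)))) * (\<Sum>i\<in>UNIV. \<Sum>j\<in>UNIV. I i j x * (ricci (Gk k) x $ i $ j - ricci_lead i j k x))))"
    by (intro of_order_cmult of_order_diff of_order_mult_bounded of_order_sum order_ricci order_I order_G of_order_const)
  moreover have "schouten (Gk k) x $ i $ j - schouten_lead i j k x = (1 / (c - 2)) * ((ricci (Gk k) x $ i $ j - ricci_lead i j k x)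
     - (G x $ i $ j * (1 / (2 * (c - 1)))) * (\<Sum>i\<in>UNIV. \<Sum>j\<in>UNIV. I i j x * (ricci (Gk k) x $ i $ j - ricci_lead i j k x)))"
    if "x \<in> L" for k x
  proof -
    have x: "x \<in> S" using that L_S by blast
    define t where "t = (\<Sum>i\<in>UNIV. \<Sum>j\<in>UNIV. I i j x * ricci_lead i j k x)"
    have t: "t = - (2 * c - 2) * q k x * I e e x - (c - 2) * (c - 1) * (p k x)\<^sup>2 * I e e x"
      unfolding t_def c_def by (rule trace_ricci_lead[OF x])
    have R: "ricci_lead i j k x = - q k x * ((c - 2) * (kd i e * kd j e) + I e e x * G x $ i $ j)
       + (p k x)\<^sup>2 * ((c - 2) * (kd i e * kd j e - I e e x * G x $ i $ j))"
      by (simp add: ricci_lead_def c_def)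
    have "schouten_lead i j k x * (c - 2) = ricci_lead i j k x - t * (1 / (2 * (c - 1))) * G x $ i $ j"
    proof -
      have u: "t * (1 / (2 * (c - 1))) = - q k x * I e e x - (c - 2) / 2 * (p k x)\<^sup>2 * I e e x"
        unfolding t using c by (simp add: field_simps)
      show ?thesis unfolding u schouten_lead_def R by (simp add: field_simps)
    qed
    moreover have "schouten_lead i j k x = (1 / (c - 2)) * (schouten_lead i j k x * (c - 2))" using c by simp
    ultimately have schouten_lead: "schouten_lead i j k x = (1 / (c - 2)) * (ricci_lead i j k x - (G x $ i $ j * (1 / (2 * (c - 1)))) * t)"
      by (simp only: mult_ac)
    show ?thesis
      unfolding schouten_Gk[OF x] schouten_lead c_def[symmetric] t_def
      by (simp add: right_diff_distrib sum_subtractf mult_ac)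
  qed
  ultimately show ?thesis by (subst of_order_cong) auto
qed

definition mixed_lead :: "'n \<Rightarrow> 'n \<Rightarrow> nat \<Rightarrow> real^'n \<Rightarrow> real" where
  "mixed_lead i j k x = ((p k x)\<^sup>2 - q k x) * (I i e x * kd j e) - (p k x)\<^sup>2 / 2 * I e e x * kd i j"

text \<open>The Schouten tensor of the rescaled metric with one index raised by the background metric. Raising
  with the rescaled metric instead multiplies it by \<open>e\<^bsup>-2w\<^esup>\<close>, which accounts for the factor \<open>e\<^bsup>4w\<^esup>\<close>
  in the formula for \<open>\<sigma>\<^sub>2\<close>.\<close>

definition mixed :: "'n \<Rightarrow> 'n \<Rightarrow> nat \<Rightarrow> real^'n \<Rightarrow> real" where
  "mixed i j k x = (\<Sum>a\<in>UNIV. I i a x * schouten (Gk k) x $ a $ j)"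

lemma order_mixed_lead: "of_order L 2 (mixed_lead i j)"
proof -
  have "of_order L (1 + 1) (\<lambda>k x. p k x * p k x)" by (intro of_order_mult order_p)
  then have p2: "of_order L 2 (\<lambda>k x. (p k x)\<^sup>2)" by (simp add: power2_eq_square numeral_2_eq_2)
  have "of_order L 2 (\<lambda>k x. (I i e x * kd j e) * ((p k x)\<^sup>2 - q k x) - (1 / 2 * I e e x * kd i j) * (p k x)\<^sup>2)"
    by (intro of_order_diff of_order_mult_bounded of_order_const order_I order_q p2)
  then show ?thesis by (simp add: mixed_lead_def[abs_def] algebra_simps)
qed

lemma order_mixed_diff:
  assumes n: "CARD('n) \<ge> 3"
  shows "of_order L 1 (\<lambda>k x. mixed i j k x - mixed_lead i j k x)"
proof -
  have "of_order L 1 (\<lambda>k x. \<Sum>a\<in>UNIV. I i a x * (schouten (Gk k) x $ a $ j - schouten_lead a j k x))"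
    by (intro of_order_sum of_order_mult_bounded order_I order_schouten n)
  moreover have "mixed i j k x - mixed_lead i j k x = (\<Sum>a\<in>UNIV. I i a x * (schouten (Gk k) x $ a $ j - schouten_lead a j k x))"
    if "x \<in> L" for k x
  proof -
    have x: "x \<in> S" using that L_S by blast
    have "I i a x * schouten_lead a j k x = ((p k x)\<^sup>2 - q k x) * kd j e * (I i a x * kd a e)
        - (p k x)\<^sup>2 / 2 * I e e x * (I i a x * G x $ a $ j)" for a
      by (simp add: schouten_lead_def algebra_simps)
    then have "(\<Sum>a\<in>UNIV. I i a x * schouten_lead a j k x) = ((p k x)\<^sup>2 - q k x) * kd j e * (\<Sum>a\<in>UNIV. I i a x * kd a e)
        - (p k x)\<^sup>2 / 2 * I e e x * (\<Sum>a\<in>UNIV. I i a x * G x $ a $ j)"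
      by (simp only: sum_subtractf sum_distrib_left[symmetric])
    then have "(\<Sum>a\<in>UNIV. I i a x * schouten_lead a j k x) = mixed_lead i j k x"
      unfolding I_G[OF x] sum_kd by (simp add: mixed_lead_def mult_ac)
    then show ?thesis by (simp add: mixed_def right_diff_distrib sum_subtractf)
  qed
  ultimately show ?thesis by (subst of_order_cong) auto
qed

lemma order_mixed:
  assumes n: "CARD('n) \<ge> 3"
  shows "of_order L 2 (mixed i j)"
proof -
  have "of_order L 2 (\<lambda>k x. (mixed i j k x - mixed_lead i j k x) + mixed_lead i j k x)"
    by (intro of_order_add of_order_mono[OF order_mixed_diff[OF n]] order_mixed_lead) simp
  then show ?thesis by simp
qed

lemma local_sigma2_Gk:
  assumes x: "x \<in> S"
  shows "exp (4 * w k x) * local_sigma2 (Gk k) x =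
    ((\<Sum>i\<in>UNIV. mixed i i k x) * (\<Sum>i\<in>UNIV. mixed i i k x) - (\<Sum>i\<in>UNIV. \<Sum>j\<in>UNIV. mixed i j k x * mixed j i k x)) / 2"
proof -
  interpret K: coordinate_metric S "Gk k" by (rule Gk_metric)
  define B where "B = matrix_inv (Gk k x) ** schouten (Gk k) x"
  have B: "B $ i $ j = exp (- 2 * w k x) * mixed i j k x" for i j
    by (simp add: B_def matrix_mult_entry inv_Gk[OF x] mixed_def sum_distrib_left mult.assoc)
  have ex: "exp (- 2 * w k x) * exp (- 2 * w k x) = exp (- (4 * w k x))" by (simp flip: exp_add)
  have "trace B = exp (- 2 * w k x) * (\<Sum>i\<in>UNIV. mixed i i k x)"
    by (simp add: trace_def B sum_distrib_left)
  then have 1: "(trace B)\<^sup>2 = exp (- (4 * w k x)) * ((\<Sum>i\<in>UNIV. mixed i i k x) * (\<Sum>i\<in>UNIV. mixed i i k x))"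
    by (simp add: power2_eq_square ex[symmetric] mult_ac)
  have 2: "trace (B ** B) = exp (- (4 * w k x)) * (\<Sum>i\<in>UNIV. \<Sum>j\<in>UNIV. mixed i j k x * mixed j i k x)"
    unfolding trace_def matrix_mult_entry B ex[symmetric] sum_distrib_left by (simp add: mult_ac)
  have "local_sigma2 (Gk k) x = exp (- (4 * w k x)) * (((\<Sum>i\<in>UNIV. mixed i i k x) * (\<Sum>i\<in>UNIV. mixed i i k x)
     - (\<Sum>i\<in>UNIV. \<Sum>j\<in>UNIV. mixed i j k x * mixed j i k x)) / 2)"
    unfolding K.local_sigma2_trace[OF x] B_def[symmetric] 1 2 by (simp add: right_diff_distrib)
  then have "exp (4 * w k x) * local_sigma2 (Gk k) x = (exp (4 * w k x) * exp (- (4 * w k x))) *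
     (((\<Sum>i\<in>UNIV. mixed i i k x) * (\<Sum>i\<in>UNIV. mixed i i k x)
     - (\<Sum>i\<in>UNIV. \<Sum>j\<in>UNIV. mixed i j k x * mixed j i k x)) / 2)"
    by (simp only: mult.assoc)
  also have "exp (4 * w k x) * exp (- (4 * w k x)) = 1" by (simp flip: exp_add)
  finally show ?thesis by simp
qed

text \<open>The matrix \<open>mixed_lead\<close> is a rank one matrix with trace \<open>\<alpha> |dx\<^sub>e|\<^sup>2\<close> minus \<open>\<beta>\<close> times the identity.\<close>

lemma sigma2_mixed_lead:
  assumes x: "x \<in> S"
  shows "((\<Sum>i\<in>UNIV. mixed_lead i i k x) * (\<Sum>i\<in>UNIV. mixed_lead i i k x) - (\<Sum>i\<in>UNIV. \<Sum>j\<in>UNIV. mixed_lead i j k x * mixed_lead j i k x)) / 2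
   = (I e e x)\<^sup>2 * ((real CARD('n) - 1) / 2 * (p k x)\<^sup>2 * q k x
       + (real CARD('n) - 1) * (real CARD('n) - 4) / 8 * (p k x) ^ 4)"
proof -
  define c where "c = real CARD('n)"
  define \<alpha> where "\<alpha> = (p k x)\<^sup>2 - q k x"
  define \<beta> where "\<beta> = (p k x)\<^sup>2 / 2 * I e e x"
  have mixed_lead: "mixed_lead i j k x = \<alpha> * (I i e x * kd j e) - \<beta> * kd i j" for i j
    by (simp add: mixed_lead_def \<alpha>_def \<beta>_def)
  have 1: "(\<Sum>i\<in>UNIV. mixed_lead i i k x) = \<alpha> * I e e x - c * \<beta>"
    by (simp add: mixed_lead sum_subtractf c_def flip: sum_distrib_left)
  have "(\<Sum>j\<in>UNIV. mixed_lead i j k x * mixed_lead j i k x) = \<alpha>\<^sup>2 * I e e x * (I i e x * kd i e) - 2 * \<alpha> * \<beta> * (I i e x * kd i e) + \<beta>\<^sup>2" for i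
  proof -
    have "(\<Sum>j\<in>UNIV. mixed_lead i j k x * mixed_lead j i k x) = \<alpha> * I i e x * (\<Sum>j\<in>UNIV. kd j e * mixed_lead j i k x) - \<beta> * (\<Sum>j\<in>UNIV. kd i j * mixed_lead j i k x)"
    proof -
      have "mixed_lead i j k x * mixed_lead j i k x = \<alpha> * I i e x * (kd j e * mixed_lead j i k x) - \<beta> * (kd i j * mixed_lead j i k x)" for j
        by (simp add: mixed_lead[of i j] algebra_simps)
      then show ?thesis by (simp only: sum_subtractf sum_distrib_left[symmetric])
    qed
    also have "\<dots> = \<alpha> * I i e x * mixed_lead e i k x - \<beta> * mixed_lead i i k x" by (simp only: sum_kd)
    finally show ?thesis
      by (simp add: mixed_lead kd_sym[of e] power2_eq_square algebra_simps)
  qed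
  then have 2: "(\<Sum>i\<in>UNIV. \<Sum>j\<in>UNIV. mixed_lead i j k x * mixed_lead j i k x) = \<alpha>\<^sup>2 * (I e e x)\<^sup>2 - 2 * \<alpha> * \<beta> * I e e x + c * \<beta>\<^sup>2"
    by (simp add: sum.distrib sum_subtractf c_def power2_eq_square mult.assoc flip: sum_distrib_left)
  show ?thesis
    unfolding 1 2 c_def[symmetric] \<alpha>_def \<beta>_def
    by (simp add: field_simps power2_eq_square power4_eq_xxxx)
qed

theorem sigma2_expansion:
  assumes n: "CARD('n) \<ge> 3"
  shows "of_order L 3 (\<lambda>k x. exp (4 * w k x) * local_sigma2 (Gk k) x -
    (I e e x)\<^sup>2 * ((real CARD('n) - 1) / 2 * (p k x)\<^sup>2 * q k x
       + (real CARD('n) - 1) * (real CARD('n) - 4) / 8 * (p k x) ^ 4))"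
proof -
  note n1 = order_mixed_diff[OF n] and n2 = order_mixed[OF n]
  have tr: "of_order L 1 (\<lambda>k x. (\<Sum>i\<in>UNIV. mixed i i k x) - (\<Sum>i\<in>UNIV. mixed_lead i i k x))"
    unfolding sum_subtractf[symmetric] by (intro of_order_sum n1)
  have 1: "of_order L 3 (\<lambda>k x. (\<Sum>i\<in>UNIV. mixed i i k x) * (\<Sum>i\<in>UNIV. mixed i i k x)
      - (\<Sum>i\<in>UNIV. mixed_lead i i k x) * (\<Sum>i\<in>UNIV. mixed_lead i i k x))"
    using tr of_order_sum[of UNIV L 2 "\<lambda>i. mixed i i", OF n2] of_order_sum[of UNIV L 2 "\<lambda>i. mixed_lead i i", OF order_mixed_lead]
    by (intro of_order_mult_diff[where a = 1 and b = 0 and a' = 1 and b' = 0 and c = 2 and c' = 2]) auto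
  have 2: "of_order L 3 (\<lambda>k x. (\<Sum>i\<in>UNIV. \<Sum>j\<in>UNIV. mixed i j k x * mixed j i k x) -
       (\<Sum>i\<in>UNIV. \<Sum>j\<in>UNIV. mixed_lead i j k x * mixed_lead j i k x))"
    unfolding sum_subtractf[symmetric] using n1 n2 order_mixed_lead
    by (intro of_order_sum of_order_mult_diff[where a = 1 and b = 0 and a' = 1 and b' = 0 and c = 2 and c' = 2]) auto
  have "of_order L 3 (\<lambda>k x. 1 / 2 * (((\<Sum>i\<in>UNIV. mixed i i k x) * (\<Sum>i\<in>UNIV. mixed i i k x)
      - (\<Sum>i\<in>UNIV. mixed_lead i i k x) * (\<Sum>i\<in>UNIV. mixed_lead i i k x)) -
      ((\<Sum>i\<in>UNIV. \<Sum>j\<in>UNIV. mixed i j k x * mixed j i k x) -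
       (\<Sum>i\<in>UNIV. \<Sum>j\<in>UNIV. mixed_lead i j k x * mixed_lead j i k x))))"
    by (intro of_order_cmult of_order_diff 1 2)
  moreover have "exp (4 * w k x) * local_sigma2 (Gk k) x -
    (I e e x)\<^sup>2 * ((real CARD('n) - 1) / 2 * (p k x)\<^sup>2 * q k x
       + (real CARD('n) - 1) * (real CARD('n) - 4) / 8 * (p k x) ^ 4)
    = 1 / 2 * (((\<Sum>i\<in>UNIV. mixed i i k x) * (\<Sum>i\<in>UNIV. mixed i i k x)
      - (\<Sum>i\<in>UNIV. mixed_lead i i k x) * (\<Sum>i\<in>UNIV. mixed_lead i i k x)) -
      ((\<Sum>i\<in>UNIV. \<Sum>j\<in>UNIV. mixed i j k x * mixed j i k x) -
       (\<Sum>i\<in>UNIV. \<Sum>j\<in>UNIV. mixed_lead i j k x * mixed_lead j i k x)))" if "x \<in> L" for k x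
  proof -
    have x: "x \<in> S" using that L_S by blast
    show ?thesis unfolding local_sigma2_Gk[OF x] sigma2_mixed_lead[OF x, symmetric] by argo
  qed
  ultimately show ?thesis by (subst of_order_cong) auto
qed

end

section \<open>Change of variables\<close>

text \<open>The change of variables formula refers to a well-order of the coordinates. Every finite index
  type is in bijection with a well-ordered one, and relabelling coordinates preserves Lebesgue
  measure and determinants.\<close>

typedef (overloaded) 'n ordered_index = "UNIV :: 'n::finite set"
  by simp

instance ordered_index :: (finite) finite
proof
  have "(UNIV :: 'a ordered_index set) = Abs_ordered_index ` UNIV"
    by (metis Rep_ordered_index_inverse UNIV_I image_eqI subsetI subset_UNIV subset_antisym)
  then show "finite (UNIV :: 'a ordered_index set)" by (metis finite finite_imageI)
qed

instantiation ordered_index :: (finite) wellorder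
begin

definition "x \<le> y \<longleftrightarrow> to_nat (Rep_ordered_index x) \<le> to_nat (Rep_ordered_index y)"
definition "x < y \<longleftrightarrow> to_nat (Rep_ordered_index x) < to_nat (Rep_ordered_index y)"

instance
proof
  fix P :: "'a ordered_index \<Rightarrow> bool" and a
  assume P: "\<And>x. (\<And>y. y < x \<Longrightarrow> P y) \<Longrightarrow> P x"
  show "P a"
    by (induction a rule: measure_induct_rule[of "\<lambda>x. to_nat (Rep_ordered_index x)"])
       (rule P, simp add: less_ordered_index_def)
qed (auto simp: less_eq_ordered_index_def less_ordered_index_def Rep_ordered_index_inject)

end

abbreviation "unordered \<equiv> Rep_ordered_index"
abbreviation "ordered \<equiv> Abs_ordered_index"

lemma bij_unordered: "bij (unordered :: 'n::finite ordered_index \<Rightarrow> 'n)"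
  by (metis Abs_ordered_index_inverse Rep_ordered_index_inverse UNIV_I bijI')

text \<open>The sign is multiplicative and the conjugate of a transposition is a transposition.\<close>

lemma sign_conjugate:
  fixes f :: "'m::finite \<Rightarrow> 'n::finite"
  assumes f: "bij f" and p: "p permutes (UNIV :: 'm set)"
  shows "sign (f \<circ> p \<circ> inv f) = sign p"
  using p finite_class.finite_UNIV
proof (induction p rule: permutes_induct)
  case id
  have "f \<circ> id \<circ> inv f = id" using f by (simp add: fun_eq_iff bij_is_surj surj_f_inv_f)
  then show ?case by simp
next
  case (swap a b p)
  have inv: "inv f (f x) = x" "f (inv f y) = y" for x y
    using f by (simp_all add: bij_is_inj bij_is_surj surj_f_inv_f)
  have fi: "f u = f v \<longleftrightarrow> u = v" for u v
    using inj_eq[OF bij_is_inj[OF f]] .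
  have eq: "f \<circ> (Transposition.transpose a b \<circ> p) \<circ> inv f = Transposition.transpose (f a) (f b) \<circ> (f \<circ> p \<circ> inv f)"
    using f by (auto simp: fun_eq_iff Transposition.transpose_def fi)
  have "bij (f \<circ> p \<circ> inv f)"
    using f swap by (intro bij_comp bij_imp_bij_inv permutes_bij)
  then have perm: "permutation (f \<circ> p \<circ> inv f)"
    by (metis bij_imp_permutes finite permutation_permutes subset_UNIV UNIV_I)
  have permp: "permutation p" using swap finite permutation_permutes by blast
  have "sign (Transposition.transpose (f a) (f b)) = sign (Transposition.transpose a b)"
    using f swap by (simp add: sign_swap_id bij_is_inj inj_eq)
  then show ?case
    unfolding eq sign_compose[OF permutation_swap_id perm] sign_compose[OF permutation_swap_id permp]
    by (simp only: swap.IH)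
qed

lemma det_reindex:
  fixes A :: "real^'n^'n" and f :: "'m::finite \<Rightarrow> 'n::finite"
  assumes f: "bij f"
  shows "det (\<chi> i j. A $ f i $ f j) = det A"
proof -
  have inv: "inv f (f x) = x" "f (inv f y) = y" for x y
    using f by (simp_all add: bij_is_inj bij_is_surj surj_f_inv_f)
  let ?c = "\<lambda>p. f \<circ> p \<circ> inv f"
  have bij: "bij_betw ?c {p. p permutes (UNIV :: 'm set)} {p. p permutes (UNIV :: 'n set)}"
  proof (rule bij_betw_byWitness[where f' = "\<lambda>p. inv f \<circ> p \<circ> f"])
    show "?c ` {p. p permutes (UNIV :: 'm set)} \<subseteq> {p. p permutes (UNIV :: 'n set)}"
      using f by (auto intro!: bij_imp_permutes bij_comp bij_imp_bij_inv permutes_bij)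
    show "(\<lambda>p. inv f \<circ> p \<circ> f) ` {p. p permutes (UNIV :: 'n set)} \<subseteq> {p. p permutes (UNIV :: 'm set)}"
      using f by (auto intro!: bij_imp_permutes bij_comp bij_imp_bij_inv permutes_bij)
  qed (auto simp: fun_eq_iff inv)
  have "det A = (\<Sum>p | p permutes (UNIV :: 'm set). of_int (sign (?c p)) * (\<Prod>i\<in>UNIV. A $ i $ ?c p i))"
    unfolding det_def by (rule sum.reindex_bij_betw[OF bij, symmetric])
  also have "\<dots> = (\<Sum>p | p permutes (UNIV :: 'm set). of_int (sign p) * (\<Prod>i\<in>UNIV. A $ f i $ f (p i)))"
  proof (rule sum.cong[OF refl])
    fix p assume "p \<in> {p. p permutes (UNIV :: 'm set)}"
    moreover have "(\<Prod>i\<in>UNIV. A $ i $ ?c p i) = (\<Prod>i\<in>UNIV. A $ f i $ ?c p (f i))"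
      by (rule prod.reindex_bij_betw[OF f, symmetric])
    ultimately show "of_int (sign (?c p)) * (\<Prod>i\<in>UNIV. A $ i $ ?c p i) = of_int (sign p) * (\<Prod>i\<in>UNIV. A $ f i $ f (p i))"
      using sign_conjugate[OF f] by (simp add: inv)
  qed
  finally show ?thesis by (simp add: det_def)
qed

definition to_ordered :: "real^'n \<Rightarrow> real^'n::finite ordered_index" where
  "to_ordered x = (\<chi> i. x $ unordered i)"

definition of_ordered :: "real^'n ordered_index \<Rightarrow> real^'n::finite" where
  "of_ordered y = (\<chi> i. y $ ordered i)"

lemma of_ordered_to_ordered [simp]: "of_ordered (to_ordered x) = x"
  by (simp add: to_ordered_def of_ordered_def vec_eq_iff Abs_ordered_index_inverse)

lemma to_ordered_of_ordered [simp]: "to_ordered (of_ordered y) = y"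
  by (simp add: to_ordered_def of_ordered_def vec_eq_iff Rep_ordered_index_inverse)

lemma bounded_linear_to_ordered: "bounded_linear to_ordered"
  by (intro linear_conv_bounded_linear[THEN iffD1] linearI) (auto simp: to_ordered_def vec_eq_iff)

lemma bounded_linear_of_ordered: "bounded_linear of_ordered"
  by (intro linear_conv_bounded_linear[THEN iffD1] linearI) (auto simp: of_ordered_def vec_eq_iff)

lemma measurable_of_ordered [measurable]: "of_ordered \<in> borel_measurable borel"
  by (intro borel_measurable_continuous_onI linear_continuous_on bounded_linear_of_ordered)

lemma Basis_cart: "(Basis :: (real^'k) set) = range (\<lambda>i. axis i 1)"
  by (auto simp: Basis_vec_def)

lemma prod_Basis_cart: "(\<Prod>b\<in>Basis. x \<bullet> b) = (\<Prod>i\<in>UNIV. x $ i)" for x :: "real^'k"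
proof -
  have "inj (\<lambda>i::'k. axis i (1::real))" by (auto simp: inj_on_def axis_eq_axis)
  then show ?thesis
    unfolding Basis_cart by (simp add: prod.reindex inner_axis)
qed

text \<open>Relabelling the coordinates maps boxes to boxes with the same side lengths.\<close>

lemma distr_of_ordered: "distr lborel borel of_ordered = (lborel :: (real^'n::finite) measure)"
proof (rule lborel_eqI[symmetric])
  fix l u :: "real^'n" assume lu: "\<And>b. b \<in> Basis \<Longrightarrow> l \<bullet> b \<le> u \<bullet> b"
  have le: "l $ i \<le> u $ i" for i
    using lu[of "axis i 1"] by (simp add: Basis_cart inner_axis)
  have mem: "x \<in> box a b \<longleftrightarrow> (\<forall>i. a $ i < x $ i \<and> x $ i < b $ i)" for a b x :: "real^'k"
    by (simp add: mem_box_cart)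
  have "of_ordered -` box l u = box (to_ordered l) (to_ordered u)"
    unfolding set_eq_iff vimage_eq mem by (simp add: to_ordered_def of_ordered_def)
      (metis Abs_ordered_index_inverse Rep_ordered_index_inverse UNIV_I)
  then have "emeasure (distr lborel borel of_ordered) (box l u) = emeasure lborel (box (to_ordered l) (to_ordered u))"
    by (simp add: emeasure_distr)
  also have "\<dots> = (\<Prod>b\<in>Basis. (to_ordered u - to_ordered l) \<bullet> b)"
    by (rule emeasure_lborel_box) (auto simp: Basis_cart inner_axis to_ordered_def le)
  also have "\<dots> = ennreal (\<Prod>i\<in>UNIV. u $ unordered i - l $ unordered i)"
    by (simp add: prod_Basis_cart to_ordered_def)
  also have "(\<Prod>i\<in>UNIV. u $ unordered i - l $ unordered i) = (\<Prod>i\<in>UNIV. (u - l) $ i)"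
    using prod.reindex_bij_betw[OF bij_unordered, of "\<lambda>i. u $ i - l $ i"] by simp
  finally show "emeasure (distr lborel borel of_ordered) (box l u) = (\<Prod>b\<in>Basis. (u - l) \<bullet> b)"
    by (simp add: prod_Basis_cart)
qed simp

lemma has_integral_iff_set_nn_integral:
  fixes h :: "'a::euclidean_space \<Rightarrow> real"
  assumes m: "(\<lambda>x. indicator S x * h x) \<in> borel_measurable borel"
    and nonneg: "\<And>x. x \<in> S \<Longrightarrow> 0 \<le> h x" and r: "0 \<le> r"
  shows "(h has_integral r) S \<longleftrightarrow> (\<integral>\<^sup>+x\<in>S. ennreal (h x) \<partial>lborel) = ennreal r"
proof
  assume "(h has_integral r) S"
  from nn_integral_has_integral_lebesgue'[OF nonneg this]
  show "(\<integral>\<^sup>+x\<in>S. ennreal (h x) \<partial>lborel) = ennreal r" by simp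
next
  assume I: "(\<integral>\<^sup>+x\<in>S. ennreal (h x) \<partial>lborel) = ennreal r"
  have "(\<integral>\<^sup>+x. ennreal (indicator S x * h x) \<partial>lborel) = (\<integral>\<^sup>+x\<in>S. ennreal (h x) \<partial>lborel)"
    by (intro nn_integral_cong) (auto split: split_indicator)
  then have "((\<lambda>x. indicator S x * h x) has_integral r) UNIV"
    using nonneg r I by (intro nn_integral_has_integral m) (auto split: split_indicator)
  moreover have "(\<lambda>x. indicator S x * h x) = (\<lambda>x. if x \<in> S then h x else 0)"
    by (auto simp: fun_eq_iff)
  ultimately show "(h has_integral r) S" by (simp add: has_integral_restrict_UNIV)
qed

text \<open>For nonnegative functions the formula holds without integrability assumptions: a finite value on
  one side is the value on the other side, so that both sides are finite or both are infinite.\<close>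

lemma nn_integral_change_of_variables_ordered:
  fixes T :: "real^'m::{finite,wellorder} \<Rightarrow> real^'m::_" and f :: "real^'m::_ \<Rightarrow> real"
  assumes S: "S \<in> sets borel" and T: "\<And>x. x \<in> S \<Longrightarrow> (T has_derivative T' x) (at x)"
    and inj: "inj_on T S"
    and m1: "(\<lambda>x. indicator (T ` S) x * f x) \<in> borel_measurable borel"
    and m2: "(\<lambda>x. indicator S x * (\<bar>det (matrix (T' x))\<bar> * f (T x))) \<in> borel_measurable borel"
    and nonneg: "\<And>x. x \<in> S \<Longrightarrow> 0 \<le> f (T x)"
  shows "(\<integral>\<^sup>+x\<in>T ` S. ennreal (f x) \<partial>lborel) = (\<integral>\<^sup>+x\<in>S. ennreal (\<bar>det (matrix (T' x))\<bar> * f (T x)) \<partial>lborel)"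
proof -
  define h where "h = (\<lambda>x. \<bar>det (matrix (T' x))\<bar> * f (T x))"
  have hn: "0 \<le> h x" if "x \<in> S" for x using nonneg that by (simp add: h_def)
  have fn: "0 \<le> f y" if "y \<in> T ` S" for y using nonneg that by auto
  have "(h has_integral r) S \<longleftrightarrow> (f has_integral r) (T ` S)" for r
  proof -
    have 1: "(\<lambda>x. \<bar>det (matrix (T' x))\<bar> *\<^sub>R (vec (f (T x)) :: real^1)) = (\<lambda>x. vec (h x))"
      by (simp add: h_def vec_eq_iff fun_eq_iff)
    have "(\<lambda>x. vec (h x) :: real^1) absolutely_integrable_on S \<and> integral S (\<lambda>x. vec (h x) :: real^1) = vec r \<longleftrightarrow>
      (\<lambda>x. vec (f x) :: real^1) absolutely_integrable_on (T ` S) \<and> integral (T ` S) (\<lambda>x. vec (f x) :: real^1) = vec r"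
      using has_absolute_integral_change_of_variables[of S T T' "\<lambda>x. vec (f x) :: real^1" "vec r"]
        S T inj unfolding 1 by (simp add: has_derivative_at_withinI)
    then have "h absolutely_integrable_on S \<and> integral S h = r \<longleftrightarrow>
      f absolutely_integrable_on (T ` S) \<and> integral (T ` S) f = r"
      by (simp add: absolutely_integrable_on_1_iff integral_on_1_eq)
    then show ?thesis
      using hn fn by (simp add: absolutely_integrable_on_iff_nonneg has_integral_iff)
  qed
  then have iff: "(\<integral>\<^sup>+x\<in>S. ennreal (h x) \<partial>lborel) = ennreal r \<longleftrightarrow> (\<integral>\<^sup>+x\<in>T ` S. ennreal (f x) \<partial>lborel) = ennreal r"
    if "0 \<le> r" for r
    using has_integral_iff_set_nn_integral[OF m1 fn that] has_integral_iff_set_nn_integral[of S h, OF _ hn that] m2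
    by (simp add: h_def)
  have "(\<integral>\<^sup>+x\<in>S. ennreal (h x) \<partial>lborel) = (\<integral>\<^sup>+x\<in>T ` S. ennreal (f x) \<partial>lborel)" (is "?A = ?B")
  proof (cases ?A rule: ennreal_cases)
    case (real r)
    then show ?thesis using iff[of r] by simp
  next
    case top
    show ?thesis
    proof (cases ?B rule: ennreal_cases)
      case (real r)
      then have "?A = ennreal r" using iff[of r] by simp
      then show ?thesis using real by simp
    qed (use top in simp)
  qed
  then show ?thesis by (simp add: h_def)
qed

lemma matrix_entry: "matrix D $ i $ j = D (axis j 1) $ i"
  by (simp add: matrix_def)

theorem nn_integral_change_of_variables:
  fixes T :: "real^'n::finite \<Rightarrow> real^'n" and f :: "real^'n \<Rightarrow> real"
  assumes S: "S \<in> sets borel" and T: "\<And>x. x \<in> S \<Longrightarrow> (T has_derivative T' x) (at x)"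
    and inj: "inj_on T S" and TS: "T ` S \<in> sets borel"
    and m1: "(\<lambda>x. indicator (T ` S) x * f x) \<in> borel_measurable borel"
    and m2: "(\<lambda>x. indicator S x * (\<bar>det (matrix (T' x))\<bar> * f (T x))) \<in> borel_measurable borel"
    and nonneg: "\<And>x. x \<in> S \<Longrightarrow> 0 \<le> f (T x)"
  shows "(\<integral>\<^sup>+x\<in>T ` S. ennreal (f x) \<partial>lborel) = (\<integral>\<^sup>+x\<in>S. ennreal (\<bar>det (matrix (T' x))\<bar> * f (T x)) \<partial>lborel)"
proof -
  define U where "U = (\<lambda>y. to_ordered (T (of_ordered y)))"
  define U' where "U' = (\<lambda>y v. to_ordered (T' (of_ordered y) (of_ordered v)))"
  define R where "R = of_ordered -` S"
  have det: "det (matrix (U' y)) = det (matrix (T' (of_ordered y)))" for y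
  proof -
    have ax: "of_ordered (axis j 1) = axis (unordered j) 1" for j
      by (auto simp: of_ordered_def vec_eq_iff axis_def Abs_ordered_index_inverse)
        (metis Rep_ordered_index_inverse)
    have "matrix (U' y) = (\<chi> i j. matrix (T' (of_ordered y)) $ unordered i $ unordered j)"
      by (subst vec_eq_iff, subst vec_eq_iff) (simp add: matrix_entry U'_def to_ordered_def ax)
    then show ?thesis using det_reindex[OF bij_unordered] by metis
  qed
  have UR: "U ` R = of_ordered -` (T ` S)"
  proof (intro equalityI subsetI)
    fix y assume "y \<in> of_ordered -` (T ` S)"
    then obtain x where x: "x \<in> S" "of_ordered y = T x" by auto
    have "y = U (to_ordered x)" using x(2) to_ordered_of_ordered[of y] by (simp add: U_def)
    moreover have "to_ordered x \<in> R" using x(1) by (simp add: R_def)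
    ultimately show "y \<in> U ` R" by (rule image_eqI)
  qed (auto simp: U_def R_def)
  have meas: "R \<in> sets borel"
    using measurable_sets_borel[OF measurable_of_ordered S] by (simp add: R_def)
  have swap: "(\<integral>\<^sup>+x\<in>A. g x \<partial>lborel) = (\<integral>\<^sup>+y\<in>of_ordered -` A. g (of_ordered y) \<partial>lborel)"
    if "(\<lambda>x. g x * indicator A x) \<in> borel_measurable borel" for A and g :: "real^'n \<Rightarrow> ennreal"
  proof -
    have "(\<integral>\<^sup>+x\<in>A. g x \<partial>lborel) = (\<integral>\<^sup>+x. g x * indicator A x \<partial>distr lborel borel of_ordered)"
      unfolding distr_of_ordered ..
    also have "\<dots> = (\<integral>\<^sup>+y. g (of_ordered y) * indicator A (of_ordered y) \<partial>lborel)"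
      using that by (subst nn_integral_distr) auto
    also have "\<dots> = (\<integral>\<^sup>+y\<in>of_ordered -` A. g (of_ordered y) \<partial>lborel)"
      by (intro nn_integral_cong) (auto split: split_indicator)
    finally show ?thesis .
  qed
  have em: "(\<lambda>x. ennreal (g x) * indicator A x) \<in> borel_measurable borel"
    if "(\<lambda>x. indicator A x * g x) \<in> borel_measurable borel" for A and g :: "real^'n \<Rightarrow> real"
  proof -
    have "(\<lambda>x. ennreal (g x) * indicator A x) = (\<lambda>x. ennreal (indicator A x * g x))"
      by (auto simp: fun_eq_iff split: split_indicator)
    then show ?thesis using that by simp
  qed
  have "(\<integral>\<^sup>+x\<in>T ` S. ennreal (f x) \<partial>lborel) = (\<integral>\<^sup>+y\<in>U ` R. ennreal (f (of_ordered y)) \<partial>lborel)"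
    unfolding UR by (rule swap[OF em[OF m1]])
  also have "\<dots> = (\<integral>\<^sup>+y\<in>R. ennreal (\<bar>det (matrix (U' y))\<bar> * f (of_ordered (U y))) \<partial>lborel)"
  proof (rule nn_integral_change_of_variables_ordered[OF meas])
    show "(U has_derivative U' y) (at y)" if "y \<in> R" for y
    proof -
      have "(T has_derivative T' (of_ordered y)) (at (of_ordered y))" using T that by (simp add: R_def)
      from has_derivative_compose[OF bounded_linear.has_derivative[OF bounded_linear_of_ordered has_derivative_ident] this]
      show ?thesis unfolding U_def U'_def by (rule bounded_linear.has_derivative[OF bounded_linear_to_ordered])
    qed
    show "inj_on U R"
    proof (rule inj_onI)
      fix x y assume xy: "x \<in> R" "y \<in> R" "U x = U y"
      then have "T (of_ordered x) = T (of_ordered y)" unfolding U_def by (metis of_ordered_to_ordered)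
      then have "of_ordered x = of_ordered y" using xy inj by (auto simp: R_def inj_on_def)
      then show "x = y" by (metis to_ordered_of_ordered)
    qed
    have "(\<lambda>y. (\<lambda>x. indicator (T ` S) x * f x) (of_ordered y)) \<in> borel_measurable borel"
      using m1 measurable_of_ordered by measurable
    then show "(\<lambda>x. indicator (U ` R) x * f (of_ordered x)) \<in> borel_measurable borel"
      unfolding UR by (simp add: indicator_def)
    have "(\<lambda>y. (\<lambda>x. indicator S x * (\<bar>det (matrix (T' x))\<bar> * f (T x))) (of_ordered y)) \<in> borel_measurable borel"
      using m2 measurable_of_ordered by measurable
    then show "(\<lambda>x. indicator R x * (\<bar>det (matrix (U' x))\<bar> * f (of_ordered (U x)))) \<in> borel_measurable borel"
      unfolding det by (simp add: indicator_def R_def U_def)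
    show "0 \<le> f (of_ordered (U x))" if "x \<in> R" for x using nonneg that by (simp add: R_def U_def)
  qed
  also have "\<dots> = (\<integral>\<^sup>+x\<in>S. ennreal (\<bar>det (matrix (T' x))\<bar> * f (T x)) \<partial>lborel)"
    unfolding det R_def U_def of_ordered_to_ordered by (rule swap[OF em[OF m2], symmetric])
  finally show ?thesis .
qed

section \<open>Charts and functions on the manifold\<close>

lemma chart_inv_left: "chart_on M c \<Longrightarrow> p \<in> fst c \<Longrightarrow> chart_inv c (snd c p) = p"
proof -
  assume c: "chart_on M c" "p \<in> fst c"
  then have "fst c \<subseteq> topspace M" by (simp add: chart_on_def openin_subset)
  then have "topspace (subtopology M (fst c)) = fst c" by (simp add: topspace_subtopology Int_absorb1)
  moreover have "homeomorphic_map (subtopology M (fst c)) (top_of_set (snd c ` fst c)) (snd c)"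
    using c(1) by (simp add: chart_on_def)
  ultimately have "inj_on (snd c) (fst c)"
    using homeomorphic_imp_injective_map by metis
  then show ?thesis using c(2) by (simp add: chart_inv_def)
qed

lemma chart_inv_right:
  assumes "x \<in> snd c ` fst c"
  shows "snd c (chart_inv c x) = x" "chart_inv c x \<in> fst c"
  using assms by (auto simp: chart_inv_def f_inv_into_f inv_into_into)

lemma chart_inj: "chart_on M c \<Longrightarrow> inj_on (snd c) (fst c)"
  by (metis chart_inv_left inj_onI)

lemma chart_image_open:
  assumes c: "chart_on M c" and W: "openin M W"
  shows "open (snd c ` (W \<inter> fst c))"
proof -
  have "open_map (subtopology M (fst c)) (top_of_set (snd c ` fst c)) (snd c)"
    using c by (simp add: chart_on_def homeomorphic_imp_open_map)
  moreover have "openin (subtopology M (fst c)) (W \<inter> fst c)"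
    using W by (auto simp: openin_subtopology)
  ultimately have "openin (top_of_set (snd c ` fst c)) (snd c ` (W \<inter> fst c))"
    by (simp add: open_map_def)
  then show ?thesis
    using c by (metis chart_on_def openin_open_trans)
qed

lemma chart_preimage_open:
  assumes c: "chart_on M c" and W: "open W"
  shows "openin M {p \<in> fst c. snd c p \<in> W}"
proof -
  have U: "openin M (fst c)" using c by (simp add: chart_on_def)
  have "continuous_map (subtopology M (fst c)) (top_of_set (snd c ` fst c)) (snd c)"
    using c by (simp add: chart_on_def homeomorphic_imp_continuous_map)
  then have "continuous_map (subtopology M (fst c)) euclidean (snd c)"
    using continuous_map_into_fulltopology by blast
  then have "openin (subtopology M (fst c)) {p \<in> topspace (subtopology M (fst c)). snd c p \<in> W}"
    using W by (auto simp: continuous_map_def)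
  moreover have "topspace (subtopology M (fst c)) = fst c"
    using openin_subset[OF U] by (auto simp: topspace_subtopology)
  ultimately show ?thesis using openin_trans_full[OF _ U] by metis
qed

abbreviation borel_of :: "'a topology \<Rightarrow> 'a measure" where
  "borel_of M \<equiv> sigma (topspace M) {U. openin M U}"

lemma space_borel_of [simp]: "space (borel_of M) = topspace M"
  by (simp add: space_measure_of_conv)

lemma sets_borel_of: "sets (borel_of M) = sigma_sets (topspace M) {U. openin M U}"
  by (rule sets_measure_of) (auto dest: openin_subset)

lemma open_in_borel_of: "openin M U \<Longrightarrow> U \<in> sets (borel_of M)"
  unfolding sets_borel_of by (rule sigma_sets.Basic) simp

lemma borel_of_subset: "B \<in> sets (borel_of M) \<Longrightarrow> B \<subseteq> topspace M"
  using sets.sets_into_space by fastforce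

text \<open>A chart is open and injective, so the sets with Borel image form a sigma-algebra that contains the
  open sets.\<close>

lemma chart_image_borel:
  assumes c: "chart_on M c" and B: "B \<in> sets (borel_of M)"
  shows "snd c ` (B \<inter> fst c) \<in> sets borel"
proof -
  have inj: "inj_on (snd c) (fst c)" by (rule chart_inj[OF c])
  have Uc: "fst c \<subseteq> topspace M" using c by (simp add: chart_on_def openin_subset)
  have V: "open (snd c ` fst c)" using c by (simp add: chart_on_def)
  have "B \<in> sigma_sets (topspace M) {U. openin M U}" using B by (simp add: sets_borel_of)
  then show ?thesis
  proof induction
    case (Basic a)
    then show ?case using chart_image_open[OF c] by (intro borel_open) auto
  next
    case (Compl a)
    have "snd c ` ((topspace M - a) \<inter> fst c) = snd c ` fst c - snd c ` (a \<inter> fst c)"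
      using Uc inj by (auto simp: inj_on_def)
    then show ?case using Compl V by auto
  next
    case (Union a)
    have "snd c ` (\<Union> (range a) \<inter> fst c) = (\<Union>i. snd c ` (a i \<inter> fst c))" by auto
    then show ?case using Union by auto
  qed auto
qed

locale closed_manifold =
  fixes M :: "'a topology" and \<A> :: "('a, 'n::finite) chart set"
  assumes compact_manifold: "compact_manifold M \<A>"
begin

lemma chart: "c \<in> \<A> \<Longrightarrow> chart_on M c"
  using compact_manifold by (simp add: compact_manifold_def smooth_atlas_def)

lemma chart_open: "c \<in> \<A> \<Longrightarrow> openin M (fst c)"
  using chart by (simp add: chart_on_def)

lemma image_open: "c \<in> \<A> \<Longrightarrow> open (snd c ` fst c)"
  using chart by (simp add: chart_on_def)

lemma charts_cover: "(\<Union>c\<in>\<A>. fst c) = topspace M"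
  using compact_manifold by (simp add: compact_manifold_def smooth_atlas_def)

lemma ex_chart: "p \<in> topspace M \<Longrightarrow> \<exists>c\<in>\<A>. p \<in> fst c"
  using charts_cover by blast

text \<open>The form in which compactness is used: a local property holds on finitely many open sets that
  cover the manifold.\<close>

lemma finite_cover:
  assumes "\<And>p. p \<in> topspace M \<Longrightarrow> \<exists>W. openin M W \<and> p \<in> W \<and> Q W"
  shows "\<exists>\<F>. finite \<F> \<and> (\<forall>W\<in>\<F>. openin M W \<and> Q W) \<and> topspace M \<subseteq> \<Union>\<F>"
proof -
  have "compact_space M" using compact_manifold by (simp add: compact_manifold_def)
  moreover have "topspace M \<subseteq> \<Union>{W. openin M W \<and> Q W}" using assms by blast
  ultimately obtain \<F> where "finite \<F>" "\<F> \<subseteq> {W. openin M W \<and> Q W}" "topspace M \<subseteq> \<Union>\<F>"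
    unfolding compact_space_alt by (metis (no_types, lifting) mem_Collect_eq)
  then show ?thesis by blast
qed

lemma chart_cover_spec: "set (chart_cover M \<A>) \<subseteq> \<A> \<and> (\<Union>c\<in>set (chart_cover M \<A>). fst c) = topspace M"
proof -
  obtain \<F> where F: "finite \<F>" "\<forall>W\<in>\<F>. openin M W \<and> (\<exists>c\<in>\<A>. W = fst c)" "topspace M \<subseteq> \<Union>\<F>"
    using finite_cover[of "\<lambda>W. \<exists>c\<in>\<A>. W = fst c"] ex_chart chart_open by metis
  then have "\<F> \<subseteq> fst ` \<A>" by auto
  from finite_subset_image[OF F(1) this] obtain C where C: "C \<subseteq> \<A>" "finite C" "\<F> = fst ` C" by blast
  obtain cs where cs: "set cs = C" using finite_list[OF C(2)] by blast
  have "(\<Union>c\<in>set cs. fst c) = topspace M"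
  proof
    show "topspace M \<subseteq> (\<Union>c\<in>set cs. fst c)" using F(3) C(3) cs by simp
    show "(\<Union>c\<in>set cs. fst c) \<subseteq> topspace M" using charts_cover C(1) cs by blast
  qed
  then have "\<exists>cs. set cs \<subseteq> \<A> \<and> (\<Union>c\<in>set cs. fst c) = topspace M" using C(1) cs by blast
  from someI_ex[OF this] show ?thesis unfolding chart_cover_def .
qed

lemma chart_at_spec:
  assumes "p \<in> topspace M"
  shows "chart_at M \<A> p \<in> \<A>" "p \<in> fst (chart_at M \<A> p)"
proof -
  have "\<exists>c\<in>set (chart_cover M \<A>). p \<in> fst c" using chart_cover_spec assms by blast
  then obtain c where f: "find (\<lambda>c. p \<in> fst c) (chart_cover M \<A>) = Some c"
    by (cases "find (\<lambda>c. p \<in> fst c) (chart_cover M \<A>)") (auto simp: find_None_iff)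
  then have "c \<in> set (chart_cover M \<A>)" "p \<in> fst c"
    by (auto simp: find_Some_iff)
  then show "chart_at M \<A> p \<in> \<A>" "p \<in> fst (chart_at M \<A> p)"
    using chart_cover_spec by (auto simp: chart_at_def f)
qed

text \<open>Continuity is expressed in charts because the manifold is an abstract topology, and
  the functions of interest are given by coordinate formulas.\<close>

definition chart_continuous :: "('a \<Rightarrow> real) \<Rightarrow> bool" where
  "chart_continuous h \<longleftrightarrow> (\<forall>c\<in>\<A>. continuous_on (snd c ` fst c) (h \<circ> chart_inv c))"

lemma chart_continuous_measurable:
  assumes "chart_continuous h"
  shows "h \<in> borel_measurable (borel_of M)"
proof (rule borel_measurableI)
  fix W :: "real set" assume W: "open W"
  define N where "N = (\<lambda>c::('a, 'n) chart. {x \<in> snd c ` fst c. (h \<circ> chart_inv c) x \<in> W})"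
  have N: "open (N c)" if "c \<in> \<A>" for c
  proof -
    have "N c = (h \<circ> chart_inv c) -` W \<inter> snd c ` fst c" by (auto simp: N_def)
    moreover have "continuous_on (snd c ` fst c) (h \<circ> chart_inv c)"
      using assms that unfolding chart_continuous_def by blast
    ultimately show ?thesis
      using continuous_on_open_vimage[OF image_open[OF that]] W by metis
  qed
  have "h -` W \<inter> space (borel_of M) = (\<Union>c\<in>\<A>. {p \<in> fst c. snd c p \<in> N c})"
  proof (intro equalityI subsetI)
    fix p assume "p \<in> h -` W \<inter> space (borel_of M)"
    then have p: "p \<in> topspace M" "h p \<in> W" by auto
    obtain c where c: "c \<in> \<A>" "p \<in> fst c" using ex_chart[OF p(1)] by blast
    then have "snd c p \<in> N c" using p(2) chart_inv_left[OF chart] by (auto simp: N_def)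
    then show "p \<in> (\<Union>c\<in>\<A>. {p \<in> fst c. snd c p \<in> N c})" using c by blast
  next
    fix p assume "p \<in> (\<Union>c\<in>\<A>. {p \<in> fst c. snd c p \<in> N c})"
    then obtain c where c: "c \<in> \<A>" "p \<in> fst c" "snd c p \<in> N c" by blast
    then show "p \<in> h -` W \<inter> space (borel_of M)"
      using chart_inv_left[OF chart] charts_cover by (auto simp: N_def)
  qed
  moreover have "openin M (\<Union>c\<in>\<A>. {p \<in> fst c. snd c p \<in> N c})"
    using chart_preimage_open[OF chart N] by blast
  ultimately show "h -` W \<inter> space (borel_of M) \<in> sets (borel_of M)"
    by (simp add: open_in_borel_of)
qed

lemma compact_chart_ball:
  assumes "c \<in> \<A>" "p \<in> fst c"
  shows "\<exists>r>0. cball (snd c p) r \<subseteq> snd c ` fst c"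
  using open_contains_cball[of "snd c ` fst c"] image_open[OF assms(1)] assms(2) by blast

lemma chart_continuous_bounded:
  assumes "chart_continuous h"
  shows "\<exists>C. \<forall>p\<in>topspace M. \<bar>h p\<bar> \<le> C"
proof -
  have "\<exists>W. openin M W \<and> p \<in> W \<and> (\<exists>C. \<forall>q\<in>W. \<bar>h q\<bar> \<le> C)" if p: "p \<in> topspace M" for p
  proof -
    obtain c where c: "c \<in> \<A>" "p \<in> fst c" using ex_chart[OF p] by blast
    obtain r where r: "r > 0" "cball (snd c p) r \<subseteq> snd c ` fst c" using compact_chart_ball[OF c] by blast
    have "continuous_on (cball (snd c p) r) (h \<circ> chart_inv c)"
      using assms c(1) unfolding chart_continuous_def by (intro continuous_on_subset[OF _ r(2)]) blast
    then have "bounded ((h \<circ> chart_inv c) ` cball (snd c p) r)"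
      by (intro compact_imp_bounded compact_continuous_image) auto
    then obtain C where C: "\<And>x. x \<in> cball (snd c p) r \<Longrightarrow> \<bar>h (chart_inv c x)\<bar> \<le> C"
      unfolding bounded_iff by (auto simp del: mem_cball)
    define W where "W = {q \<in> fst c. snd c q \<in> ball (snd c p) r}"
    have "openin M W" unfolding W_def using chart_preimage_open[OF chart[OF c(1)]] by blast
    moreover have "p \<in> W" using c r by (simp add: W_def)
    moreover have "\<bar>h q\<bar> \<le> C" if "q \<in> W" for q
      using C[of "snd c q"] that chart_inv_left[OF chart[OF c(1)], of q] by (auto simp: W_def)
    ultimately show ?thesis by blast
  qed
  from finite_cover[OF this] obtain \<F> where F: "finite \<F>" "\<forall>W\<in>\<F>. \<exists>C. \<forall>q\<in>W. \<bar>h q\<bar> \<le> C" "topspace M \<subseteq> \<Union>\<F>"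
    by blast
  obtain C where C: "\<forall>W\<in>\<F>. \<forall>q\<in>W. \<bar>h q\<bar> \<le> C W" using F(2) by metis
  have "\<bar>h p\<bar> \<le> (\<Sum>W\<in>\<F>. \<bar>C W\<bar>)" if p: "p \<in> topspace M" for p
  proof -
    obtain W where W: "W \<in> \<F>" "p \<in> W" using F(3) p by blast
    then have "\<bar>h p\<bar> \<le> \<bar>C W\<bar>" using C by force
    also have "\<dots> \<le> (\<Sum>W\<in>\<F>. \<bar>C W\<bar>)" using F(1) W by (intro member_le_sum) auto
    finally show ?thesis .
  qed
  then show ?thesis by blast
qed

lemma smooth_function_chart_continuous: "smooth_function \<A> f \<Longrightarrow> chart_continuous f"
  unfolding smooth_function_def chart_continuous_def by (blast intro: smooth_on_imp_continuous_on)

lemma transition_chart: "p \<in> fst c \<Longrightarrow> c \<in> \<A> \<Longrightarrow> transition c d (snd c p) = snd d p"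
  by (simp add: transition_def chart_inv_left[OF chart])

lemma chart_coordinate_metric:
  assumes "riemannian_metric \<A> g" "c \<in> \<A>"
  shows "coordinate_metric (snd c ` fst c) (g c)"
  using assms image_open[OF assms(2)] by unfold_locales (auto simp: riemannian_metric_def)

lemma coordinate_metric_subset:
  assumes "coordinate_metric S G" "open S'" "S' \<subseteq> S"
  shows "coordinate_metric S' G"
proof -
  interpret coordinate_metric S G by fact
  show ?thesis
    using assms(2,3) sym_G pos_G smooth_on_subset[OF smooth_G] by unfold_locales auto
qed

lemma overlap_open: "c \<in> \<A> \<Longrightarrow> d \<in> \<A> \<Longrightarrow> open (snd c ` (fst c \<inter> fst d))"
  using chart_image_open[OF chart chart_open, of c d] by (simp add: Int_commute)

lemma smooth_transition: "c \<in> \<A> \<Longrightarrow> d \<in> \<A> \<Longrightarrow> smooth_on (snd c ` (fst c \<inter> fst d)) (transition c d)"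
  using compact_manifold by (simp add: compact_manifold_def smooth_atlas_def)

lemma transition_maps: "c \<in> \<A> \<Longrightarrow> transition c d ` (snd c ` (fst c \<inter> fst d)) \<subseteq> snd d ` fst d"
  by (auto simp: transition_chart)

lemma chart_coordinate_change:
  assumes g: "riemannian_metric \<A> g" and c: "c \<in> \<A>" and d: "d \<in> \<A>"
  shows "coordinate_change (snd c ` (fst c \<inter> fst d)) (g c) (snd d ` fst d) (g d) (transition c d)"
proof -
  let ?S = "snd c ` (fst c \<inter> fst d)" and ?T = "transition c d"
  interpret G: coordinate_metric ?S "g c"
    by (rule coordinate_metric_subset[OF chart_coordinate_metric[OF g c] overlap_open[OF c d]]) auto
  interpret H: coordinate_metric "snd d ` fst d" "g d"
    by (rule chart_coordinate_metric[OF g d])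
  have eq: "(\<chi> a i. pderivative i (\<lambda>y. ?T y $ a) x) = matrix (frechet_derivative ?T (at x))" if "x \<in> ?S" for x
    using jacobian_entry[OF smooth_on_imp_differentiable[OF smooth_transition[OF c d] that]]
    by (simp add: vec_eq_iff)
  show ?thesis
  proof
    show "smooth_on ?S ?T" by (rule smooth_transition[OF c d])
    show "?T ` ?S \<subseteq> snd d ` fst d" by (rule transition_maps[OF c])
    show "g c x = transpose (\<chi> a i. pderivative i (\<lambda>y. ?T y $ a) x) ** g d (?T x) ** (\<chi> a i. pderivative i (\<lambda>y. ?T y $ a) x)"
      if "x \<in> ?S" for x
      using g c d that unfolding eq[OF that] riemannian_metric_def Let_def by blast
  qed
qed

text \<open>The chart that the definition of \<open>sigma2\<close> selects can be replaced by any other one.\<close>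

lemma sigma2_eq:
  assumes g: "riemannian_metric \<A> g" and c: "c \<in> \<A>" "p \<in> fst c"
  shows "sigma2 M \<A> g p = local_sigma2 (g c) (snd c p)"
proof -
  have p: "p \<in> topspace M" using c charts_cover by blast
  define d where "d = chart_at M \<A> p"
  have d: "d \<in> \<A>" "p \<in> fst d" using chart_at_spec[OF p] by (auto simp: d_def)
  interpret coordinate_change "snd d ` (fst d \<inter> fst c)" "g d" "snd c ` fst c" "g c" "transition d c"
    "\<lambda>a i. pderivative i (\<lambda>y. transition d c y $ a)"
    by (rule chart_coordinate_change[OF g d(1) c(1)])
  have "local_sigma2 (g d) (snd d p) = local_sigma2 (g c) (transition d c (snd d p))"
    by (rule local_sigma2_transform) (use c d in auto)
  also have "transition d c (snd d p) = snd c p" by (rule transition_chart[OF d(2,1)])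
  finally show ?thesis by (simp add: sigma2_def d_def)
qed

text \<open>Chart independence is essential here: it excludes a blow-up at the boundary between the regions in
  which different charts are selected.\<close>

lemma sigma2_chart_continuous:
  assumes g: "riemannian_metric \<A> g"
  shows "chart_continuous (sigma2 M \<A> g)"
  unfolding chart_continuous_def
proof
  fix c assume c: "c \<in> \<A>"
  interpret coordinate_metric "snd c ` fst c" "g c" by (rule chart_coordinate_metric[OF g c])
  have "continuous_on (snd c ` fst c) (local_sigma2 (g c))"
    by (rule smooth_on_imp_continuous_on[OF smooth_local_sigma2])
  moreover have "(sigma2 M \<A> g \<circ> chart_inv c) x = local_sigma2 (g c) x" if "x \<in> snd c ` fst c" for x
    using sigma2_eq[OF g c] chart_inv_right[OF that] by simp
  ultimately show "continuous_on (snd c ` fst c) (sigma2 M \<A> g \<circ> chart_inv c)"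
    by (subst continuous_on_cong[OF refl]) auto
qed

section \<open>The Riemannian volume\<close>

definition chart_density :: "('a, 'n) metric_field \<Rightarrow> ('a, 'n) chart \<Rightarrow> (real^'n) measure" where
  "chart_density g c = density lborel (\<lambda>x. ennreal (indicator (snd c ` fst c) x * sqrt (det (g c x))))"

lemma det_pos:
  assumes "riemannian_metric \<A> g" "c \<in> \<A>" "x \<in> snd c ` fst c"
  shows "det (g c x) > 0"
  using coordinate_metric.det_G_pos[OF chart_coordinate_metric[OF assms(1,2)] assms(3)] .

lemma continuous_sqrt_det:
  assumes "riemannian_metric \<A> g" "c \<in> \<A>"
  shows "continuous_on (snd c ` fst c) (\<lambda>x. sqrt (det (g c x)))"
proof -
  interpret coordinate_metric "snd c ` fst c" "g c" by (rule chart_coordinate_metric[OF assms])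
  show ?thesis
    by (intro continuous_on_real_sqrt smooth_on_imp_continuous_on smooth_on_det open_S smooth_G_entry)
qed

lemma indicator_sqrt_det_measurable:
  assumes "riemannian_metric \<A> g" "c \<in> \<A>" "B \<in> sets borel" "B \<subseteq> snd c ` fst c"
  shows "(\<lambda>x. indicator B x * sqrt (det (g c x))) \<in> borel_measurable borel"
  using borel_measurable_continuous_on_indicator[OF assms(3) continuous_on_subset[OF continuous_sqrt_det[OF assms(1,2)] assms(4)]]
  by simp

lemma image_borel: "c \<in> \<A> \<Longrightarrow> B \<in> sets (borel_of M) \<Longrightarrow> B \<subseteq> fst c \<Longrightarrow> snd c ` B \<in> sets borel"
  using chart_image_borel[OF chart, of c B] by (simp add: Int_absorb2)

lemma sets_chart_density [simp]: "sets (chart_density g c) = sets borel"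
  by (simp add: chart_density_def)

lemma emeasure_chart_density:
  assumes "riemannian_metric \<A> g" "c \<in> \<A>" "E \<in> sets borel" "E \<subseteq> snd c ` fst c"
  shows "emeasure (chart_density g c) E = (\<integral>\<^sup>+x\<in>E. ennreal (sqrt (det (g c x))) \<partial>lborel)"
proof -
  have "emeasure (chart_density g c) E =
     (\<integral>\<^sup>+x. ennreal (indicator (snd c ` fst c) x * sqrt (det (g c x))) * indicator E x \<partial>lborel)"
    unfolding chart_density_def using assms image_open[OF assms(2)]
    by (intro emeasure_density) (auto intro!: indicator_sqrt_det_measurable measurable_compose[OF _ measurable_ennreal])
  also have "\<dots> = (\<integral>\<^sup>+x\<in>E. ennreal (sqrt (det (g c x))) \<partial>lborel)"
    using assms(4) by (intro nn_integral_cong) (auto split: split_indicator)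
  finally show ?thesis .
qed

text \<open>The factor \<open>|det J|\<close> of the change of variables formula is the quotient of the two densities.\<close>

lemma chart_density_change:
  assumes g: "riemannian_metric \<A> g" and c: "c \<in> \<A>" and d: "d \<in> \<A>"
    and B: "B \<in> sets (borel_of M)" "B \<subseteq> fst c \<inter> fst d"
  shows "emeasure (chart_density g c) (snd c ` B) = emeasure (chart_density g d) (snd d ` B)"
proof -
  let ?T = "transition c d" and ?S = "snd c ` B"
  have sub: "?S \<subseteq> snd c ` (fst c \<inter> fst d)" "?S \<subseteq> snd c ` fst c" "snd d ` B \<subseteq> snd d ` fst d" using B(2) by auto
  have TS: "?T ` ?S = snd d ` B"
    using B(2) c by (force simp: transition_chart image_iff)
  have mc: "?S \<in> sets borel" and md: "snd d ` B \<in> sets borel"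
    using image_borel[OF c B(1)] image_borel[OF d B(1)] B(2) by auto
  have D: "(?T has_derivative frechet_derivative ?T (at x)) (at x)" if "x \<in> ?S" for x
    using smooth_on_imp_differentiable[OF smooth_transition[OF c d]] sub that frechet_derivative_works by blast
  have jac: "\<bar>det (matrix (frechet_derivative ?T (at x)))\<bar> * sqrt (det (g d (?T x))) = sqrt (det (g c x))" if "x \<in> ?S" for x
  proof -
    let ?J = "matrix (frechet_derivative ?T (at x))"
    have "x \<in> snd c ` (fst c \<inter> fst d)" using that sub by blast
    then have "g c x = transpose ?J ** g d (?T x) ** ?J"
      using g c d unfolding riemannian_metric_def Let_def by blast
    then have "det (g c x) = (det ?J)\<^sup>2 * det (g d (?T x))"
      by (simp add: det_mul det_transpose power2_eq_square)
    then show ?thesis by (simp add: real_sqrt_mult)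
  qed
  have inj: "inj_on ?T ?S"
  proof (rule inj_onI)
    fix x y assume "x \<in> ?S" "y \<in> ?S" "?T x = ?T y"
    moreover from this obtain p q where pq: "x = snd c p" "y = snd c q" "p \<in> B" "q \<in> B" by blast
    moreover have "p \<in> fst c" "p \<in> fst d" "q \<in> fst c" "q \<in> fst d" using pq(3,4) B(2) by blast+
    ultimately have "snd d p = snd d q" by (simp add: transition_chart[OF _ c])
    then have "p = q"
      by (rule inj_onD[OF chart_inj[OF chart[OF d]]]) fact+
    then show "x = y" using pq by simp
  qed
  have "(\<integral>\<^sup>+x\<in>?T ` ?S. ennreal (sqrt (det (g d x))) \<partial>lborel) =
      (\<integral>\<^sup>+x\<in>?S. ennreal (\<bar>det (matrix (frechet_derivative ?T (at x)))\<bar> * sqrt (det (g d (?T x)))) \<partial>lborel)"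
  proof (rule nn_integral_change_of_variables[OF mc D inj])
    show "?T ` ?S \<in> sets borel" using md TS by simp
    show "(\<lambda>x. indicator (?T ` ?S) x * sqrt (det (g d x))) \<in> borel_measurable borel"
      unfolding TS by (rule indicator_sqrt_det_measurable[OF g d md sub(3)])
    have "(\<lambda>x. indicator ?S x * (\<bar>det (matrix (frechet_derivative ?T (at x)))\<bar> * sqrt (det (g d (?T x)))))
       = (\<lambda>x. indicator ?S x * sqrt (det (g c x)))"
      using jac by (auto simp: fun_eq_iff split: split_indicator)
    then show "(\<lambda>x. indicator ?S x * (\<bar>det (matrix (frechet_derivative ?T (at x)))\<bar> * sqrt (det (g d (?T x))))) \<in> borel_measurable borel"
      using indicator_sqrt_det_measurable[OF g c mc sub(2)] by simp
    show "0 \<le> sqrt (det (g d (?T x)))" if "x \<in> ?S" for x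
    proof -
      have "?T x \<in> snd d ` fst d"
        by (rule subsetD[OF transition_maps[OF c] imageI[OF subsetD[OF sub(1) that]]])
      from det_pos[OF g d this] show ?thesis by simp
    qed
  qed
  also have "\<dots> = (\<integral>\<^sup>+x\<in>?S. ennreal (sqrt (det (g c x))) \<partial>lborel)"
    using jac by (intro nn_integral_cong) (auto split: split_indicator)
  finally show ?thesis
    unfolding TS emeasure_chart_density[OF g c mc sub(2)] emeasure_chart_density[OF g d md sub(3)] by simp
qed

text \<open>The characterization of the Riemannian volume as a predicate, for the proof that it determines
  a measure.\<close>

definition is_volume :: "('a, 'n) metric_field \<Rightarrow> 'a measure \<Rightarrow> bool" where
  "is_volume g \<mu> \<longleftrightarrow> space \<mu> = topspace M \<and>
            sets \<mu> = sigma_sets (topspace M) {U. openin M U} \<and>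
            (\<forall>c\<in>\<A>. \<forall>B\<in>sets \<mu>. B \<subseteq> fst c \<longrightarrow>
               emeasure \<mu> B = (\<integral>\<^sup>+x\<in>snd c ` B. ennreal (sqrt (det (g c x))) \<partial>lborel))"

lemma is_volumeI:
  assumes "riemannian_metric \<A> g" "sets \<mu> = sets (borel_of M)"
    and "\<And>c B. c \<in> \<A> \<Longrightarrow> B \<in> sets (borel_of M) \<Longrightarrow> B \<subseteq> fst c \<Longrightarrow> emeasure \<mu> B = emeasure (chart_density g c) (snd c ` B)"
  shows "is_volume g \<mu>"
  unfolding is_volume_def
proof (intro conjI ballI impI)
  show "space \<mu> = topspace M" using sets_eq_imp_space_eq[OF assms(2)] by simp
  show "sets \<mu> = sigma_sets (topspace M) {U. openin M U}" using assms(2) by (simp add: sets_borel_of)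
  fix c B assume c: "c \<in> \<A>" "B \<in> sets \<mu>" "B \<subseteq> fst c"
  then have B: "B \<in> sets (borel_of M)" using assms(2) by simp
  show "emeasure \<mu> B = (\<integral>\<^sup>+x\<in>snd c ` B. ennreal (sqrt (det (g c x))) \<partial>lborel)"
    unfolding assms(3)[OF c(1) B c(3)]
    by (rule emeasure_chart_density[OF assms(1) c(1) image_borel[OF c(1) B c(3)]]) (use c in blast)
qed

lemma is_volumeD:
  assumes "is_volume g \<mu>"
  shows "sets \<mu> = sets (borel_of M)" "space \<mu> = topspace M"
    "riemannian_metric \<A> g \<Longrightarrow> c \<in> \<A> \<Longrightarrow> B \<in> sets (borel_of M) \<Longrightarrow> B \<subseteq> fst c \<Longrightarrow>
       emeasure \<mu> B = emeasure (chart_density g c) (snd c ` B)"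
proof -
  show s: "sets \<mu> = sets (borel_of M)" "space \<mu> = topspace M"
    using assms by (auto simp: is_volume_def sets_borel_of)
  assume c: "riemannian_metric \<A> g" "c \<in> \<A>" "B \<in> sets (borel_of M)" "B \<subseteq> fst c"
  have "snd c ` B \<subseteq> snd c ` fst c" using c by blast
  from emeasure_chart_density[OF c(1,2) image_borel[OF c(2-4)] this]
  show "emeasure \<mu> B = emeasure (chart_density g c) (snd c ` B)"
    using assms c s by (simp add: is_volume_def)
qed

text \<open>A finite Borel partition of the manifold, each piece of which lies in one chart. It serves
  to define the volume by summing up local contributions.\<close>

definition piece :: "nat \<Rightarrow> 'a set" where
  "piece i = fst (chart_cover M \<A> ! i) - (\<Union>j<i. fst (chart_cover M \<A> ! j))"

lemma cover_nth: "i < length (chart_cover M \<A>) \<Longrightarrow> chart_cover M \<A> ! i \<in> \<A>"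
  using chart_cover_spec nth_mem by blast

lemma piece_borel: "i < length (chart_cover M \<A>) \<Longrightarrow> piece i \<in> sets (borel_of M)"
  unfolding piece_def
  by (intro sets.Diff sets.countable_UN') (auto intro!: open_in_borel_of chart_open cover_nth)

lemma piece_subset: "piece i \<subseteq> fst (chart_cover M \<A> ! i)"
  by (auto simp: piece_def)

lemma piece_disjoint: "disjoint_family piece"
proof -
  have "piece m \<inter> piece n = {}" if "m < n" for m n
    using that by (auto simp: piece_def)
  then show ?thesis
    unfolding disjoint_family_on_def by (metis Int_commute linorder_neqE_nat)
qed

lemma piece_cover: "topspace M \<subseteq> (\<Union>i<length (chart_cover M \<A>). piece i)"
proof
  fix p assume "p \<in> topspace M"
  then obtain c where "c \<in> set (chart_cover M \<A>)" "p \<in> fst c" using chart_cover_spec by blast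
  then have ex: "\<exists>i. i < length (chart_cover M \<A>) \<and> p \<in> fst (chart_cover M \<A> ! i)" by (metis in_set_conv_nth)
  define i where "i = (LEAST i. i < length (chart_cover M \<A>) \<and> p \<in> fst (chart_cover M \<A> ! i))"
  have i: "i < length (chart_cover M \<A>)" "p \<in> fst (chart_cover M \<A> ! i)"
    using LeastI_ex[OF ex] by (auto simp: i_def)
  have "p \<notin> fst (chart_cover M \<A> ! j)" if "j < i" for j
    using not_less_Least[of j] that i(1) unfolding i_def by force
  then show "p \<in> (\<Union>i<length (chart_cover M \<A>). piece i)" using i by (auto simp: piece_def)
qed

lemma emeasure_pieces:
  assumes "sets \<nu> = sets (borel_of M)" "B \<in> sets (borel_of M)"
  shows "emeasure \<nu> B = (\<Sum>i<length (chart_cover M \<A>). emeasure \<nu> (B \<inter> piece i))"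
proof -
  have "(\<Sum>i<length (chart_cover M \<A>). emeasure \<nu> (B \<inter> piece i)) = emeasure \<nu> (\<Union>i<length (chart_cover M \<A>). B \<inter> piece i)"
  proof (rule sum_emeasure)
    show "disjoint_family_on (\<lambda>i. B \<inter> piece i) {..<length (chart_cover M \<A>)}"
      using piece_disjoint unfolding disjoint_family_on_def by blast
  qed (use assms piece_borel in auto)
  also have "(\<Union>i<length (chart_cover M \<A>). B \<inter> piece i) = B"
    using piece_cover borel_of_subset[OF assms(2)] by blast
  finally show ?thesis ..
qed

text \<open>The contributions of the pieces are summed up; by the change of variables formula, the result does
  not depend on the chart in which a set is measured.\<close>

lemma ex_volume:
  assumes g: "riemannian_metric \<A> g"
  shows "\<exists>\<mu>. is_volume g \<mu>"
proof -
  let ?N = "length (chart_cover M \<A>)" and ?c = "\<lambda>i. chart_cover M \<A> ! i"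
  define m where "m = (\<lambda>B. \<Sum>i<?N. emeasure (chart_density g (?c i)) (snd (?c i) ` (B \<inter> piece i)))"
  define \<mu> where "\<mu> = measure_of (topspace M) (sets (borel_of M)) m"
  have img: "snd (?c i) ` (B \<inter> piece i) \<in> sets borel" if "i < ?N" "B \<in> sets (borel_of M)" for i B
    using that piece_borel[OF that(1)] piece_subset[of i] by (intro image_borel cover_nth) auto
  have sa: "sigma_algebra (topspace M) (sets (borel_of M))"
    using sets.sigma_algebra_axioms[of "borel_of M"] by simp
  have sets: "sets \<mu> = sets (borel_of M)"
    unfolding \<mu>_def by (simp add: sigma_algebra.sets_measure_of_eq[OF sa])
  have em: "emeasure \<mu> B = m B" if "B \<in> sets (borel_of M)" for B
    unfolding \<mu>_def
  proof (rule emeasure_measure_of_sigma[OF sa _ _ that])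
    show "positive (sets (borel_of M)) m" by (simp add: positive_def m_def)
    show "countably_additive (sets (borel_of M)) m"
    proof (rule countably_additiveI)
      fix F :: "nat \<Rightarrow> 'a set" assume F: "range F \<subseteq> sets (borel_of M)" "disjoint_family F" "\<Union> (range F) \<in> sets (borel_of M)"
      have "(\<Sum>k. emeasure (chart_density g (?c i)) (snd (?c i) ` (F k \<inter> piece i)))
         = emeasure (chart_density g (?c i)) (snd (?c i) ` (\<Union> (range F) \<inter> piece i))" if i: "i < ?N" for i
      proof -
        have "disjoint_family (\<lambda>k. snd (?c i) ` (F k \<inter> piece i))"
          using F(2) chart_inj[OF chart[OF cover_nth[OF i]]] piece_subset[of i]
          unfolding disjoint_family_on_def inj_on_def by blast
        then have "(\<Sum>k. emeasure (chart_density g (?c i)) (snd (?c i) ` (F k \<inter> piece i)))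
          = emeasure (chart_density g (?c i)) (\<Union>k. snd (?c i) ` (F k \<inter> piece i))"
          using img[OF i] F(1) by (intro suminf_emeasure) auto
        also have "(\<Union>k. snd (?c i) ` (F k \<inter> piece i)) = snd (?c i) ` (\<Union> (range F) \<inter> piece i)" by auto
        finally show ?thesis .
      qed
      then show "(\<Sum>k. m (F k)) = m (\<Union> (range F))"
        unfolding m_def by (subst suminf_sum) auto
    qed
  qed
  have "is_volume g \<mu>"
  proof (rule is_volumeI[OF g sets])
    fix c B assume c: "c \<in> \<A>" and B: "B \<in> sets (borel_of M)" "B \<subseteq> fst c"
    have "emeasure \<mu> B = (\<Sum>i<?N. emeasure (chart_density g c) (snd c ` (B \<inter> piece i)))"
      unfolding em[OF B(1)] m_def
    proof (rule sum.cong[OF refl])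
      fix i assume i: "i \<in> {..<?N}"
      then show "emeasure (chart_density g (?c i)) (snd (?c i) ` (B \<inter> piece i)) = emeasure (chart_density g c) (snd c ` (B \<inter> piece i))"
        using piece_subset[of i] piece_borel[of i] B c cover_nth[of i]
        by (intro chart_density_change[OF g]) auto
    qed
    also have "\<dots> = emeasure (chart_density g c) (\<Union>i<?N. snd c ` (B \<inter> piece i))"
    proof (rule sum_emeasure)
      show "(\<lambda>i. snd c ` (B \<inter> piece i)) ` {..<?N} \<subseteq> sets (chart_density g c)"
        using B piece_borel by (auto intro!: image_borel[OF c])
      show "disjoint_family_on (\<lambda>i. snd c ` (B \<inter> piece i)) {..<?N}"
        using B(2) chart_inj[OF chart[OF c]] piece_disjoint
        unfolding disjoint_family_on_def inj_on_def by blast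
    qed auto
    also have "(\<Union>i<?N. snd c ` (B \<inter> piece i)) = snd c ` B"
      using piece_cover borel_of_subset[OF B(1)] by blast
    finally show "emeasure \<mu> B = emeasure (chart_density g c) (snd c ` B)" .
  qed
  then show ?thesis ..
qed

lemma volume_unique:
  assumes g: "riemannian_metric \<A> g" and m: "is_volume g \<mu>" "is_volume g \<nu>"
  shows "\<mu> = \<nu>"
proof (rule measure_eqI)
  show "sets \<mu> = sets \<nu>" using is_volumeD(1)[OF m(1)] is_volumeD(1)[OF m(2)] by simp
  fix B assume "B \<in> sets \<mu>"
  then have B: "B \<in> sets (borel_of M)" using is_volumeD(1)[OF m(1)] by simp
  have "emeasure \<mu> (B \<inter> piece i) = emeasure \<nu> (B \<inter> piece i)" if i: "i < length (chart_cover M \<A>)" for i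
    using is_volumeD(3)[OF m(1) g cover_nth[OF i]] is_volumeD(3)[OF m(2) g cover_nth[OF i]]
      B piece_borel[OF i] piece_subset[of i] by (metis inf.coboundedI2 sets.Int)
  then show "emeasure \<mu> B = emeasure \<nu> B"
    using emeasure_pieces[OF is_volumeD(1)[OF m(1)] B] emeasure_pieces[OF is_volumeD(1)[OF m(2)] B] by simp
qed

lemma volume_eqI: "riemannian_metric \<A> g \<Longrightarrow> is_volume g \<mu> \<Longrightarrow> riemannian_volume M \<A> g = \<mu>"
  unfolding riemannian_volume_def is_volume_def[symmetric]
  by (rule the_equality) (auto intro: volume_unique)

lemma is_volume_riemannian_volume: "riemannian_metric \<A> g \<Longrightarrow> is_volume g (riemannian_volume M \<A> g)"
  using ex_volume volume_eqI by metis

end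

lemma det_scaleR_matrix: "det (t *\<^sub>R A) = t ^ CARD('n) * det A" for A :: "real^'n::finite^'n"
  using det_rows_mul[of "\<lambda>_. t" "\<lambda>i. A $ i"]
  by (simp add: scalar_mult_eq_scaleR scaleR_vec_def)

context closed_manifold
begin

subsection \<open>Integration in a chart\<close>

lemma chart_measurable_volume:
  assumes g: "riemannian_metric \<A> g" and c: "c \<in> \<A>"
  shows "snd c \<in> measurable (restrict_space (riemannian_volume M \<A> g) (fst c)) borel"
proof (rule borel_measurableI)
  let ?\<mu> = "riemannian_volume M \<A> g"
  note mu = is_volumeD(1,2)[OF is_volume_riemannian_volume[OF g]]
  fix W :: "(real^'n) set" assume "open W"
  from open_in_borel_of[OF chart_preimage_open[OF chart[OF c] this]]
  have 1: "{p \<in> fst c. snd c p \<in> W} \<in> sets ?\<mu>" by (simp add: mu)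
  have 2: "fst c \<in> sets ?\<mu>" by (simp add: mu open_in_borel_of chart_open c)
  have "snd c -` W \<inter> space (restrict_space ?\<mu> (fst c)) = {p \<in> fst c. snd c p \<in> W}"
    using sets.sets_into_space[OF 2] by (auto simp: space_restrict_space)
  then show "snd c -` W \<inter> space (restrict_space ?\<mu> (fst c)) \<in> sets (restrict_space ?\<mu> (fst c))"
    using 1 2 sets.sets_into_space[OF 2] by (auto simp: sets_restrict_space_iff Int_absorb2)
qed

lemma density_measurable:
  assumes g: "riemannian_metric \<A> g" and c: "c \<in> \<A>"
  shows "(\<lambda>x. indicator (snd c ` fst c) x * sqrt (det (g c x))) \<in> borel_measurable borel"
  using image_open[OF c] by (intro indicator_sqrt_det_measurable[OF g c]) auto

text \<open>Integrals over a chart domain reduce to Lebesgue integrals.\<close>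

lemma distr_chart:
  assumes g: "riemannian_metric \<A> g" and c: "c \<in> \<A>"
  shows "distr (restrict_space (riemannian_volume M \<A> g) (fst c)) borel (snd c) = chart_density g c"
proof (rule measure_eqI)
  let ?\<mu> = "riemannian_volume M \<A> g"
  let ?V = "snd c ` fst c"
  note vol = is_volume_riemannian_volume[OF g]
  note mu = is_volumeD(1,2)[OF vol]
  have U: "fst c \<in> sets ?\<mu>" by (simp add: mu open_in_borel_of chart_open c)
  fix E assume "E \<in> sets (distr (restrict_space ?\<mu> (fst c)) borel (snd c))"
  then have E: "E \<in> sets borel" by simp
  define B where "B = snd c -` E \<inter> space (restrict_space ?\<mu> (fst c))"
  have B: "B \<in> sets (restrict_space ?\<mu> (fst c))"
    unfolding B_def by (rule measurable_sets[OF chart_measurable_volume[OF g c] E])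
  have B2: "B \<in> sets ?\<mu>" "B \<subseteq> fst c"
    using B U sets.sets_into_space[OF U] by (auto simp: sets_restrict_space_iff Int_absorb2)
  have img: "snd c ` B = E \<inter> ?V"
    using sets.sets_into_space[OF U] by (auto simp: B_def space_restrict_space)
  have "emeasure (distr (restrict_space ?\<mu> (fst c)) borel (snd c)) E = emeasure (restrict_space ?\<mu> (fst c)) B"
    unfolding B_def by (rule emeasure_distr[OF chart_measurable_volume[OF g c] E])
  also have "\<dots> = emeasure ?\<mu> B"
    using U B2 sets.sets_into_space[OF U] by (intro emeasure_restrict_space) (auto simp: Int_absorb2)
  also have "\<dots> = emeasure (chart_density g c) (E \<inter> ?V)"
    using is_volumeD(3)[OF vol g c] B2 mu img by simp
  also have "\<dots> = emeasure (chart_density g c) E"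
    unfolding chart_density_def using density_measurable[OF g c] image_open[OF c] E
    by (subst (1 2) emeasure_density) (auto intro!: nn_integral_cong split: split_indicator)
  finally show "emeasure (distr (restrict_space ?\<mu> (fst c)) borel (snd c)) E = emeasure (chart_density g c) E" .
qed simp

lemma chart_nn_integral:
  assumes g: "riemannian_metric \<A> g" and c: "c \<in> \<A>" and k: "k \<in> borel_measurable borel"
  shows "(\<integral>\<^sup>+p. k (snd c p) * indicator (fst c) p \<partial>riemannian_volume M \<A> g) =
    (\<integral>\<^sup>+x. ennreal (indicator (snd c ` fst c) x * sqrt (det (g c x))) * k x \<partial>lborel)"
proof -
  let ?\<mu> = "riemannian_volume M \<A> g"
  note mu = is_volumeD(1,2)[OF is_volume_riemannian_volume[OF g]]
  have U: "fst c \<in> sets ?\<mu>" by (simp add: mu open_in_borel_of chart_open c)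
  have "(\<integral>\<^sup>+p. k (snd c p) * indicator (fst c) p \<partial>?\<mu>) = (\<integral>\<^sup>+p. k (snd c p) \<partial>restrict_space ?\<mu> (fst c))"
    using U sets.sets_into_space[OF U] by (subst nn_integral_restrict_space) (auto simp: Int_absorb2)
  also have "\<dots> = (\<integral>\<^sup>+x. k x \<partial>chart_density g c)"
    unfolding distr_chart[OF g c, symmetric] using chart_measurable_volume[OF g c] k
    by (subst nn_integral_distr) auto
  also have "\<dots> = (\<integral>\<^sup>+x. ennreal (indicator (snd c ` fst c) x * sqrt (det (g c x))) * k x \<partial>lborel)"
    unfolding chart_density_def using density_measurable[OF g c] k
    by (subst nn_integral_density) auto
  finally show ?thesis .
qed

lemma chart_integral:
  fixes k :: "real^'n \<Rightarrow> real"
  assumes g: "riemannian_metric \<A> g" and c: "c \<in> \<A>" and k: "k \<in> borel_measurable borel"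
  shows "(\<integral>p. indicator (fst c) p * k (snd c p) \<partial>riemannian_volume M \<A> g) =
    (\<integral>x. indicator (snd c ` fst c) x * sqrt (det (g c x)) * k x \<partial>lborel)"
proof -
  let ?\<mu> = "riemannian_volume M \<A> g"
  note mu = is_volumeD(1,2)[OF is_volume_riemannian_volume[OF g]]
  have U: "fst c \<in> sets ?\<mu>" by (simp add: mu open_in_borel_of chart_open c)
  have "(\<integral>p. indicator (fst c) p * k (snd c p) \<partial>?\<mu>) = (\<integral>p. k (snd c p) \<partial>restrict_space ?\<mu> (fst c))"
    using U sets.sets_into_space[OF U] by (subst integral_restrict_space) (auto simp: Int_absorb2)
  also have "\<dots> = (\<integral>x. k x \<partial>chart_density g c)"
    unfolding distr_chart[OF g c, symmetric] using chart_measurable_volume[OF g c] k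
    by (subst integral_distr) auto
  also have "\<dots> = (\<integral>x. indicator (snd c ` fst c) x * sqrt (det (g c x)) * k x \<partial>lborel)"
  proof -
    have "0 \<le> indicator (snd c ` fst c) x * sqrt (det (g c x))" for x
      using det_pos[OF g c, of x] by (auto split: split_indicator)
    then show ?thesis
      unfolding chart_density_def using density_measurable[OF g c] k
      by (subst integral_density) auto
  qed
  finally show ?thesis .
qed

text \<open>Multiplying the metric by \<open>f\<close> multiplies its determinant by \<open>f\<^sup>n\<close>.\<close>

lemma volume_conformal:
  assumes g: "riemannian_metric \<A> g" and g': "riemannian_metric \<A> g'"
    and f: "chart_continuous f" "\<And>p. p \<in> topspace M \<Longrightarrow> f p > 0"
    and conf: "\<And>c p. c \<in> \<A> \<Longrightarrow> p \<in> fst c \<Longrightarrow> g' c (snd c p) = f p *\<^sub>R g c (snd c p)"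
  shows "riemannian_volume M \<A> g' = density (riemannian_volume M \<A> g) (\<lambda>p. ennreal (f p powr (real CARD('n) / 2)))"
proof (rule volume_eqI[OF g' is_volumeI[OF g']])
  let ?\<mu> = "riemannian_volume M \<A> g" and ?n = "real CARD('n) / 2"
  note mu = is_volumeD(1,2)[OF is_volume_riemannian_volume[OF g]]
  show "sets (density ?\<mu> (\<lambda>p. ennreal (f p powr ?n))) = sets (borel_of M)" by (simp add: mu)
  have fm: "f \<in> borel_measurable ?\<mu>"
    using chart_continuous_measurable[OF f(1)] measurable_cong_sets[OF mu(1) refl] by blast
  fix c B assume c: "c \<in> \<A>" and B: "B \<in> sets (borel_of M)" "B \<subseteq> fst c"
  let ?V = "snd c ` fst c"
  have U: "fst c \<subseteq> topspace M" using chart_open[OF c] openin_subset by blast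
  have V: "open ?V" by (rule image_open[OF c])
  have \<phi>B: "snd c ` B \<in> sets borel" by (rule image_borel[OF c B])
  define k where "k = (\<lambda>x. indicator (snd c ` B) x * (indicator ?V x * f (chart_inv c x)) powr ?n)"
  have "(\<lambda>x. indicator ?V x * f (chart_inv c x)) \<in> borel_measurable borel"
    using borel_measurable_continuous_on_indicator[of ?V "f \<circ> chart_inv c"] V f(1) c
    by (auto simp: chart_continuous_def)
  then have km: "k \<in> borel_measurable borel" unfolding k_def using \<phi>B by measurable
  have kB: "k (snd c p) = indicator B p * f p powr ?n" if "p \<in> fst c" for p
  proof -
    have "snd c p \<in> snd c ` B \<longleftrightarrow> p \<in> B"
      using inj_on_image_mem_iff[OF chart_inj[OF chart[OF c]] that B(2)] .
    then show ?thesis using that chart_inv_left[OF chart[OF c] that] by (auto simp: k_def indicator_def)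
  qed
  have sq: "sqrt (det (g' c (snd c p))) = sqrt (det (g c (snd c p))) * f p powr ?n" if "p \<in> fst c" for p
  proof -
    have "f p > 0" using f(2) that U by blast
    then have "sqrt (f p ^ CARD('n)) = f p powr ?n"
      by (simp add: powr_half_sqrt[symmetric] powr_powr flip: powr_realpow)
    then show ?thesis by (simp add: conf[OF c that] det_scaleR_matrix real_sqrt_mult)
  qed
  have "emeasure (density ?\<mu> (\<lambda>p. ennreal (f p powr ?n))) B = (\<integral>\<^sup>+p. ennreal (f p powr ?n) * indicator B p \<partial>?\<mu>)"
    using fm B mu by (intro emeasure_density) auto
  also have "\<dots> = (\<integral>\<^sup>+p. ennreal (k (snd c p)) * indicator (fst c) p \<partial>?\<mu>)"
    using B(2) kB by (intro nn_integral_cong) (auto split: split_indicator)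
  also have "\<dots> = (\<integral>\<^sup>+x. ennreal (indicator ?V x * sqrt (det (g c x))) * ennreal (k x) \<partial>lborel)"
    using km by (intro chart_nn_integral[OF g c]) simp
  also have "\<dots> = (\<integral>\<^sup>+x\<in>snd c ` B. ennreal (sqrt (det (g' c x))) \<partial>lborel)"
  proof (rule nn_integral_cong)
    fix x
    show "ennreal (indicator ?V x * sqrt (det (g c x))) * ennreal (k x) = ennreal (sqrt (det (g' c x))) * indicator (snd c ` B) x"
    proof (cases "x \<in> snd c ` B")
      case True
      then obtain p where p: "p \<in> B" "x = snd c p" by blast
      have pU: "p \<in> fst c" using p B(2) by blast
      have "0 \<le> sqrt (det (g c x))" using det_pos[OF g c, of x] pU p(2) by force
      then show ?thesis using kB[OF pU] sq[OF pU] p pU True by (simp add: ennreal_mult)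
    qed (simp add: k_def)
  qed
  also have "\<dots> = emeasure (chart_density g' c) (snd c ` B)"
    using B by (intro emeasure_chart_density[symmetric] g' c \<phi>B) blast
  finally show "emeasure (density ?\<mu> (\<lambda>p. ennreal (f p powr ?n))) B = emeasure (chart_density g' c) (snd c ` B)" .
qed

text \<open>Every point has a neighbourhood that lies in a compact coordinate ball, on which the density is
  bounded.\<close>

lemma volume_finite:
  assumes g: "riemannian_metric \<A> g"
  shows "finite_measure (riemannian_volume M \<A> g)"
proof
  let ?\<mu> = "riemannian_volume M \<A> g"
  note vol = is_volume_riemannian_volume[OF g]
  note mu = is_volumeD(1,2)[OF vol]
  have "\<exists>W. openin M W \<and> p \<in> W \<and> emeasure ?\<mu> W < \<infinity>" if p: "p \<in> topspace M" for p
  proof -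
    obtain c where c: "c \<in> \<A>" "p \<in> fst c" using ex_chart[OF p] by blast
    obtain r where r: "r > 0" "cball (snd c p) r \<subseteq> snd c ` fst c" using compact_chart_ball[OF c] by blast
    let ?K = "cball (snd c p) r"
    define W where "W = {q \<in> fst c. snd c q \<in> ball (snd c p) r}"
    have W: "openin M W" unfolding W_def using chart_preimage_open[OF chart[OF c(1)]] by blast
    have "continuous_on ?K (\<lambda>x. sqrt (det (g c x)))"
      by (rule continuous_on_subset[OF continuous_sqrt_det[OF g c(1)] r(2)])
    then have "bounded ((\<lambda>x. sqrt (det (g c x))) ` ?K)"
      by (intro compact_imp_bounded compact_continuous_image) auto
    then obtain C where C: "\<And>x. x \<in> ?K \<Longrightarrow> sqrt (det (g c x)) \<le> C"
      unfolding bounded_iff by (metis abs_le_D1 image_eqI real_norm_def)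
    have Ws: "W \<subseteq> fst c" "snd c ` W \<subseteq> snd c ` fst c" by (auto simp: W_def)
    have "emeasure ?\<mu> W = emeasure (chart_density g c) (snd c ` W)"
      by (rule is_volumeD(3)[OF vol g c(1) open_in_borel_of[OF W] Ws(1)])
    also have "\<dots> = (\<integral>\<^sup>+x\<in>snd c ` W. ennreal (sqrt (det (g c x))) \<partial>lborel)"
      by (rule emeasure_chart_density[OF g c(1) image_borel[OF c(1) open_in_borel_of[OF W] Ws(1)] Ws(2)])
    also have "\<dots> \<le> (\<integral>\<^sup>+x. ennreal C * indicator ?K x \<partial>lborel)"
    proof (rule nn_integral_mono)
      fix x :: "real^'n"
      show "ennreal (sqrt (det (g c x))) * indicator (snd c ` W) x \<le> ennreal C * indicator ?K x"
      proof (cases "x \<in> snd c ` W")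
        case True
        then have "x \<in> ?K" by (auto simp: W_def)
        then show ?thesis using C[of x] True by (simp add: ennreal_leI)
      qed simp
    qed
    also have "\<dots> = ennreal C * emeasure lborel ?K" by (rule nn_integral_cmult_indicator) simp
    also have "\<dots> < \<infinity>" using emeasure_bounded_finite[of ?K] by (simp add: ennreal_mult_less_top)
    finally show ?thesis using W c r by (intro exI[of _ W]) (simp add: W_def)
  qed
  from finite_cover[OF this] obtain \<F> where F: "finite \<F>" "\<forall>W\<in>\<F>. openin M W \<and> emeasure ?\<mu> W < \<infinity>" "topspace M \<subseteq> \<Union>\<F>"
    by blast
  have Fm: "W \<in> sets ?\<mu>" if "W \<in> \<F>" for W using F(2) that by (simp add: mu open_in_borel_of)
  have "emeasure ?\<mu> (space ?\<mu>) \<le> emeasure ?\<mu> (\<Union>W\<in>\<F>. W)"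
    using F(1,3) Fm by (intro emeasure_mono) (auto simp: mu)
  also have "\<dots> \<le> (\<Sum>W\<in>\<F>. emeasure ?\<mu> W)"
    using F(1) Fm by (intro emeasure_subadditive_finite) auto
  also have "\<dots> < \<infinity>"
    using F(1,2) by (induction \<F> rule: finite_induct) (auto simp: ennreal_add_less_top)
  finally show "emeasure ?\<mu> (space ?\<mu>) \<noteq> \<infinity>" by simp
qed

lemma volume_positive:
  assumes g: "riemannian_metric \<A> g"
  shows "total_volume M \<A> g > 0"
proof -
  let ?\<mu> = "riemannian_volume M \<A> g"
  note vol = is_volume_riemannian_volume[OF g]
  note mu = is_volumeD(1,2)[OF vol]
  interpret finite_measure ?\<mu> by (rule volume_finite[OF g])
  have "topspace M \<noteq> {}" using compact_manifold by (simp add: compact_manifold_def)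
  then obtain p where p: "p \<in> topspace M" by blast
  obtain c where c: "c \<in> \<A>" "p \<in> fst c" using ex_chart[OF p] by blast
  obtain r where r: "r > 0" "cball (snd c p) r \<subseteq> snd c ` fst c" using compact_chart_ball[OF c] by blast
  let ?K = "cball (snd c p) r"
  have U: "fst c \<in> sets (borel_of M)" by (simp add: open_in_borel_of chart_open c)
  have "continuous_on ?K (\<lambda>x. sqrt (det (g c x)))"
    by (rule continuous_on_subset[OF continuous_sqrt_det[OF g c(1)] r(2)])
  then obtain x0 where x0: "x0 \<in> ?K" "\<And>x. x \<in> ?K \<Longrightarrow> sqrt (det (g c x0)) \<le> sqrt (det (g c x))"
    using continuous_attains_inf[of ?K "\<lambda>x. sqrt (det (g c x))"] r(1) by force
  define m where "m = sqrt (det (g c x0))"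
  have m: "m > 0" using det_pos[OF g c(1), of x0] x0(1) r(2) by (auto simp: m_def)
  have "measure lborel ?K > 0" using r(1) by (rule content_cball_pos)
  then have "emeasure lborel ?K > 0" by (simp add: measure_def enn2real_positive_iff)
  then have "0 < ennreal m * emeasure lborel ?K" using m by (simp add: ennreal_zero_less_mult_iff)
  also have "\<dots> = (\<integral>\<^sup>+x. ennreal m * indicator ?K x \<partial>lborel)"
    by (rule nn_integral_cmult_indicator[symmetric]) simp
  also have "\<dots> \<le> (\<integral>\<^sup>+x\<in>snd c ` fst c. ennreal (sqrt (det (g c x))) \<partial>lborel)"
    using x0(2) r(2) by (intro nn_integral_mono) (auto split: split_indicator simp: m_def intro!: ennreal_leI)
  also have "\<dots> = emeasure (chart_density g c) (snd c ` fst c)"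
    using image_open[OF c(1)] by (intro emeasure_chart_density[symmetric] g c) auto
  also have "\<dots> = emeasure ?\<mu> (fst c)"
    by (rule is_volumeD(3)[OF vol g c(1) U, symmetric]) simp
  also have "\<dots> \<le> emeasure ?\<mu> (topspace M)"
    using openin_subset[OF chart_open[OF c(1)]] sets.top[of ?\<mu>] by (intro emeasure_mono) (auto simp: mu)
  finally have "0 < emeasure ?\<mu> (topspace M)" .
  then show ?thesis
    unfolding total_volume_def by (simp add: emeasure_eq_measure)
qed

lemma chart_continuous_integrable:
  assumes g: "riemannian_metric \<A> g" and h: "chart_continuous h"
  shows "integrable (riemannian_volume M \<A> g) h"
proof -
  note mu = is_volumeD(1,2)[OF is_volume_riemannian_volume[OF g]]
  interpret finite_measure "riemannian_volume M \<A> g" by (rule volume_finite[OF g])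
  obtain C where C: "\<And>p. p \<in> topspace M \<Longrightarrow> \<bar>h p\<bar> \<le> C" using chart_continuous_bounded[OF h] by blast
  have "h \<in> borel_measurable (riemannian_volume M \<A> g)"
    using chart_continuous_measurable[OF h] measurable_cong_sets[OF mu(1) refl] by blast
  then show ?thesis using C mu by (intro integrable_const_bound[of _ C]) auto
qed

lemma total_sigma2_conformal:
  assumes g: "riemannian_metric \<A> g" and g': "riemannian_metric \<A> g'"
    and f: "chart_continuous f" "\<And>p. p \<in> topspace M \<Longrightarrow> f p > 0"
    and conf: "\<And>c p. c \<in> \<A> \<Longrightarrow> p \<in> fst c \<Longrightarrow> g' c (snd c p) = f p *\<^sub>R g c (snd c p)"
  shows "total_sigma2 M \<A> g' = (\<integral>p. f p powr (real CARD('n) / 2) * sigma2 M \<A> g' p \<partial>riemannian_volume M \<A> g)"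
proof -
  note mu = is_volumeD(1,2)[OF is_volume_riemannian_volume[OF g]]
  have m: "h \<in> borel_measurable (riemannian_volume M \<A> g)" if "chart_continuous h" for h
    using chart_continuous_measurable[OF that] measurable_cong_sets[OF mu(1) refl] by blast
  have eq: "riemannian_volume M \<A> g' = density (riemannian_volume M \<A> g) (\<lambda>p. ennreal (f p powr (real CARD('n) / 2)))"
    by (rule volume_conformal[OF g g' f(1)]) (use f conf in auto)
  show ?thesis
    unfolding total_sigma2_def eq
    using m[OF f(1)] m[OF sigma2_chart_continuous[OF g']] by (subst integral_density) auto
qed

lemma total_volume_conformal_le:
  assumes g: "riemannian_metric \<A> g" and g': "riemannian_metric \<A> g'"
    and f: "chart_continuous f" "\<And>p. p \<in> topspace M \<Longrightarrow> f p > 0" "\<And>p. p \<in> topspace M \<Longrightarrow> f p \<le> C"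
    and conf: "\<And>c p. c \<in> \<A> \<Longrightarrow> p \<in> fst c \<Longrightarrow> g' c (snd c p) = f p *\<^sub>R g c (snd c p)"
  shows "total_volume M \<A> g' \<le> C powr (real CARD('n) / 2) * total_volume M \<A> g"
proof -
  let ?\<mu> = "riemannian_volume M \<A> g" and ?n = "real CARD('n) / 2"
  note mu = is_volumeD(1,2)[OF is_volume_riemannian_volume[OF g]]
  interpret finite_measure ?\<mu> by (rule volume_finite[OF g])
  interpret g': finite_measure "riemannian_volume M \<A> g'" by (rule volume_finite[OF g'])
  have fm: "f \<in> borel_measurable ?\<mu>"
    using chart_continuous_measurable[OF f(1)] measurable_cong_sets[OF mu(1) refl] by blast
  have top: "topspace M \<in> sets ?\<mu>" using sets.top[of ?\<mu>] by (simp add: mu)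
  have "emeasure (riemannian_volume M \<A> g') (topspace M) = (\<integral>\<^sup>+p. ennreal (f p powr ?n) * indicator (topspace M) p \<partial>?\<mu>)"
  proof -
    have "riemannian_volume M \<A> g' = density ?\<mu> (\<lambda>p. ennreal (f p powr ?n))"
      by (rule volume_conformal[OF g g' f(1)]) (use f conf in auto)
    then show ?thesis using fm top by (simp add: emeasure_density)
  qed
  also have "\<dots> \<le> (\<integral>\<^sup>+p. ennreal (C powr ?n) * indicator (topspace M) p \<partial>?\<mu>)"
  proof (rule nn_integral_mono)
    fix p
    have "f p powr ?n \<le> C powr ?n" if "p \<in> topspace M"
      using f(2)[OF that] f(3)[OF that] by (intro powr_mono2) auto
    then show "ennreal (f p powr ?n) * indicator (topspace M) p \<le> ennreal (C powr ?n) * indicator (topspace M) p"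
      by (auto split: split_indicator intro: ennreal_leI)
  qed
  also have "\<dots> = ennreal (C powr ?n) * emeasure ?\<mu> (topspace M)"
    by (rule nn_integral_cmult_indicator[OF top])
  finally have "ennreal (measure (riemannian_volume M \<A> g') (topspace M)) \<le> ennreal (C powr ?n * measure ?\<mu> (topspace M))"
    by (simp add: emeasure_eq_measure g'.emeasure_eq_measure ennreal_mult)
  then show ?thesis by (simp add: total_volume_def)
qed

end

section \<open>Integration by parts and the leading coefficient\<close>

text \<open>By translation invariance the integral of every difference quotient vanishes, and the difference
  quotients converge dominatedly.\<close>

lemma integral_pderivative_compact_support:
  fixes F :: "real^'n::finite \<Rightarrow> real"
  assumes diff: "\<And>x. F differentiable at x" and cont: "continuous_on UNIV (pderivative i F)"
    and supp: "\<And>x. R < norm x \<Longrightarrow> F x = 0"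
  shows "(\<integral>x. pderivative i F x \<partial>lborel) = 0"
proof -
  define h where "h = (\<lambda>n. inverse (real (Suc n)))"
  define e where "e = axis i (1::real)"
  define D where "D = (\<lambda>n x. (F (x + h n *\<^sub>R e) - F x) / h n)"
  have h: "0 < h n" "h n \<le> 1" for n by (auto simp: h_def inverse_le_1_iff)
  have ne: "norm e = 1" by (simp add: e_def)
  have contF: "continuous_on UNIV F"
    using diff by (simp add: continuous_on_eq_continuous_at differentiable_imp_continuous_within)
  have Fm: "F \<in> borel_measurable borel" using contF by (rule borel_measurable_continuous_onI)
  have mvt: "\<exists>r. 0 < r \<and> r < h n \<and> D n x = pderivative i F (x + r *\<^sub>R e)" for n x
    using pderivative_mvt[OF h(1)[of n], of F x i] diff h(1)[of n] by (auto simp: D_def e_def)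
  have "compact (cball (0::real^'n) (R + 2))" by simp
  then have "bounded (pderivative i F ` cball 0 (R + 2))"
    using cont continuous_on_subset by (intro compact_imp_bounded compact_continuous_image) blast+
  then obtain B where B: "\<And>x. norm x \<le> R + 2 \<Longrightarrow> \<bar>pderivative i F x\<bar> \<le> B"
    unfolding bounded_iff by (force simp: dist_norm)
  have Dlim: "(\<lambda>n. D n x) \<longlonglongrightarrow> pderivative i F x" for x
  proof -
    obtain r where r: "\<And>n. 0 < r n" "\<And>n. r n < h n" "\<And>n. D n x = pderivative i F (x + r n *\<^sub>R e)"
      using mvt[of _ x] by metis
    have "h \<longlonglongrightarrow> 0" unfolding h_def by (rule LIMSEQ_inverse_real_of_nat)
    then have "r \<longlonglongrightarrow> 0"
      using r(1,2) by (intro tendsto_sandwich[of "\<lambda>_. 0" r sequentially h]) (auto intro!: always_eventually less_imp_le)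
    then have "(\<lambda>n. x + r n *\<^sub>R e) \<longlonglongrightarrow> x + 0 *\<^sub>R e" by (intro tendsto_intros)
    then have "(\<lambda>n. x + r n *\<^sub>R e) \<longlonglongrightarrow> x" by simp
    moreover have "isCont (pderivative i F) x" using cont by (simp add: continuous_on_eq_continuous_at)
    ultimately show ?thesis unfolding r(3) by (rule isCont_tendsto_compose[rotated])
  qed
  have Dbound: "norm (D n x) \<le> B * indicator (cball 0 (R + 1)) x" for n x
  proof (cases "norm x \<le> R + 1")
    case True
    obtain r where r: "0 < r" "r < h n" "D n x = pderivative i F (x + r *\<^sub>R e)" using mvt by blast
    have "norm (x + r *\<^sub>R e) \<le> norm x + r" using norm_triangle_ineq[of x "r *\<^sub>R e"] r ne by simp
    then have "norm (x + r *\<^sub>R e) \<le> R + 2" using True r h(2)[of n] by linarith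
    from B[OF this] show ?thesis using True r(3) by simp
  next
    case False
    have "norm x \<le> norm (x + h n *\<^sub>R e) + h n"
      using norm_triangle_ineq4[of "x + h n *\<^sub>R e" "h n *\<^sub>R e"] h(1)[of n] ne by simp
    then have "R < norm (x + h n *\<^sub>R e)" using False h(2)[of n] by linarith
    moreover have "R < norm x" using False by linarith
    ultimately show ?thesis using False supp by (simp add: D_def)
  qed
  have intF: "integrable lborel F"
  proof -
    have "F = (\<lambda>x. indicator (cball 0 R) x *\<^sub>R F x)" using supp by (force simp: fun_eq_iff indicator_def)
    moreover have "integrable lborel (\<lambda>x. indicator (cball 0 R) x *\<^sub>R F x)"
      using contF continuous_on_subset by (intro borel_integrable_compact) auto
    ultimately show ?thesis by simp
  qed
  have shift: "integrable lborel (\<lambda>x. F (x + c))" "(\<integral>x. F (x + c) \<partial>lborel) = (\<integral>x. F x \<partial>lborel)" for c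
  proof -
    have d: "distr lborel borel ((+) c) = lborel" by (rule lborel_distr_plus)
    have m: "(+) c \<in> measurable lborel borel" by simp
    have "integrable (distr lborel borel ((+) c)) F" unfolding d by (rule intF)
    then show "integrable lborel (\<lambda>x. F (x + c))"
      using integrable_distr[OF m] by (simp add: add.commute)
    have "(\<integral>x. F x \<partial>distr lborel borel ((+) c)) = (\<integral>x. F (c + x) \<partial>lborel)"
      by (rule integral_distr[OF m Fm])
    then show "(\<integral>x. F (x + c) \<partial>lborel) = (\<integral>x. F x \<partial>lborel)" unfolding d by (simp add: add.commute)
  qed
  have D0: "(\<integral>x. D n x \<partial>lborel) = 0" for n
    unfolding D_def using shift intF by (simp add: Bochner_Integration.integral_diff)
  have "(\<lambda>n. \<integral>x. D n x \<partial>lborel) \<longlonglongrightarrow> (\<integral>x. pderivative i F x \<partial>lborel)"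
  proof (rule integral_dominated_convergence[where w = "\<lambda>x. B * indicator (cball 0 (R + 1)) x"])
    show "pderivative i F \<in> borel_measurable lborel"
      using borel_measurable_continuous_onI[OF cont] by simp
    show "D n \<in> borel_measurable lborel" for n
      unfolding D_def using Fm by measurable
    show "integrable lborel (\<lambda>x::real^'n. B * indicator (cball 0 (R + 1)) x)"
      using emeasure_bounded_finite[of "cball (0::real^'n) (R + 1)"] by (intro integrable_mult_right) (simp add: integrable_indicator_iff)
  qed (use Dlim Dbound in auto)
  then show ?thesis unfolding D0 by (simp add: LIMSEQ_const_iff)
qed

lemma smooth_on_extend_by_zero:
  fixes h :: "real^'n \<Rightarrow> real"
  assumes "open S" "closed L" "L \<subseteq> S" "smooth_on S h" "\<And>x. x \<in> S \<Longrightarrow> x \<notin> L \<Longrightarrow> h x = 0"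
  shows "smooth_on UNIV (\<lambda>x. if x \<in> S then h x else 0)"
proof (rule smooth_on_locally[OF open_UNIV])
  fix x :: "real^'n"
  show "\<exists>T. open T \<and> x \<in> T \<and> smooth_on T (\<lambda>x. if x \<in> S then h x else 0)"
  proof (cases "x \<in> S")
    case True
    have "smooth_on S (\<lambda>x. if x \<in> S then h x else 0)"
      by (rule smooth_on_cong[OF assms(1) _ assms(4)]) simp
    then show ?thesis using True assms(1) by blast
  next
    case False
    have "open (- L)" using assms(2) by auto
    moreover have "smooth_on (- L) (\<lambda>x. if x \<in> S then h x else 0)"
      by (rule smooth_on_cong[OF \<open>open (- L)\<close> _ smooth_on_const[OF \<open>open (- L)\<close>, of 0]]) (use assms(5) in auto)
    ultimately show ?thesis using False assms(3) by blast
  qed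
qed

text \<open>The amplitude vanishes outside of \<open>L\<close>, so that integration by parts over \<open>L\<close> has no boundary terms.\<close>

locale bump_oscillation = oscillation S G L eta e
  for S :: "(real^'n::finite) set" and G L eta e +
  assumes eta_support: "\<And>x. x \<in> S \<Longrightarrow> x \<notin> L \<Longrightarrow> eta x = 0"
    and dim: "CARD('n) \<ge> 5" and eta_nonzero: "\<exists>x\<in>S. eta x \<noteq> 0"
begin

definition intL :: "(real^'n \<Rightarrow> real) \<Rightarrow> real" where
  "intL h = (\<integral>x. indicator L x * h x \<partial>lborel)"

lemma integrable_L: "continuous_on S h \<Longrightarrow> integrable lborel (\<lambda>x. indicator L x * h x)" for h :: "real^'n \<Rightarrow> real"
  using borel_integrable_compact[OF compact_L continuous_on_subset[OF _ L_S], of h] by simp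

lemma intL_add: "continuous_on S f \<Longrightarrow> continuous_on S h \<Longrightarrow> intL (\<lambda>x. f x + h x) = intL f + intL h"
  unfolding intL_def using Bochner_Integration.integral_add[OF integrable_L integrable_L, of f h] by (simp add: distrib_left)

lemma intL_cmult: "intL (\<lambda>x. t * f x) = t * intL f"
  unfolding intL_def by (simp add: mult.left_commute)

lemma intL_mono: "continuous_on S f \<Longrightarrow> continuous_on S h \<Longrightarrow> (\<And>x. x \<in> L \<Longrightarrow> f x \<le> h x) \<Longrightarrow> intL f \<le> intL h"
  unfolding intL_def by (intro integral_mono integrable_L) (auto split: split_indicator)

lemma intL_cong: "(\<And>x. x \<in> L \<Longrightarrow> f x = h x) \<Longrightarrow> intL f = intL h"
  unfolding intL_def by (intro Bochner_Integration.integral_cong) (auto split: split_indicator)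

lemma intL_order:
  assumes "of_order L m F" "\<And>k. continuous_on S (F k)"
  shows "\<exists>C. \<forall>k\<ge>1. \<bar>intL (F k)\<bar> \<le> C * real k ^ m"
proof -
  obtain C where C: "\<And>k x. k \<ge> 1 \<Longrightarrow> x \<in> L \<Longrightarrow> \<bar>F k x\<bar> \<le> C * real k ^ m"
    using assms(1) unfolding of_order_def by blast
  have "\<bar>intL (F k)\<bar> \<le> (C * intL (\<lambda>x. 1)) * real k ^ m" if "k \<ge> 1" for k
  proof -
    have "intL (F k) \<le> intL (\<lambda>x. (C * real k ^ m) * 1)" "intL (\<lambda>x. - (C * real k ^ m) * 1) \<le> intL (F k)"
      using C[OF that] assms(2) by (auto intro!: intL_mono continuous_on_const simp: abs_le_iff minus_le_iff)
    then show ?thesis unfolding intL_cmult by (simp add: abs_le_iff algebra_simps)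
  qed
  then show ?thesis by blast
qed

lemma intL_pderivative:
  assumes h: "smooth_on S h" and h0: "\<And>x. x \<in> S \<Longrightarrow> x \<notin> L \<Longrightarrow> h x = 0"
  shows "intL (pderivative e h) = 0"
proof -
  define F where "F = (\<lambda>x. if x \<in> S then h x else 0)"
  have L: "closed L" using compact_L by (rule compact_imp_closed)
  have F: "smooth_on UNIV F"
    unfolding F_def by (rule smooth_on_extend_by_zero[OF open_S L L_S h h0])
  obtain R where R: "\<And>x. x \<in> L \<Longrightarrow> norm x \<le> R"
    using compact_imp_bounded[OF compact_L] by (auto simp: bounded_iff)
  have F0: "F x = 0" if "x \<notin> L" for x using h0 that by (simp add: F_def)
  have "(\<integral>x. pderivative e F x \<partial>lborel) = 0"
  proof (rule integral_pderivative_compact_support)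
    show "F differentiable at x" for x using smooth_on_imp_differentiable[OF F] by blast
    show "continuous_on UNIV (pderivative e F)"
      by (rule smooth_on_imp_continuous_on[OF smooth_on_pderivative[OF F]])
    show "F x = 0" if "R < norm x" for x using R[of x] F0[of x] that by force
  qed
  moreover have "pderivative e F x = indicator L x * pderivative e h x" for x
  proof (cases "x \<in> L")
    case True
    then have x: "x \<in> S" using L_S by blast
    have "pderivative e h x = pderivative e F x"
      by (rule pderivative_eq_on[OF open_S x _ h]) (simp add: F_def)
    then show ?thesis using True by simp
  next
    case False
    have "pderivative e F x = pderivative e (\<lambda>x. 0) x"
      by (rule pderivative_eq_on[of "- L"]) (use L False F0 smooth_on_subset[OF F] in auto)
    then show ?thesis using False by simp
  qed
  ultimately show ?thesis unfolding intL_def by simp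
qed

definition rho :: "real^'n \<Rightarrow> real" where
  "rho x = (I e e x)\<^sup>2 * sqrt (det (G x))"

lemma smooth_sqrt_det: "smooth_on S (\<lambda>x. sqrt (det (G x)))"
proof (rule smooth_on_cong[OF open_S])
  show "smooth_on S (\<lambda>x. det (G x) powr (1/2))"
    by (intro smooth_on_powr_const smooth_on_det open_S smooth_G_entry det_G_pos)
qed (use det_G_pos in \<open>auto simp: powr_half_sqrt less_imp_le\<close>)

lemma smooth_rho: "smooth_on S rho"
  unfolding rho_def[abs_def] by (intro smooth_on_mult smooth_on_power smooth_I smooth_sqrt_det open_S)

lemma I_ee_pos:
  assumes x: "x \<in> S"
  shows "I e e x > 0"
proof -
  define v where "v = matrix_inv (G x) *v axis e 1"
  have Gv: "G x *v v = axis e 1"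
    unfolding v_def by (simp add: matrix_vector_mul_assoc inv_G[OF x])
  then have "v \<noteq> 0" by (metis axis_eq_0_iff matrix_vector_mult_0_right zero_neq_one)
  from pos_G[OF x this] have "v $ e > 0" by (simp add: Gv inner_axis)
  then show ?thesis by (simp add: v_def I_def matrix_vector_mult_basis column_def)
qed

lemma rho_pos: "x \<in> S \<Longrightarrow> rho x > 0"
  using I_ee_pos[of x] det_G_pos[of x] by (simp add: rho_def)

definition m :: real where "m = real CARD('n) - 4"

lemma m_pos: "m > 0"
  using dim by (simp add: m_def)

definition ex :: "nat \<Rightarrow> real^'n \<Rightarrow> real" where
  "ex k x = exp (m * w k x)"

text \<open>The field whose derivative in the direction \<open>e\<close> is integrated. Its weight is \<open>e\<^bsup>(n-4)w\<^esup> |dx\<^sub>e|\<^sup>4\<close> times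
  the volume density, the weight of \<open>p\<^sup>4\<close> in the total \<open>\<sigma>\<^sub>2\<close>.\<close>

definition F :: "nat \<Rightarrow> real^'n \<Rightarrow> real" where
  "F k x = ex k x * rho x * p k x ^ 3"

lemma smooth_p: "smooth_on S (p k)"
  unfolding p_def[abs_def]
  by (intro smooth_on_mult smooth_on_const smooth_eta smooth_on_sin_cos smooth_phase open_S)

lemma smooth_ex: "smooth_on S (ex k)"
  unfolding ex_def[abs_def] by (intro smooth_on_exp smooth_on_mult smooth_on_const smooth_w open_S)

lemma smooth_F: "smooth_on S (F k)"
  unfolding F_def[abs_def] by (intro smooth_on_mult smooth_on_power smooth_ex smooth_rho smooth_p open_S)

lemma pderivative_p:
  assumes "x \<in> S"
  shows "pderivative e (p k) x = q k x + real k * (cos (real k * x $ e) * pderivative e eta x)"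
  unfolding p_def[abs_def] using assms
  by (simp add: pderivative_mult diff_simps differentiable_mult pderivative_cos_phase q_def algebra_simps power2_eq_square)

lemma pderivative_ex:
  assumes x: "x \<in> S"
  shows "pderivative e (ex k) x = ex k x * (m * (p k x + b e k x))"
proof -
  have d: "(\<lambda>y. m * w k y) differentiable at x" using diff_simps(5)[OF x] by (intro differentiable_mult) auto
  have "pderivative e (ex k) x = exp (m * w k x) * pderivative e (\<lambda>y. m * w k y) x"
    unfolding ex_def[abs_def] by (rule pderivative_compose_real[OF d DERIV_exp])
  then show ?thesis
    using diff_simps(5)[OF x] by (simp add: pderivative_mult pderivative_w[OF x] ex_def)
qed

lemma pderivative_F:
  assumes x: "x \<in> S"
  shows "pderivative e (F k) x = ex k x * rho x * (m * p k x ^ 4 + 3 * (p k x)\<^sup>2 * q k x)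
    + ex k x * ((m * b e k x * rho x + pderivative e rho x) * p k x ^ 3
        + (3 * rho x * (cos (real k * x $ e) * pderivative e eta x)) * (real k * (p k x)\<^sup>2))"
proof -
  note [simp] = smooth_ex[THEN smooth_on_imp_differentiable, OF x] smooth_rho[THEN smooth_on_imp_differentiable, OF x]
    smooth_p[THEN smooth_on_imp_differentiable, OF x]
  have eq: "F k = (\<lambda>x. ex k x * rho x * (p k x * (p k x * p k x)))"
    by (simp add: F_def fun_eq_iff power3_eq_cube)
  show ?thesis
    unfolding eq
    by (simp add: pderivative_mult differentiable_mult pderivative_p[OF x] pderivative_ex[OF x])
       (simp add: algebra_simps power2_eq_square power3_eq_cube power4_eq_xxxx)
qed

lemma order_w: "of_order L 0 w"
  using of_order_mult_bounded[OF order_smooth[OF smooth_eta] order_trig(1)] by (simp add: w_def[abs_def])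

lemma order_ex: "of_order L 0 ex"
proof -
  obtain C where C: "\<And>k x. k \<ge> 1 \<Longrightarrow> x \<in> L \<Longrightarrow> \<bar>w k x\<bar> \<le> C"
    using order_w unfolding of_order_def by auto
  have "\<bar>ex k x\<bar> \<le> exp (m * C)" if "k \<ge> 1" "x \<in> L" for k x
    using C[OF that] m_pos by (simp add: ex_def mult_left_mono)
  then show ?thesis unfolding of_order_def by (intro exI[of _ "exp (m * C)"]) auto
qed

lemma order_p_power: "of_order L j (\<lambda>k x. p k x ^ j)"
proof (induction j)
  case 0
  show ?case using of_order_const[of L 1] by simp
next
  case (Suc j)
  show ?case using of_order_mult[OF order_p Suc] by simp
qed

lemma order_pderivative_F:
  "of_order L 3 (\<lambda>k x. pderivative e (F k) x - ex k x * rho x * (m * p k x ^ 4 + 3 * (p k x)\<^sup>2 * q k x))"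
proof -
  have kp: "of_order L 3 (\<lambda>k x. real k * (p k x)\<^sup>2)"
    using of_order_mult[OF order_k order_p_power[of 2]] by (simp add: numeral_3_eq_3 numeral_2_eq_2)
  have "of_order L 3 (\<lambda>k x. ex k x * ((m * b e k x * rho x + pderivative e rho x) * p k x ^ 3
        + (3 * rho x * (cos (real k * x $ e) * pderivative e eta x)) * (real k * (p k x)\<^sup>2)))"
    by (intro of_order_mult_bounded of_order_add order_ex order_p_power order_b of_order_const order_trig
        order_deriv_eta kp order_smooth[OF smooth_rho] order_smooth[OF smooth_on_pderivative[OF smooth_rho]])
  then show ?thesis
    by (subst of_order_cong) (use L_S pderivative_F in auto)
qed

text \<open>The density of the total \<open>\<sigma>\<^sub>2\<close> of the rescaled metric in coordinates; the volume form contributes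
  \<open>e\<^bsup>nw\<^esup>\<close>.\<close>

definition Phi :: "nat \<Rightarrow> real^'n \<Rightarrow> real" where
  "Phi k x = exp (real CARD('n) * w k x) * local_sigma2 (Gk k) x * sqrt (det (G x))"

lemma smooth_Phi: "smooth_on S (Phi k)"
  unfolding Phi_def[abs_def]
  by (intro smooth_on_mult smooth_on_exp smooth_on_const smooth_w smooth_sqrt_det open_S
      coordinate_metric.smooth_local_sigma2[OF Gk_metric])

text \<open>Integrating \<open>\<partial>\<^sub>e (e\<^bsup>mw\<^esup> \<rho> p\<^sup>3)\<close>, where \<open>m = n - 4\<close>, trades the indefinite term
  \<open>p\<^sup>2 q\<close> for \<open>- (m/3) p\<^sup>4\<close>; the total coefficient of \<open>p\<^sup>4\<close> is then
  \<open>(n - 1) (n - 4) (1/8 - 1/6) < 0\<close>.\<close>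

definition \<kappa> :: real where "\<kappa> = (real CARD('n) - 1) * (real CARD('n) - 4) / 24"

lemma kappa_pos: "\<kappa> > 0"
  using dim by (simp add: \<kappa>_def)

lemma order_Phi:
  "of_order L 3 (\<lambda>k x. Phi k x - ((real CARD('n) - 1) / 6 * pderivative e (F k) x - \<kappa> * (ex k x * rho x * p k x ^ 4)))"
proof -
  let ?n = "real CARD('n)"
  have n3: "CARD('n) \<ge> 3" using dim by simp
  let ?A = "\<lambda>k x. exp (4 * w k x) * local_sigma2 (Gk k) x -
    (I e e x)\<^sup>2 * ((?n - 1) / 2 * (p k x)\<^sup>2 * q k x + (?n - 1) * (?n - 4) / 8 * (p k x) ^ 4)"
  let ?B = "\<lambda>k x. pderivative e (F k) x - ex k x * rho x * (m * p k x ^ 4 + 3 * (p k x)\<^sup>2 * q k x)"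
  have "of_order L 3 (\<lambda>k x. (ex k x * sqrt (det (G x))) * ?A k x - (?n - 1) / 6 * ?B k x)"
    by (intro of_order_diff of_order_mult_bounded[of L "\<lambda>k x. ex k x * sqrt (det (G x))"] of_order_mult_bounded[OF order_ex]
        of_order_cmult sigma2_expansion n3 order_pderivative_F order_smooth[OF smooth_sqrt_det])
  moreover have "Phi k x - ((?n - 1) / 6 * pderivative e (F k) x - \<kappa> * (ex k x * rho x * p k x ^ 4))
     = (ex k x * sqrt (det (G x))) * ?A k x - (?n - 1) / 6 * ?B k x" for k x
  proof -
    have "exp (?n * w k x) = ex k x * exp (4 * w k x)"
      by (simp add: ex_def m_def algebra_simps flip: exp_add)
    then have "Phi k x = (ex k x * sqrt (det (G x))) * (exp (4 * w k x) * local_sigma2 (Gk k) x)"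
      by (simp add: Phi_def mult_ac)
    then show ?thesis
      by (simp add: rho_def \<kappa>_def m_def field_simps)
  qed
  ultimately show ?thesis by simp
qed

text \<open>Another integration by parts, now of \<open>eta\<^sup>4 sin (2 k x\<^sub>e)\<close>: oscillating integrals decay like \<open>1/k\<close>.\<close>

lemma phase_double_integral: "\<exists>C. \<forall>k\<ge>1. \<bar>real k * intL (\<lambda>x. eta x ^ 4 * cos (real (2 * k) * x $ e))\<bar> \<le> C"
proof -
  have sm4: "smooth_on S (\<lambda>x. eta x ^ 4)" by (intro smooth_on_power smooth_eta open_S)
  have "of_order L 0 (\<lambda>k x. pderivative e (\<lambda>x. eta x ^ 4) x * sin (real (2 * k) * x $ e))"
    by (intro of_order_mult_bounded[of L "\<lambda>k x. pderivative e (\<lambda>x. eta x ^ 4) x"]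
        order_smooth[OF smooth_on_pderivative[OF sm4]] of_order_bounded[of L _ 1]) simp
  moreover have "continuous_on S (\<lambda>x. pderivative e (\<lambda>x. eta x ^ 4) x * sin (real (2 * k) * x $ e))" for k
    by (intro smooth_on_imp_continuous_on smooth_on_mult smooth_on_pderivative[OF sm4] smooth_on_sin_cos smooth_phase open_S)
  ultimately obtain C where C: "\<And>k. k \<ge> 1 \<Longrightarrow>
     \<bar>intL (\<lambda>x. pderivative e (\<lambda>x. eta x ^ 4) x * sin (real (2 * k) * x $ e))\<bar> \<le> C"
    using intL_order[of 0 "\<lambda>k x. pderivative e (\<lambda>x. eta x ^ 4) x * sin (real (2 * k) * x $ e)"] by auto
  have "\<bar>real k * intL (\<lambda>x. eta x ^ 4 * cos (real (2 * k) * x $ e))\<bar> \<le> C" if "k \<ge> 1" for k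
  proof -
    have sms: "smooth_on S (\<lambda>x. sin (real (2 * k) * x $ e))"
      by (intro smooth_on_sin_cos smooth_phase open_S)
    have "intL (pderivative e (\<lambda>x. eta x ^ 4 * sin (real (2 * k) * x $ e))) = 0"
      by (rule intL_pderivative[OF smooth_on_mult[OF open_S sm4 sms]]) (simp add: eta_support)
    moreover have "intL (pderivative e (\<lambda>x. eta x ^ 4 * sin (real (2 * k) * x $ e))) =
        intL (\<lambda>x. pderivative e (\<lambda>x. eta x ^ 4) x * sin (real (2 * k) * x $ e) + (2 * real k) * (eta x ^ 4 * cos (real (2 * k) * x $ e)))"
    proof (rule intL_cong)
      fix x assume "x \<in> L"
      then have x: "x \<in> S" using L_S by blast
      show "pderivative e (\<lambda>x. eta x ^ 4 * sin (real (2 * k) * x $ e)) x =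
         pderivative e (\<lambda>x. eta x ^ 4) x * sin (real (2 * k) * x $ e) + (2 * real k) * (eta x ^ 4 * cos (real (2 * k) * x $ e))"
        by (subst pderivative_mult[OF smooth_on_imp_differentiable[OF sm4 x] diff_simps(3)[OF x]])
           (simp only: pderivative_sin_phase[OF x] kd_same, simp)
    qed
    moreover have "\<dots> = intL (\<lambda>x. pderivative e (\<lambda>x. eta x ^ 4) x * sin (real (2 * k) * x $ e))
        + intL (\<lambda>x. (2 * real k) * (eta x ^ 4 * cos (real (2 * k) * x $ e)))"
      by (intro intL_add smooth_on_imp_continuous_on smooth_on_mult smooth_on_const smooth_on_pderivative[OF sm4] sm4
          smooth_on_sin_cos smooth_phase open_S)
    ultimately show ?thesis using C[OF that] unfolding intL_cmult by simp
  qed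
  then show ?thesis by blast
qed

lemma intL_eta_pos: "intL (\<lambda>x. eta x ^ 4) > 0"
proof -
  obtain x0 where x0: "x0 \<in> S" "eta x0 \<noteq> 0" using eta_nonzero by blast
  define \<epsilon> where "\<epsilon> = eta x0 ^ 4 / 2"
  have eps: "\<epsilon> > 0" using x0 by (simp add: \<epsilon>_def)
  have c4: "continuous_on S (\<lambda>x. eta x ^ 4)"
    by (intro smooth_on_imp_continuous_on smooth_on_power smooth_eta open_S)
  have "open ((\<lambda>x. eta x ^ 4) -` {\<epsilon><..} \<inter> S)"
    using continuous_on_open_vimage[OF open_S, of "\<lambda>x. eta x ^ 4"] c4 open_greaterThan by metis
  moreover have "x0 \<in> (\<lambda>x. eta x ^ 4) -` {\<epsilon><..} \<inter> S" using x0 eps by (simp add: \<epsilon>_def)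
  ultimately obtain r where r: "r > 0" "cball x0 r \<subseteq> (\<lambda>x. eta x ^ 4) -` {\<epsilon><..} \<inter> S"
    using open_contains_cball by blast
  have rL: "cball x0 r \<subseteq> L"
  proof
    fix x assume "x \<in> cball x0 r"
    then have "x \<in> S" "eta x ^ 4 > \<epsilon>" using r(2) by auto
    then show "x \<in> L" using eta_support[of x] eps by force
  qed
  have "0 < \<epsilon> * measure lborel (cball x0 r)" using eps content_cball_pos[OF r(1)] by simp
  also have "\<dots> = (\<integral>x. \<epsilon> * indicator (cball x0 r) x \<partial>lborel)" by simp
  also have "\<dots> \<le> intL (\<lambda>x. eta x ^ 4)"
    unfolding intL_def
  proof (rule integral_mono)
    show "integrable lborel (\<lambda>x. \<epsilon> * indicator (cball x0 r) x)"
      using emeasure_bounded_finite[of "cball x0 r"] by (intro integrable_mult_right) (simp add: integrable_indicator_iff)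
    show "integrable lborel (\<lambda>x. indicator L x * eta x ^ 4)" by (rule integrable_L[OF c4])
    show "\<epsilon> * indicator (cball x0 r) x \<le> indicator L x * eta x ^ 4" for x
    proof (cases "x \<in> cball x0 r")
      case True
      then have "x \<in> L" "\<epsilon> < eta x ^ 4" using r(2) rL by blast+
      then show ?thesis using True by simp
    qed (simp split: split_indicator)
  qed
  finally show ?thesis .
qed

lemma cos_power4_ge: "cos t ^ 4 \<ge> 1 / 4 + cos (2 * t) / 2" for t :: real
proof -
  have "0 \<le> ((cos t)\<^sup>2 - 1 / 2)\<^sup>2" by simp
  then have "(cos t)\<^sup>2 - 1 / 4 \<le> cos t ^ 4" by (simp add: power2_eq_square algebra_simps power4_eq_xxxx)
  then show ?thesis unfolding cos_double_cos by argo
qed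

text \<open>The weights are bounded below on \<open>L\<close>. In the lower bound \<open>1/4 + cos (2 t) / 2\<close> for \<open>cos\<^sup>4 t\<close>
  the oscillating term averages out, so that a positive mean value remains.\<close>

lemma intL_p4_lower: "\<exists>a>0. \<exists>C. \<forall>k\<ge>1. a * real k ^ 4 - C * real k ^ 3 \<le> intL (\<lambda>x. ex k x * rho x * p k x ^ 4)"
proof -
  obtain W where W: "\<And>k x. k \<ge> 1 \<Longrightarrow> x \<in> L \<Longrightarrow> \<bar>w k x\<bar> \<le> W"
    using order_w unfolding of_order_def by auto
  have Lne: "L \<noteq> {}" using eta_nonzero eta_support by blast
  have "continuous_on L rho" using smooth_on_imp_continuous_on[OF smooth_rho] L_S continuous_on_subset by blast
  then obtain x1 where x1: "x1 \<in> L" "\<And>x. x \<in> L \<Longrightarrow> rho x1 \<le> rho x"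
    using continuous_attains_inf[OF compact_L Lne] by blast
  define c where "c = exp (- (m * W)) * rho x1"
  have c: "c > 0" using rho_pos[of x1] x1(1) L_S by (auto simp: c_def)
  have cl: "c \<le> ex k x * rho x" if "k \<ge> 1" "x \<in> L" for k x
  proof -
    have "- (m * W) \<le> m * w k x"
      using W[OF that] m_pos by (metis abs_le_D2 minus_le_iff mult_le_cancel_left_pos mult_minus_right)
    then show ?thesis
      unfolding c_def ex_def using x1(2)[OF that(2)] rho_pos[of x1] x1(1) L_S by (intro mult_mono) auto
  qed
  obtain C where C: "\<And>k. k \<ge> 1 \<Longrightarrow> \<bar>real k * intL (\<lambda>x. eta x ^ 4 * cos (real (2 * k) * x $ e))\<bar> \<le> C"
    using phase_double_integral by blast
  define A where "A = intL (\<lambda>x. eta x ^ 4)"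
  have "c * A / 4 * real k ^ 4 - (c * C / 2) * real k ^ 3 \<le> intL (\<lambda>x. ex k x * rho x * p k x ^ 4)" if k: "k \<ge> 1" for k
  proof -
    define J where "J = intL (\<lambda>x. eta x ^ 4 * cos (real (2 * k) * x $ e))"
    have cc: "continuous_on S (\<lambda>x. eta x ^ 4)" "continuous_on S (\<lambda>x. eta x ^ 4 * cos (real (2 * k) * x $ e))"
      "continuous_on S (\<lambda>x. ex k x * rho x * p k x ^ 4)"
      by (intro smooth_on_imp_continuous_on smooth_on_mult smooth_on_power smooth_eta smooth_on_sin_cos
          smooth_phase smooth_ex smooth_rho smooth_p open_S)+
    have "c * real k ^ 4 * (A / 4 + J / 2) = c * real k ^ 4 * intL (\<lambda>x. 1 / 4 * eta x ^ 4 + 1 / 2 * (eta x ^ 4 * cos (real (2 * k) * x $ e)))"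
    proof -
      have "intL (\<lambda>x. 1 / 4 * eta x ^ 4 + 1 / 2 * (eta x ^ 4 * cos (real (2 * k) * x $ e))) = 1 / 4 * A + 1 / 2 * J"
        unfolding A_def J_def intL_cmult[symmetric]
        by (rule intL_add[OF continuous_on_mult[OF continuous_on_const cc(1)] continuous_on_mult[OF continuous_on_const cc(2)]])
      then show ?thesis by simp
    qed
    also have "\<dots> = intL (\<lambda>x. c * real k ^ 4 * (1 / 4 * eta x ^ 4 + 1 / 2 * (eta x ^ 4 * cos (real (2 * k) * x $ e))))"
      by (simp only: intL_cmult)
    also have "\<dots> \<le> intL (\<lambda>x. ex k x * rho x * p k x ^ 4)"
    proof (rule intL_mono[OF _ cc(3)])
      show "continuous_on S (\<lambda>x. c * real k ^ 4 * (1 / 4 * eta x ^ 4 + 1 / 2 * (eta x ^ 4 * cos (real (2 * k) * x $ e))))"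
        by (rule continuous_on_mult[OF continuous_on_const continuous_on_add[OF
                continuous_on_mult[OF continuous_on_const cc(1)] continuous_on_mult[OF continuous_on_const cc(2)]]])
      fix x assume x: "x \<in> L"
      have "c * real k ^ 4 * (1 / 4 * eta x ^ 4 + 1 / 2 * (eta x ^ 4 * cos (real (2 * k) * x $ e)))
         = c * (real k ^ 4 * (eta x ^ 4 * (1 / 4 + cos (2 * (real k * x $ e)) / 2)))" by (simp add: algebra_simps)
      also have "\<dots> \<le> c * (real k ^ 4 * (eta x ^ 4 * cos (real k * x $ e) ^ 4))"
        using c cos_power4_ge[of "real k * x $ e"] by (intro mult_left_mono) auto
      also have "\<dots> = c * p k x ^ 4" by (simp add: p_def power_mult_distrib)
      also have "\<dots> \<le> ex k x * rho x * p k x ^ 4" using cl[OF k x] by (intro mult_right_mono) auto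
      finally show "c * real k ^ 4 * (1 / 4 * eta x ^ 4 + 1 / 2 * (eta x ^ 4 * cos (real (2 * k) * x $ e))) \<le> ex k x * rho x * p k x ^ 4" .
    qed
    finally have 1: "c * real k ^ 4 * (A / 4 + J / 2) \<le> intL (\<lambda>x. ex k x * rho x * p k x ^ 4)" .
    have "- C \<le> real k * J" using C[OF k] by (simp add: J_def abs_le_iff)
    then have "(c * real k ^ 3 / 2) * (- C) \<le> (c * real k ^ 3 / 2) * (real k * J)"
      using c by (intro mult_left_mono) auto
    then have "c * A / 4 * real k ^ 4 - (c * C / 2) * real k ^ 3 \<le> c * real k ^ 4 * (A / 4 + J / 2)"
      by (simp add: algebra_simps power4_eq_xxxx power3_eq_cube)
    then show ?thesis using 1 by linarith
  qed
  moreover have "c * A / 4 > 0" using c intL_eta_pos by (simp add: A_def)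
  ultimately show ?thesis by blast
qed

theorem intL_Phi_unbounded: "\<exists>k\<ge>1. intL (Phi k) \<le> N"
proof -
  let ?R = "\<lambda>k x. Phi k x - ((real CARD('n) - 1) / 6 * pderivative e (F k) x - \<kappa> * (ex k x * rho x * p k x ^ 4))"
  have cPhi: "continuous_on S (Phi k)" "continuous_on S (pderivative e (F k))" "continuous_on S (\<lambda>x. ex k x * rho x * p k x ^ 4)" for k
    by (intro smooth_on_imp_continuous_on smooth_Phi smooth_on_pderivative smooth_F smooth_on_mult smooth_on_power
        smooth_ex smooth_rho smooth_p open_S)+
  have cR: "continuous_on S (?R k)" for k
    by (rule continuous_on_diff[OF cPhi(1) continuous_on_diff[OF continuous_on_mult[OF continuous_on_const cPhi(2)]
            continuous_on_mult[OF continuous_on_const cPhi(3)]]])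
  obtain C where C: "\<And>k. k \<ge> 1 \<Longrightarrow> \<bar>intL (?R k)\<bar> \<le> C * real k ^ 3"
    using intL_order[OF order_Phi cR] by blast
  obtain a C' where a: "a > 0" "\<And>k. k \<ge> 1 \<Longrightarrow> a * real k ^ 4 - C' * real k ^ 3 \<le> intL (\<lambda>x. ex k x * rho x * p k x ^ 4)"
    using intL_p4_lower by blast
  define B where "B = C + \<kappa> * C'"
  have main: "intL (Phi k) \<le> - (real k ^ 3 * (\<kappa> * a * real k - B))" if k: "k \<ge> 1" for k
  proof -
    have "intL (Phi k) = intL (\<lambda>x. ?R k x + ((real CARD('n) - 1) / 6 * pderivative e (F k) x + (- \<kappa>) * (ex k x * rho x * p k x ^ 4)))"
      by (rule intL_cong) simp
    also have "\<dots> = intL (?R k) + intL (\<lambda>x. (real CARD('n) - 1) / 6 * pderivative e (F k) x + (- \<kappa>) * (ex k x * rho x * p k x ^ 4))"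
      by (rule intL_add[OF cR continuous_on_add[OF continuous_on_mult[OF continuous_on_const cPhi(2)]
              continuous_on_mult[OF continuous_on_const cPhi(3)]]])
    also have "intL (\<lambda>x. (real CARD('n) - 1) / 6 * pderivative e (F k) x + (- \<kappa>) * (ex k x * rho x * p k x ^ 4))
       = intL (\<lambda>x. (real CARD('n) - 1) / 6 * pderivative e (F k) x) + intL (\<lambda>x. (- \<kappa>) * (ex k x * rho x * p k x ^ 4))"
      by (rule intL_add[OF continuous_on_mult[OF continuous_on_const cPhi(2)] continuous_on_mult[OF continuous_on_const cPhi(3)]])
    also have "intL (\<lambda>x. (real CARD('n) - 1) / 6 * pderivative e (F k) x) = 0"
      unfolding intL_cmult using intL_pderivative[OF smooth_F[of k]] eta_support by (simp add: F_def p_def)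
    also have "intL (\<lambda>x. (- \<kappa>) * (ex k x * rho x * p k x ^ 4)) = - \<kappa> * intL (\<lambda>x. ex k x * rho x * p k x ^ 4)"
      by (rule intL_cmult)
    finally have "intL (Phi k) = intL (?R k) - \<kappa> * intL (\<lambda>x. ex k x * rho x * p k x ^ 4)" by simp
    moreover have "\<kappa> * (a * real k ^ 4 - C' * real k ^ 3) \<le> \<kappa> * intL (\<lambda>x. ex k x * rho x * p k x ^ 4)"
      using a(2)[OF k] kappa_pos by (intro mult_left_mono) auto
    moreover have "intL (?R k) \<le> C * real k ^ 3" using C[OF k] by linarith
    moreover have "C * real k ^ 3 - \<kappa> * (a * real k ^ 4 - C' * real k ^ 3) = - (real k ^ 3 * (\<kappa> * a * real k - B))"
      by (simp add: B_def algebra_simps power4_eq_xxxx power3_eq_cube)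
    ultimately show ?thesis by linarith
  qed
  have ka: "\<kappa> * a > 0" using kappa_pos a(1) by simp
  obtain k0 :: nat where k0: "(B + \<bar>N\<bar>) / (\<kappa> * a) \<le> real k0" using real_arch_simple by blast
  define k where "k = Suc k0"
  have k: "k \<ge> 1" "(B + \<bar>N\<bar>) / (\<kappa> * a) \<le> real k" using k0 by (auto simp: k_def)
  have "\<bar>N\<bar> \<le> \<kappa> * a * real k - B" using k(2) ka by (simp add: pos_divide_le_eq mult.commute)
  moreover have "1 \<le> real k ^ 3" using k(1) by (simp add: one_le_power)
  ultimately have "1 * \<bar>N\<bar> \<le> real k ^ 3 * (\<kappa> * a * real k - B)" by (intro mult_mono) auto
  then have "intL (Phi k) \<le> N" using main[OF k(1)] by linarith
  then show ?thesis using k(1) by blast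
qed

end

section \<open>A smooth bump function\<close>

text \<open>The functions \<open>P(1/x) e\<^bsup>-1/x\<^esup>\<close> for polynomials \<open>P\<close>, extended by zero to the left, are
  closed under differentiation.\<close>

definition flat :: "real poly \<Rightarrow> real \<Rightarrow> real" where
  "flat P x = (if x > 0 then poly P (inverse x) * exp (- inverse x) else 0)"

lemma poly_exp_tendsto_0: "((\<lambda>y. poly P y * exp (- y)) \<longlongrightarrow> (0::real)) at_top"
proof -
  have "((\<lambda>y. \<Sum>i\<le>degree P. coeff P i * (y ^ i / exp y)) \<longlongrightarrow> (\<Sum>i\<le>degree P. coeff P i * 0)) at_top"
    by (intro tendsto_sum tendsto_mult tendsto_const tendsto_power_div_exp_0)
  moreover have "(\<Sum>i\<le>degree P. coeff P i * (y ^ i / exp y)) = poly P y * exp (- y)" for y :: real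
    by (simp add: poly_altdef sum_distrib_right exp_minus divide_inverse mult.assoc)
  ultimately show ?thesis by simp
qed

lemma flat_tendsto_0: "((\<lambda>x. flat P x) \<longlongrightarrow> 0) (at_right 0)"
proof -
  have "((\<lambda>x. poly P (inverse x) * exp (- inverse x)) \<longlongrightarrow> 0) (at_right (0::real))"
    by (rule filterlim_compose[OF poly_exp_tendsto_0 filterlim_inverse_at_top_right])
  moreover have "\<forall>\<^sub>F x in at_right 0. poly P (inverse x) * exp (- inverse x) = flat P x"
    using eventually_at_right_less[of "0::real"] by eventually_elim (simp add: flat_def)
  ultimately show ?thesis by (rule Lim_transform_eventually)
qed

text \<open>Away from zero this is the chain rule. At zero the difference quotient of the function for \<open>P\<close> is
  the function for \<open>X P\<close>, which tends to zero since the exponential beats every polynomial.\<close>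

lemma flat_derivative:
  "(flat P has_real_derivative flat ([:0, 0, 1:] * (P - pderiv P)) x) (at x)"
proof -
  consider "x > 0" | "x < 0" | "x = 0" by linarith
  then show ?thesis
  proof cases
    case 1
    have "((\<lambda>x. poly P (inverse x) * exp (- inverse x)) has_real_derivative
        flat ([:0, 0, 1:] * (P - pderiv P)) x) (at x)"
      using 1 by (auto intro!: derivative_eq_intros DERIV_chain'[OF _ poly_DERIV]
          simp: flat_def algebra_simps power2_eq_square)
    then show ?thesis
      by (rule has_field_derivative_transform_within_open[of _ _ _ "{0<..}"]) (use 1 in \<open>auto simp: flat_def\<close>)
  next
    case 2
    have "((\<lambda>x. 0) has_real_derivative 0) (at x)" by simp
    then have "(flat P has_real_derivative 0) (at x)"
      by (rule has_field_derivative_transform_within_open[of _ _ _ "{..<0}"]) (use 2 in \<open>auto simp: flat_def\<close>)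
    then show ?thesis using 2 by (simp add: flat_def)
  next
    case 3
    have l: "((\<lambda>h. (flat P (0 + h) - flat P 0) / h) \<longlongrightarrow> 0) (at_left 0)"
    proof (rule Lim_transform_eventually[OF tendsto_const])
      show "\<forall>\<^sub>F h in at_left 0. 0 = (flat P (0 + h) - flat P 0) / h"
        by (auto simp: eventually_at_filter flat_def intro!: always_eventually)
    qed
    have r: "((\<lambda>h. (flat P (0 + h) - flat P 0) / h) \<longlongrightarrow> 0) (at_right 0)"
    proof (rule Lim_transform_eventually[OF flat_tendsto_0[of "pCons 0 P"]])
      show "\<forall>\<^sub>F h in at_right 0. flat (pCons 0 P) h = (flat P (0 + h) - flat P 0) / h"
        using eventually_at_right_less[of "0::real"] by eventually_elim (simp add: flat_def divide_inverse)
    qed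
    have "((\<lambda>h. (flat P (0 + h) - flat P 0) / h) \<longlongrightarrow> 0) (at 0)"
      by (rule filterlim_split_at[OF l r])
    then show ?thesis using 3 by (simp add: DERIV_def flat_def)
  qed
qed

definition bump :: "real^'n \<Rightarrow> real \<Rightarrow> real^'n \<Rightarrow> real" where
  "bump a r x = flat 1 (r\<^sup>2 - (\<Sum>i\<in>UNIV. (x $ i - a $ i)\<^sup>2))"

lemma smooth_bump:
  assumes S: "open S"
  shows "smooth_on S (bump a r)"
  unfolding bump_def[abs_def]
proof (rule smooth_on_compose_real[OF S, where F = "range flat" and T = UNIV and h = "flat 1"])
  show "smooth_on S (\<lambda>x. r\<^sup>2 - (\<Sum>i\<in>UNIV. (x $ i - a $ i)\<^sup>2))"
    by (intro smooth_on_diff smooth_on_const smooth_on_sum smooth_on_power smooth_on_component S)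
qed (use flat_derivative in auto)

lemma sum_squares_norm: "(\<Sum>i\<in>UNIV. (x $ i - a $ i)\<^sup>2) = (norm (x - a))\<^sup>2" for x a :: "real^'n"
  unfolding power2_norm_eq_inner by (simp add: inner_vec_def power2_eq_square)

lemma bump_outside: "r > 0 \<Longrightarrow> x \<notin> cball a r \<Longrightarrow> bump a r x = 0"
proof -
  assume "r > 0" "x \<notin> cball a r"
  then have "r\<^sup>2 \<le> (norm (x - a))\<^sup>2" by (intro power_mono) (auto simp: dist_norm norm_minus_commute)
  then show ?thesis by (simp add: bump_def sum_squares_norm flat_def)
qed

lemma bump_center: "r > 0 \<Longrightarrow> bump a r a \<noteq> 0"
  by (simp add: bump_def flat_def)

lemma bump_bounds: "0 \<le> bump a r x" "bump a r x \<le> 1"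
  by (simp_all add: bump_def flat_def)

section \<open>Locality of the curvature\<close>

lemma (in coordinate_metric) local_sigma2_cong:
  assumes H: "coordinate_metric S H" and eq: "\<And>x. x \<in> S \<Longrightarrow> G x = H x" and x: "x \<in> S"
  shows "local_sigma2 G x = local_sigma2 H x"
proof -
  interpret H: coordinate_metric S H by (rule H)
  have pd: "pderivative l (\<lambda>z. G z $ i $ j) y = pderivative l (\<lambda>z. H z $ i $ j) y" if "y \<in> S" for l i j y
    by (rule pderivative_eq_on[OF open_S that _ smooth_G_entry]) (simp add: eq)
  have chr: "christoffel G k i j y = christoffel H k i j y" if "y \<in> S" for k i j y
    unfolding christoffel_def by (simp add: pd[OF that] eq[OF that])
  have dchr: "pderivative l (christoffel G k i j) x = pderivative l (christoffel H k i j) x" for l k i j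
    by (rule pderivative_eq_on[OF open_S x _ smooth_christoffel]) (simp add: chr)
  have "ricci G x = ricci H x"
    unfolding ricci_def riemann_def by (simp add: dchr chr[OF x])
  then show ?thesis
    by (simp add: local_sigma2_def schouten_def scalar_curvature_def eq[OF x])
qed

section \<open>Oscillating metrics in the conformal class\<close>

context closed_manifold
begin

text \<open>This makes the complement open, so that a function supported in \<open>L\<close> and extended by a constant is
  smooth across the boundary of the chart domain.\<close>

lemma closedin_chart_compact:
  assumes c: "c \<in> \<A>" and L: "compact L" "L \<subseteq> snd c ` fst c"
  shows "closedin M (chart_inv c ` L)"
proof -
  let ?V = "snd c ` fst c"
  have "continuous_map (top_of_set ?V) M (chart_inv c)"
    unfolding continuous_map_def
  proof (intro conjI allI impI)
    show "chart_inv c \<in> topspace (top_of_set ?V) \<rightarrow> topspace M"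
      using chart_inv_right[of _ c] openin_subset[OF chart_open[OF c]] by auto
    fix W assume W: "openin M W"
    have "{x \<in> topspace (top_of_set ?V). chart_inv c x \<in> W} = snd c ` (W \<inter> fst c)"
      using chart_inv_left[OF chart[OF c]] by (auto simp: image_iff) 
    then show "openin (top_of_set ?V) {x \<in> topspace (top_of_set ?V). chart_inv c x \<in> W}"
      using chart_image_open[OF chart[OF c] W] by (auto simp: openin_open)
  qed
  moreover have "compactin (top_of_set ?V) L"
    using L by (simp add: compactin_subtopology)
  ultimately have "compactin M (chart_inv c ` L)" by (rule image_compactin[rotated])
  then show ?thesis
    using compact_manifold compactin_imp_closedin by (auto simp: compact_manifold_def)
qed

lemma chart_continuous_mult: "chart_continuous f \<Longrightarrow> chart_continuous h \<Longrightarrow> chart_continuous (\<lambda>p. f p * h p)"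
  by (auto simp: chart_continuous_def o_def intro!: continuous_on_mult)

lemma chart_continuous_powr:
  assumes "chart_continuous f" "\<And>p. p \<in> topspace M \<Longrightarrow> f p > 0"
  shows "chart_continuous (\<lambda>p. f p powr t)"
  unfolding chart_continuous_def
proof
  fix c assume c: "c \<in> \<A>"
  have "f (chart_inv c x) \<noteq> 0" if "x \<in> snd c ` fst c" for x
    using assms(2)[of "chart_inv c x"] chart_inv_right[OF that] openin_subset[OF chart_open[OF c]] by force
  then show "continuous_on (snd c ` fst c) ((\<lambda>p. f p powr t) \<circ> chart_inv c)"
    using assms(1) c by (auto simp: chart_continuous_def o_def intro!: continuous_on_powr continuous_on_const)
qed

definition rescale :: "('a \<Rightarrow> real) \<Rightarrow> ('a, 'n) metric_field \<Rightarrow> ('a, 'n) metric_field" where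
  "rescale f g c x = f (chart_inv c x) *\<^sub>R g c x"

lemma rescale_chart: "c \<in> \<A> \<Longrightarrow> p \<in> fst c \<Longrightarrow> rescale f g c (snd c p) = f p *\<^sub>R g c (snd c p)"
  by (simp add: rescale_def chart_inv_left[OF chart])

lemma riemannian_metric_rescale:
  assumes g: "riemannian_metric \<A> g" and f: "smooth_function \<A> f" and pos: "\<And>p. p \<in> topspace M \<Longrightarrow> f p > 0"
  shows "riemannian_metric \<A> (rescale f g)"
  unfolding riemannian_metric_def Let_def
proof (intro conjI ballI allI impI)
  fix c assume c: "c \<in> \<A>"
  interpret coordinate_metric "snd c ` fst c" "g c" by (rule chart_coordinate_metric[OF g c])
  have "smooth_on (snd c ` fst c) (\<lambda>x. f (chart_inv c x))"
    using f c by (simp add: smooth_function_def o_def)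
  then show "smooth_on (snd c ` fst c) (rescale f g c)"
    unfolding rescale_def[abs_def] by (intro smooth_on_scaleR open_S smooth_G)
  fix x assume x: "x \<in> snd c ` fst c"
  have fp: "f (chart_inv c x) > 0"
    using pos chart_inv_right[OF x] openin_subset[OF chart_open[OF c]] by blast
  show "transpose (rescale f g c x) = rescale f g c x"
    using sym_G_entry[OF x] by (simp add: vec_eq_iff rescale_def)
  fix v :: "real^'n" assume "v \<noteq> 0"
  then show "v \<bullet> (rescale f g c x *v v) > 0"
    using pos_G[OF x] fp by (simp add: rescale_def scaleR_matrix_vector_assoc[symmetric])
next
  fix c d x assume c: "c \<in> \<A>" "d \<in> \<A>" "x \<in> snd c ` (fst c \<inter> fst d)"
  let ?J = "matrix (frechet_derivative (transition c d) (at x))"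
  obtain p where p: "p \<in> fst c" "p \<in> fst d" "x = snd c p" using c(3) by blast
  have "g c x = transpose ?J ** g d (transition c d x) ** ?J"
    using g c unfolding riemannian_metric_def Let_def by blast
  moreover have "chart_inv d (transition c d x) = chart_inv c x"
    using p c by (simp add: transition_chart chart_inv_left[OF chart])
  ultimately show "rescale f g c x = transpose ?J ** rescale f g d (transition c d x) ** ?J"
    by (simp add: rescale_def matrix_scalar_ac flip: scalar_matrix_assoc)
qed

lemma rescale_conformal:
  assumes "riemannian_metric \<A> g" "smooth_function \<A> f" "\<And>p. p \<in> topspace M \<Longrightarrow> f p > 0"
  shows "rescale f g \<in> conformal_class \<A> g"
proof -
  have "\<forall>c\<in>\<A>. \<forall>p\<in>fst c. f p > 0 \<and> rescale f g c (snd c p) = f p *\<^sub>R g c (snd c p)"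
    using assms(3) rescale_chart chart_open openin_subset by blast
  then show ?thesis
    unfolding conformal_class_def using riemannian_metric_rescale[OF assms] assms(2) by blast
qed

text \<open>The two metrics agree in a neighbourhood of the point, not only at the point.\<close>

lemma sigma2_rescale_outside:
  assumes g: "riemannian_metric \<A> g" and g': "riemannian_metric \<A> (rescale f g)"
    and N: "closedin M N" and f1: "\<And>q. q \<in> topspace M \<Longrightarrow> q \<notin> N \<Longrightarrow> f q = 1"
    and p: "p \<in> topspace M" "p \<notin> N"
  shows "sigma2 M \<A> (rescale f g) p = sigma2 M \<A> g p"
proof -
  obtain d where d: "d \<in> \<A>" "p \<in> fst d" using ex_chart[OF p(1)] by blast
  define S where "S = snd d ` ((topspace M - N) \<inter> fst d)"
  have oS: "open S"
    unfolding S_def using N by (intro chart_image_open[OF chart[OF d(1)]]) (simp add: openin_diff)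
  have S: "S \<subseteq> snd d ` fst d" by (auto simp: S_def)
  interpret G: coordinate_metric S "g d"
    by (rule coordinate_metric_subset[OF chart_coordinate_metric[OF g d(1)] oS S])
  have H: "coordinate_metric S (rescale f g d)"
    by (rule coordinate_metric_subset[OF chart_coordinate_metric[OF g' d(1)] oS S])
  have "g d x = rescale f g d x" if "x \<in> S" for x
  proof -
    obtain q where "q \<in> topspace M" "q \<notin> N" "q \<in> fst d" "x = snd d q" using \<open>x \<in> S\<close> unfolding S_def by blast
    then show ?thesis using f1[of q] rescale_chart[OF d(1), of q f g] by simp
  qed
  moreover have "snd d p \<in> S" using p d by (auto simp: S_def)
  ultimately have "local_sigma2 (g d) (snd d p) = local_sigma2 (rescale f g d) (snd d p)"
    using G.local_sigma2_cong[OF H] by blast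
  then show ?thesis by (simp add: sigma2_eq[OF g d] sigma2_eq[OF g' d])
qed

text \<open>The oscillation lives in a coordinate ball of a single chart. Off the ball nothing changes, so the
  total \<open>\<sigma>\<^sub>2\<close> differs by a constant from an integral over the ball, which is unbounded below. The volume
  stays bounded since \<open>|w| \<le> 1\<close>.\<close>

theorem total_sigma2_unbounded_below:
  assumes g: "riemannian_metric \<A> g" and n: "CARD('n) \<ge> 5"
  shows "\<exists>V. \<forall>B. \<exists>g'\<in>conformal_class \<A> g. riemannian_metric \<A> g' \<and>
     total_volume M \<A> g' \<le> V \<and> total_sigma2 M \<A> g' \<le> B"
proof -
  have "topspace M \<noteq> {}" using compact_manifold by (simp add: compact_manifold_def)
  then obtain p0 where p0: "p0 \<in> topspace M" by blast
  obtain c where c: "c \<in> \<A>" "p0 \<in> fst c" using ex_chart[OF p0] by blast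
  define a where "a = snd c p0"
  obtain r where r: "r > 0" "cball a r \<subseteq> snd c ` fst c" using compact_chart_ball[OF c] unfolding a_def by blast
  define L where "L = cball a r"
  define V where "V = snd c ` fst c"
  interpret cm: coordinate_metric V "g c" unfolding V_def by (rule chart_coordinate_metric[OF g c(1)])
  interpret osc: bump_oscillation V "g c" L "bump a r" "undefined :: 'n"
  proof
    show "compact L" by (simp add: L_def)
    show "L \<subseteq> V" using r by (simp add: L_def V_def)
    show "smooth_on V (bump a r)" by (rule smooth_bump[OF cm.open_S])
    show "bump a r x = 0" if "x \<in> V" "x \<notin> L" for x using bump_outside[OF r(1)] that by (simp add: L_def)
    show "5 \<le> CARD('n)" by (rule n)
    show "\<exists>x\<in>V. bump a r x \<noteq> 0" using bump_center[OF r(1)] c(2) by (auto simp: a_def V_def)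
  qed
  define N where "N = chart_inv c ` L"
  have N: "closedin M N"
    unfolding N_def using r by (intro closedin_chart_compact[OF c(1)]) (auto simp: L_def)
  define f where "f = (\<lambda>k p. if p \<in> fst c then exp (2 * osc.w k (snd c p)) else 1)"
  have fpos: "f k p > 0" for k p by (simp add: f_def)
  have w1: "\<bar>osc.w k x\<bar> \<le> 1" for k x
  proof -
    have "\<bar>bump a r x\<bar> * \<bar>sin (real k * x $ undefined)\<bar> \<le> 1 * 1"
      using bump_bounds[of a r x] by (intro mult_mono) auto
    then show ?thesis by (simp add: osc.w_def abs_mult)
  qed
  have fle: "f k p \<le> exp 2" for k p
    using w1[of k "snd c p"] by (auto simp: f_def abs_le_iff)
  have inN: "snd c q \<in> L \<longleftrightarrow> q \<in> N" if "q \<in> fst c" for q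
  proof
    assume "snd c q \<in> L"
    then show "q \<in> N" unfolding N_def using chart_inv_left[OF chart[OF c(1)] that] by (metis image_eqI)
  next
    assume "q \<in> N"
    then obtain x where x: "x \<in> L" "q = chart_inv c x" by (auto simp: N_def)
    then show "snd c q \<in> L" using chart_inv_right(1)[of x c] r by (auto simp: L_def)
  qed
  have f1: "f k q = 1" if "q \<notin> N" for k q
    using that inN[of q] bump_outside[OF r(1), of "snd c q" a] by (auto simp: f_def osc.w_def L_def)
  have fsm: "smooth_function \<A> (f k)" for k
    unfolding smooth_function_def
  proof
    fix d assume d: "d \<in> \<A>"
    show "smooth_on (snd d ` fst d) (f k \<circ> chart_inv d)"
    proof (rule smooth_on_locally[OF image_open[OF d]])
      fix x assume x: "x \<in> snd d ` fst d"
      then obtain p where p: "p \<in> fst d" "x = snd d p" by blast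
      show "\<exists>T. open T \<and> x \<in> T \<and> smooth_on T (f k \<circ> chart_inv d)"
      proof (cases "p \<in> fst c")
        case True
        let ?T = "snd d ` (fst d \<inter> fst c)"
        have oT: "open ?T" by (rule overlap_open[OF d c(1)])
        have "smooth_on ?T (\<lambda>x. osc.w k (transition d c x))"
          using transition_maps[OF d] osc.smooth_w
          by (intro smooth_on_compose[OF oT _ smooth_transition[OF d c(1)], where U = V]) (auto simp: V_def)
        then have "smooth_on ?T (\<lambda>x. exp (2 * osc.w k (transition d c x)))"
          by (intro smooth_on_exp smooth_on_mult smooth_on_const oT)
        then have "smooth_on ?T (f k \<circ> chart_inv d)"
          by (rule smooth_on_cong[OF oT, rotated])
             (auto simp: f_def transition_chart d chart_inv_left[OF chart[OF d]])
        then show ?thesis using oT True p by blast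
      next
        case False
        let ?T = "snd d ` ((topspace M - N) \<inter> fst d)"
        have oT: "open ?T"
          using N by (intro chart_image_open[OF chart[OF d]]) (simp add: openin_diff)
        have "smooth_on ?T (f k \<circ> chart_inv d)"
          by (rule smooth_on_cong[OF oT _ smooth_on_const[OF oT, of 1]])
             (auto simp: f1 chart_inv_left[OF chart[OF d]])
        moreover have "p \<notin> N" using False r chart_inv_right(2)[of _ c] by (auto simp: N_def L_def)
        moreover have "p \<in> topspace M" using p openin_subset[OF chart_open[OF d]] by blast
        ultimately show ?thesis using oT p by blast
      qed
    qed
  qed
  define gk where "gk = (\<lambda>k. rescale (f k) g)"
  have gk: "riemannian_metric \<A> (gk k)" "gk k \<in> conformal_class \<A> g" for k
    unfolding gk_def using g fsm fpos by (auto intro!: riemannian_metric_rescale rescale_conformal)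
  have fcc: "chart_continuous (f k)" for k by (rule smooth_function_chart_continuous[OF fsm])
  have conf: "gk k d (snd d p) = f k p *\<^sub>R g d (snd d p)" if "d \<in> \<A>" "p \<in> fst d" for k d p
    unfolding gk_def by (rule rescale_chart[OF that])
  have vol: "total_volume M \<A> (gk k) \<le> exp 2 powr (real CARD('n) / 2) * total_volume M \<A> g" for k
    by (rule total_volume_conformal_le[OF g gk(1) fcc]) (use fpos fle conf in auto)
  (* The contribution of the complement of the ball, for the unchanged metric. *)
  define C where "C = total_sigma2 M \<A> g - osc.intL (\<lambda>x. local_sigma2 (g c) x * sqrt (det (g c x)))"
  let ?\<mu> = "riemannian_volume M \<A> g"
  have sig: "total_sigma2 M \<A> (gk k) = osc.intL (osc.Phi k) + C" for k
  proof -
    have GkV: "local_sigma2 (gk k c) x = local_sigma2 (osc.Gk k) x" if "x \<in> V" for x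
    proof -
      interpret K: coordinate_metric V "gk k c" unfolding V_def by (rule chart_coordinate_metric[OF gk(1) c(1)])
      have "gk k c y = osc.Gk k y" if "y \<in> V" for y
      proof -
        obtain q where q: "q \<in> fst c" "y = snd c q" using \<open>y \<in> V\<close> by (auto simp: V_def)
        then show ?thesis using conf[OF c(1) q(1), of k] by (simp add: osc.Gk_def f_def)
      qed
      then show ?thesis by (rule K.local_sigma2_cong[OF osc.Gk_metric _ that])
    qed
    define kk where "kk = (\<lambda>x. indicator L x * (exp (real CARD('n) * osc.w k x) * local_sigma2 (osc.Gk k) x - local_sigma2 (g c) x))"
    have scont: "continuous_on V (local_sigma2 (osc.Gk k))" "continuous_on V (local_sigma2 (g c))" "continuous_on V (osc.w k)"
      "continuous_on V (\<lambda>x. sqrt (det (g c x)))"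
      by (intro smooth_on_imp_continuous_on coordinate_metric.smooth_local_sigma2[OF osc.Gk_metric]
          cm.smooth_local_sigma2 osc.smooth_w osc.smooth_sqrt_det)+
    have kc: "continuous_on L (\<lambda>x. exp (real CARD('n) * osc.w k x) * local_sigma2 (osc.Gk k) x - local_sigma2 (g c) x)"
      using scont osc.L_S continuous_on_subset
      by (intro continuous_on_diff continuous_on_mult continuous_on_exp continuous_on_const) blast+
    have Lb: "L \<in> sets borel" by (simp add: L_def)
    have km: "kk \<in> borel_measurable borel"
      unfolding kk_def using borel_measurable_continuous_on_indicator[OF Lb kc] by simp
    have point: "f k p powr (real CARD('n) / 2) * sigma2 M \<A> (gk k) p - sigma2 M \<A> g p = indicator (fst c) p * kk (snd c p)"
      if p: "p \<in> topspace M" for p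
    proof (cases "p \<in> N")
      case True
      then have pc: "p \<in> fst c" using r chart_inv_right(2)[of _ c] by (auto simp: N_def L_def)
      have pL: "snd c p \<in> L" using inN[OF pc] True by simp
      have "f k p powr (real CARD('n) / 2) = exp (real CARD('n) * osc.w k (snd c p))"
        using pc by (simp add: f_def powr_def)
      moreover have "sigma2 M \<A> (gk k) p = local_sigma2 (osc.Gk k) (snd c p)"
        using sigma2_eq[OF gk(1) c(1) pc] GkV pc by (simp add: V_def)
      ultimately show ?thesis using pc pL sigma2_eq[OF g c(1) pc] by (simp add: kk_def)
    next
      case False
      have "sigma2 M \<A> (gk k) p = sigma2 M \<A> g p"
        unfolding gk_def by (rule sigma2_rescale_outside[OF g gk(1)[unfolded gk_def] N _ p False]) (rule f1)
      moreover have "p \<in> fst c \<Longrightarrow> kk (snd c p) = 0" using inN[of p] False by (simp add: kk_def)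
      ultimately show ?thesis using f1[OF False] by (auto simp: indicator_def)
    qed
    have int1: "integrable ?\<mu> (\<lambda>p. f k p powr (real CARD('n) / 2) * sigma2 M \<A> (gk k) p)"
      by (intro chart_continuous_integrable[OF g] chart_continuous_mult chart_continuous_powr fcc fpos sigma2_chart_continuous gk)
    have int2: "integrable ?\<mu> (sigma2 M \<A> g)"
      by (intro chart_continuous_integrable[OF g] sigma2_chart_continuous g)
    have ts: "total_sigma2 M \<A> (gk k) = (\<integral>p. f k p powr (real CARD('n) / 2) * sigma2 M \<A> (gk k) p \<partial>?\<mu>)"
      by (rule total_sigma2_conformal[OF g gk(1) fcc]) (use fpos conf in auto)
    have "total_sigma2 M \<A> (gk k) - total_sigma2 M \<A> g =
       (\<integral>p. f k p powr (real CARD('n) / 2) * sigma2 M \<A> (gk k) p - sigma2 M \<A> g p \<partial>?\<mu>)"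
      unfolding ts total_sigma2_def[of M \<A> g] by (rule Bochner_Integration.integral_diff[OF int1 int2, symmetric])
    also have "\<dots> = (\<integral>p. indicator (fst c) p * kk (snd c p) \<partial>?\<mu>)"
      by (rule Bochner_Integration.integral_cong[OF refl])
         (use point is_volumeD(2)[OF is_volume_riemannian_volume[OF g]] in auto)
    also have "\<dots> = (\<integral>x. indicator (snd c ` fst c) x * sqrt (det (g c x)) * kk x \<partial>lborel)"
      by (rule chart_integral[OF g c(1) km])
    also have "\<dots> = osc.intL (\<lambda>x. osc.Phi k x + (- 1) * (local_sigma2 (g c) x * sqrt (det (g c x))))"
      unfolding osc.intL_def
      by (rule Bochner_Integration.integral_cong[OF refl])
         (use osc.L_S in \<open>auto simp: kk_def osc.Phi_def V_def algebra_simps split: split_indicator\<close>)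
    also have "\<dots> = osc.intL (osc.Phi k) + osc.intL (\<lambda>x. (- 1) * (local_sigma2 (g c) x * sqrt (det (g c x))))"
      by (rule osc.intL_add) (use scont smooth_on_imp_continuous_on[OF osc.smooth_Phi] in \<open>auto intro!: continuous_on_mult continuous_on_const continuous_on_minus\<close>)
    also have "\<dots> = osc.intL (osc.Phi k) - osc.intL (\<lambda>x. local_sigma2 (g c) x * sqrt (det (g c x)))"
      unfolding osc.intL_cmult by simp
    finally show ?thesis by (simp add: C_def)
  qed
  have "\<exists>g'\<in>conformal_class \<A> g. riemannian_metric \<A> g' \<and>
     total_volume M \<A> g' \<le> exp 2 powr (real CARD('n) / 2) * total_volume M \<A> g \<and> total_sigma2 M \<A> g' \<le> B" for B
  proof -
    obtain k where "osc.intL (osc.Phi k) \<le> B - C" using osc.intL_Phi_unbounded by blast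
    then show ?thesis using gk vol sig[of k] by (intro bexI[of _ "gk k"]) auto
  qed
  then show ?thesis by blast
qed

end

theorem proposition6p1:
  fixes M :: "'a topology"
    and \<A> :: "('a, 'n::finite) chart set"
    and g0 :: "('a, 'n) metric_field"
  assumes "CARD('n) \<ge> 5"
    and "compact_manifold M \<A>"
    and "riemannian_metric \<A> g0"
  shows "(INF g\<in>conformal_class \<A> g0.
            ereal (total_sigma2 M \<A> g /
                   total_volume M \<A> g powr ((real CARD('n) - 4) / real CARD('n)))) = -\<infinity>"
proof (rule ereal_bot)
  interpret closed_manifold M \<A> by standard (rule assms(2))
  define s where "s = (real CARD('n) - 4) / real CARD('n)"
  have s: "s \<ge> 0" using assms(1) by (simp add: s_def)
  obtain V where V: "\<And>B. \<exists>g'\<in>conformal_class \<A> g0. riemannian_metric \<A> g' \<and>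
     total_volume M \<A> g' \<le> V \<and> total_sigma2 M \<A> g' \<le> B"
    using total_sigma2_unbounded_below[OF assms(3,1)] by blast
  (* The volume is only bounded above, so the numerator is driven below a negative multiple of the
     largest possible denominator. *)
  fix N :: real
  obtain g where g: "g \<in> conformal_class \<A> g0" "riemannian_metric \<A> g"
     "total_volume M \<A> g \<le> V" "total_sigma2 M \<A> g \<le> - \<bar>N\<bar> * V powr s"
    using V by blast
  have pos: "total_volume M \<A> g > 0" by (rule volume_positive[OF g(2)])
  have "total_volume M \<A> g powr s \<le> V powr s" using pos g(3) s by (intro powr_mono2) auto
  then have "- \<bar>N\<bar> * V powr s \<le> - \<bar>N\<bar> * total_volume M \<A> g powr s" by (intro mult_left_mono_neg) auto
  then have "total_sigma2 M \<A> g \<le> - \<bar>N\<bar> * total_volume M \<A> g powr s" using g(4) by linarith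
  then have "total_sigma2 M \<A> g / total_volume M \<A> g powr s \<le> - \<bar>N\<bar>"
    using pos by (simp add: pos_divide_le_eq)
  then have "ereal (total_sigma2 M \<A> g / total_volume M \<A> g powr s) \<le> ereal N" by simp
  then show "(INF g\<in>conformal_class \<A> g0. ereal (total_sigma2 M \<A> g /
       total_volume M \<A> g powr ((real CARD('n) - 4) / real CARD('n)))) \<le> ereal N"
    unfolding s_def by (rule INF_lower2[OF g(1)])
qed

end
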